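(* Let $\Omega$ be a smooth bounded open subset of $\mathbb{R}^n$, $n \geq 1$, and let $0 < s < 1$. Assume that $p, q > 0$ and $pq < 1$. Then the problem $$ \begin{cases} (-\Delta)^{s}u = v^p & \text{in } \Omega,\\ (-\Delta)^{s}v = u^q & \text{in } \Omega,\\ u = v = 0 & \text{in } \mathbb{R}^n\setminus\Omega \end{cases} $$ admits a unique positive viscosity solution $(u,v)$ (i.e. there exists exactly one positive viscosity solution).
   Context: For $0<s<1$ the fractional Laplacian is $$(-\Delta)^{s}u(x) = C(n,s)\,\mathrm{P.V.}\int_{\mathbb{R}^{n}}\frac{u(x)-u(y)}{|x-y|^{n+2s}}\,dy,\qquad C(n,s)=\left(\int_{\mathbb{R}^{n}}\frac{1-\cos(\zeta_1)}{|\zeta|^{n+2s}}\,d\zeta\right)^{-1},$$ where P.V. denotes the principal value. Viscosity solutions of the system. A couple $(u,v)$ of continuous functions on $\mathbb{R}^n$ with $u=v=0$ in $\mathbb{R}^n\setminus\Omega$ is a viscosity supersolution if each point $x_0\in\Omega$ admits a neighborhood $U$ with $\overline{U}\subset\Omega$ such that for any $\varphi,\psi\in C^2(\overline{U})$ satisfying $u(x_0)=\varphi(x_0)$, $v(x_0)=\psi(x_0)$, $u\geq\varphi$ and $v\geq\psi$ in $U$, the functions $\overline{u}$ (equal to $\varphi$ in $U$ and to $u$ in $\mathbb{R}^n\setminus U$) and $\overline{v}$ (equal to $\psi$ in $U$ and to $v$ in $\mathbb{R}^n\setminus U$) satisfy $$(-\Delta)^s\overline{u}(x_0)\geq |v(x_0)|^{p-1}v(x_0)\quad\text{and}\quad(-\Delta)^s\overline{v}(x_0)\geq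 |u(x_0)|^{q-1}u(x_0).$$ It is a viscosity subsolution if the same holds with $u\leq\varphi$, $v\leq\psi$ in $U$ in place of $u\geq\varphi$, $v\geq\psi$, and with both final inequalities reversed ($\leq$). It is a viscosity solution if it is both a viscosity subsolution and a viscosity supersolution. It is a positive viscosity solution if in addition $u$ and $v$ are positive in $\Omega$ and nonnegative in $\mathbb{R}^n$.
   Formalization: In the definition of viscosity solution each inequality is required whenever its own test function touches its component, not only for couples φ, ψ touching u and v simultaneously; with simultaneous touching uniqueness fails, since couples never touched at once are vacuously solutions. *)

theory Defs
  imports "HOL-Analysis.Analysis"
begin

section \<open>\<open>C\<^sup>k\<close> functions and smooth domains\<close>

text \<open>\<open>iter_partial [b\<^sub>1, \<dots>, b\<^sub>k] f\<close> is the iterated partial derivative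
  \<open>\<partial>\<^bsub>b\<^sub>1\<^esub> \<dots> \<partial>\<^bsub>b\<^sub>k\<^esub> f\<close>.\<close>

primrec iter_partial :: "'a::euclidean_space list \<Rightarrow> ('a \<Rightarrow> real) \<Rightarrow> 'a \<Rightarrow> real" where
  "iter_partial [] f = f"
| "iter_partial (b # bs) f = (\<lambda>x. frechet_derivative (iter_partial bs f) (at x) b)"

text \<open>The two predicates below are meant for open sets \<open>U\<close>. The second is
  \<open>f \<in> C\<^sup>k(closure U)\<close> in the usual sense: \<open>f\<close> is \<open>C\<^sup>k\<close> in \<open>U\<close> and all its partial
  derivatives up to order \<open>k\<close> extend continuously to the closure of \<open>U\<close>.
  Only the values of \<open>f\<close> on \<open>U\<close> matter.\<close>

definition Ck_on :: "nat \<Rightarrow> 'a::euclidean_space set \<Rightarrow> ('a \<Rightarrow> real) \<Rightarrow> bool" where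
  "Ck_on k U f \<longleftrightarrow>
     (\<forall>bs. set bs \<subseteq> Basis \<and> length bs \<le> k \<longrightarrow> continuous_on U (iter_partial bs f)) \<and>
     (\<forall>bs. set bs \<subseteq> Basis \<and> length bs < k \<longrightarrow> (\<forall>x\<in>U. iter_partial bs f differentiable (at x)))"

definition Ck_closure :: "nat \<Rightarrow> 'a::euclidean_space set \<Rightarrow> ('a \<Rightarrow> real) \<Rightarrow> bool" where
  "Ck_closure k U f \<longleftrightarrow> Ck_on k U f \<and>
     (\<forall>bs. set bs \<subseteq> Basis \<and> length bs \<le> k \<longrightarrow>
       (\<exists>g. continuous_on (closure U) g \<and> (\<forall>x\<in>U. g x = iter_partial bs f x)))"

text \<open>Near each boundary point, \<open>\<Omega>\<close> is the region above the graph of a smooth function. Rather than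
  rotating coordinates, the vertical direction is a unit vector \<open>e\<close>, and a function of the remaining
  \<open>n - 1\<close> variables is a function on the whole space that is invariant in the direction \<open>e\<close>.
  For \<open>n = 1\<close> such a function is a constant.\<close>

definition smooth_domain :: "'a::euclidean_space set \<Rightarrow> bool" where
  "smooth_domain \<Omega> \<longleftrightarrow> open \<Omega> \<and>
     (\<forall>x\<^sub>0\<in>frontier \<Omega>. \<exists>r>0. \<exists>e \<gamma>.
        norm e = 1 \<and> (\<forall>k. Ck_on k UNIV \<gamma>) \<and> (\<forall>x t. \<gamma> (x + t *\<^sub>R e) = \<gamma> x) \<and>
        \<Omega> \<inter> ball x\<^sub>0 r = {x \<in> ball x\<^sub>0 r. \<gamma> x < x \<bullet> e})"

section \<open>The fractional Laplacian\<close>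

text \<open>The class \<open>wellorder\<close> on the index type only serves to single out the first coordinate
  \<open>\<zeta> $ Min UNIV\<close>; the numeral types provide such an index type of each cardinality \<open>n \<ge> 1\<close>.\<close>

definition frac_const :: "'n::{finite,wellorder} itself \<Rightarrow> real \<Rightarrow> real" where
  "frac_const _ s =
     inverse (LINT \<zeta>::real^'n::_|lborel.
       (1 - cos (\<zeta> $ Min UNIV)) / norm \<zeta> powr (real CARD('n) + 2 * s))"

text \<open>The principal value is the limit of the integrals over the complements of the balls of radius
  \<open>\<epsilon> \<rightarrow> 0\<close>. It exists wherever the operator is applied below: there \<open>w\<close> is bounded and Borel
  measurable, and of class \<open>C\<^sup>2\<close> near \<open>x\<close>.\<close>

definition frac_laplacian :: "real \<Rightarrow> (real^'n::{finite,wellorder} \<Rightarrow> real) \<Rightarrow> real^'n::_ \<Rightarrow> real" where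
  "frac_laplacian s w x = frac_const TYPE('n) s *
     Lim (at_right 0) (\<lambda>\<epsilon>. LINT y:- ball x \<epsilon>|lborel.
       (w x - w y) / norm (x - y) powr (real CARD('n) + 2 * s))"

section \<open>Viscosity solutions\<close>

definition glue :: "'a set \<Rightarrow> ('a \<Rightarrow> real) \<Rightarrow> ('a \<Rightarrow> real) \<Rightarrow> 'a \<Rightarrow> real" where
  "glue U \<phi> u = (\<lambda>x. if x \<in> U then \<phi> x else u x)"

definition test_below ::
    "'a::euclidean_space set \<Rightarrow> 'a \<Rightarrow> ('a \<Rightarrow> real) \<Rightarrow> ('a \<Rightarrow> real) \<Rightarrow> bool" where
  "test_below U x\<^sub>0 u \<phi> \<longleftrightarrow> Ck_closure 2 U \<phi> \<and> u x\<^sub>0 = \<phi> x\<^sub>0 \<and> (\<forall>x\<in>U. u x \<ge> \<phi> x)"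

definition test_above ::
    "'a::euclidean_space set \<Rightarrow> 'a \<Rightarrow> ('a \<Rightarrow> real) \<Rightarrow> ('a \<Rightarrow> real) \<Rightarrow> bool" where
  "test_above U x\<^sub>0 u \<phi> \<longleftrightarrow> Ck_closure 2 U \<phi> \<and> u x\<^sub>0 = \<phi> x\<^sub>0 \<and> (\<forall>x\<in>U. u x \<le> \<phi> x)"

definition admissible_couple ::
    "'a::euclidean_space set \<Rightarrow> ('a \<Rightarrow> real) \<Rightarrow> ('a \<Rightarrow> real) \<Rightarrow> bool" where
  "admissible_couple \<Omega> u v \<longleftrightarrow>
     continuous_on UNIV u \<and> continuous_on UNIV v \<and> (\<forall>x. x \<notin> \<Omega> \<longrightarrow> u x = 0 \<and> v x = 0)"

text \<open>Each inequality involves only one of the two test functions and is required whenever that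
  test function touches its component, whether or not the other component can be touched at the same
  point. If the inequalities were required only for pairs \<open>(\<phi>, \<psi>)\<close> touching \<open>u\<close> and \<open>v\<close>
  simultaneously, uniqueness would fail: for \<open>g\<close> smooth and positive in \<open>\<Omega>\<close>, continuous and zero
  outside, and \<open>w\<close> continuous, nowhere differentiable and with \<open>\<bar>w\<bar> \<le> 1\<close>, the functions
  \<open>u = g (1 + w/2)\<close> and \<open>v = g (1 - w/2)\<close> are nowhere in \<open>\<Omega>\<close> simultaneously touched from below (or
  from above), since \<open>w\<close> would be differentiable at such a point.\<close>

definition viscosity_supersolution ::
    "real \<Rightarrow> real \<Rightarrow> real \<Rightarrow> (real^'n::{finite,wellorder}) set \<Rightarrow>
     (real^'n::_ \<Rightarrow> real) \<Rightarrow> (real^'n::_ \<Rightarrow> real) \<Rightarrow> bool" where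
  "viscosity_supersolution s p q \<Omega> u v \<longleftrightarrow> admissible_couple \<Omega> u v \<and>
     (\<forall>x\<^sub>0\<in>\<Omega>. \<exists>U. open U \<and> x\<^sub>0 \<in> U \<and> closure U \<subseteq> \<Omega> \<and>
        (\<forall>\<phi>. test_below U x\<^sub>0 u \<phi> \<longrightarrow>
           frac_laplacian s (glue U \<phi> u) x\<^sub>0 \<ge> \<bar>v x\<^sub>0\<bar> powr (p - 1) * v x\<^sub>0) \<and>
        (\<forall>\<psi>. test_below U x\<^sub>0 v \<psi> \<longrightarrow>
           frac_laplacian s (glue U \<psi> v) x\<^sub>0 \<ge> \<bar>u x\<^sub>0\<bar> powr (q - 1) * u x\<^sub>0))"

definition viscosity_subsolution ::
    "real \<Rightarrow> real \<Rightarrow> real \<Rightarrow> (real^'n::{finite,wellorder}) set \<Rightarrow>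
     (real^'n::_ \<Rightarrow> real) \<Rightarrow> (real^'n::_ \<Rightarrow> real) \<Rightarrow> bool" where
  "viscosity_subsolution s p q \<Omega> u v \<longleftrightarrow> admissible_couple \<Omega> u v \<and>
     (\<forall>x\<^sub>0\<in>\<Omega>. \<exists>U. open U \<and> x\<^sub>0 \<in> U \<and> closure U \<subseteq> \<Omega> \<and>
        (\<forall>\<phi>. test_above U x\<^sub>0 u \<phi> \<longrightarrow>
           frac_laplacian s (glue U \<phi> u) x\<^sub>0 \<le> \<bar>v x\<^sub>0\<bar> powr (p - 1) * v x\<^sub>0) \<and>
        (\<forall>\<psi>. test_above U x\<^sub>0 v \<psi> \<longrightarrow>
           frac_laplacian s (glue U \<psi> v) x\<^sub>0 \<le> \<bar>u x\<^sub>0\<bar> powr (q - 1) * u x\<^sub>0))"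

definition viscosity_solution ::
    "real \<Rightarrow> real \<Rightarrow> real \<Rightarrow> (real^'n::{finite,wellorder}) set \<Rightarrow>
     (real^'n::_ \<Rightarrow> real) \<Rightarrow> (real^'n::_ \<Rightarrow> real) \<Rightarrow> bool" where
  "viscosity_solution s p q \<Omega> u v \<longleftrightarrow>
     viscosity_subsolution s p q \<Omega> u v \<and> viscosity_supersolution s p q \<Omega> u v"

definition positive_viscosity_solution ::
    "real \<Rightarrow> real \<Rightarrow> real \<Rightarrow> (real^'n::{finite,wellorder}) set \<Rightarrow>
     (real^'n::_ \<Rightarrow> real) \<Rightarrow> (real^'n::_ \<Rightarrow> real) \<Rightarrow> bool" where
  "positive_viscosity_solution s p q \<Omega> u v \<longleftrightarrow> viscosity_solution s p q \<Omega> u v \<and>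
     (\<forall>x\<in>\<Omega>. u x > 0 \<and> v x > 0) \<and> (\<forall>x. u x \<ge> 0 \<and> v x \<ge> 0)"

end

theory Submission
  imports Defs
begin

text \<open>Since the operator commutes with translations, a maximum of
  \<open>u(x) - w(y) - N (norm (x - y))\<^sup>2\<close> makes the difference of the integrands of \<open>(- \<Delta>)\<^sup>s u(x)\<close> and
  \<open>(- \<Delta>)\<^sup>s w(y)\<close> nonnegative everywhere, so that comparison holds for semicontinuous viscosity
  sub- and supersolutions of \<open>(- \<Delta>)\<^sup>s u = f\<close> without any regularity theory. For the system, a
  bound \<open>u\<^sub>1 \<le> \<theta> u\<^sub>2\<close> improves to \<open>v\<^sub>1 \<le> \<theta>\<^sup>q v\<^sub>2\<close> and then to
  \<open>u\<^sub>1 \<le> \<theta>\<^bsup>pq\<^esup> u\<^sub>2\<close>; iterating, \<open>p q < 1\<close> gives \<open>u\<^sub>1 \<le> u\<^sub>2\<close>. Some finite \<open>\<theta>\<close> exists because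
  removing a tent from \<open>u\<^sub>2\<close> makes \<open>(- \<Delta>)\<^sup>s u\<^sub>2\<close> strictly positive away from the tent.

  For existence, the operator with its kernel cut off in a ball of radius \<open>\<epsilon>\<close> admits solutions by
  monotone iteration between barriers independent of \<open>\<epsilon>\<close>. Their upper and lower relaxed limits are
  sub- and supersolutions, the upper one vanishes on the boundary by the exterior ball property, and
  comparison shows that the two limits agree.\<close>

section \<open>The kernel\<close>

text \<open>The equation has no zeroth-order term, so the operator itself must exclude a positive
  maximum of a difference: all functions vanish outside a bounded set, and the part of the kernel
  reaching beyond it contributes a fixed positive multiple of that maximum. On the viscosity side
  the obstacle is that the neighborhood \<open>U\<close> belongs to the definition and a test
  function replaces \<open>u\<close> on all of it; to recover an inequality for \<open>u\<close>,
  smooth functions are needed that touch at one point and stay close to \<open>u\<close> elsewhere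
  in \<open>U\<close>. The working notion \<open>sub_at\<close> uses only paraboloids and values of
  the function, so it makes sense for semicontinuous functions and also at boundary points. The
  cut-off problems are solved by bounded Borel functions that may jump at the boundary; continuity
  and boundary values are recovered only in the limit. Besides closing the iteration,
  \<open>p q < 1\<close> makes the inequalities between the constants of the two barriers
  solvable.\<close>

lemma integrable_dyadic:
  fixes f :: "'a::euclidean_space \<Rightarrow> real" and c r :: "nat \<Rightarrow> real"
  assumes meas: "f \<in> borel_measurable borel" and nonneg: "\<And>z. 0 \<le> f z"
    and c: "\<And>j. 0 \<le> c j" and r: "\<And>j. 0 \<le> r j"
    and cover: "\<And>z. f z \<noteq> 0 \<Longrightarrow> \<exists>j. f z \<le> c j \<and> norm z < r j"
    and sums: "(\<lambda>j. c j * r j ^ DIM('a)) sums S"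
  shows "integrable lborel f" and "(\<integral>z. f z \<partial>lborel) \<le> measure lborel (ball (0::'a) 1) * S"
proof -
  define \<omega> where "\<omega> = measure lborel (ball (0::'a) 1)"
  have \<omega>: "0 \<le> \<omega>" by (simp add: \<omega>_def)
  have sums': "(\<lambda>j. \<omega> * (c j * r j ^ DIM('a))) sums (\<omega> * S)"
    using sums by (rule sums_mult)
  have S: "0 \<le> \<omega> * S"
    by (rule sums_le[OF _ sums_zero sums']) (use c r \<omega> in auto)
  have "(\<integral>\<^sup>+z. ennreal (f z) \<partial>lborel) \<le> (\<integral>\<^sup>+z. (\<Sum>j. ennreal (c j) * indicator (ball 0 (r j)) (z::'a)) \<partial>lborel)"
  proof (rule nn_integral_mono)
    fix z :: 'a
    \<comment> \<open>Each nonzero value of \<open>f\<close> is charged to one ball whose constant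
      bounds it. Overlaps of the balls only enlarge the right side, so neither disjoint shells nor
      polar coordinates enter.\<close>
    show "ennreal (f z) \<le> (\<Sum>j. ennreal (c j) * indicator (ball 0 (r j)) z)"
    proof (cases "f z = 0")
      case False
      then obtain j where j: "f z \<le> c j" "norm z < r j" using cover by blast
      have "ennreal (f z) \<le> ennreal (c j) * indicator (ball 0 (r j)) z"
        using j by (simp add: ennreal_leI)
      also have "\<dots> = sum (\<lambda>i. ennreal (c i) * indicator (ball 0 (r i)) z) {j}"
        by (subst sum.insert) auto
      also have "\<dots> \<le> (\<Sum>i. ennreal (c i) * indicator (ball 0 (r i)) z)"
        by (rule sum_le_suminf) auto
      finally show ?thesis .
    qed simp
  qed
  also have "\<dots> = (\<Sum>j. \<integral>\<^sup>+z. ennreal (c j) * indicator (ball 0 (r j)) (z::'a) \<partial>lborel)"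
    by (rule nn_integral_suminf) (auto intro!: borel_measurable_times_ennreal borel_measurable_indicator)
  also have "\<dots> = (\<Sum>j. ennreal (\<omega> * (c j * r j ^ DIM('a))))"
  proof (rule suminf_cong)
    fix j
    have "emeasure lborel (ball (0::'a) (r j)) = ennreal (measure lborel (ball (0::'a) (r j)))"
      using emeasure_lborel_ball_finite[of "0::'a" "r j"] by (intro emeasure_eq_ennreal_measure) auto
    also have "measure lborel (ball (0::'a) (r j)) = r j ^ DIM('a) * \<omega>"
      using content_ball_conv_unit_ball[of "r j" "0::'a"] r by (simp add: \<omega>_def)
    finally show "(\<integral>\<^sup>+z. ennreal (c j) * indicator (ball 0 (r j)) (z::'a) \<partial>lborel) = ennreal (\<omega> * (c j * r j ^ DIM('a)))"
      using c r \<omega> by (simp add: nn_integral_cmult_indicator ennreal_mult[symmetric] mult_ac)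
  qed
  also have "\<dots> = ennreal (\<omega> * S)"
    using c r \<omega> by (intro suminf_ennreal_eq[OF _ sums']) auto
  finally have le: "(\<integral>\<^sup>+z. ennreal (f z) \<partial>lborel) \<le> ennreal (\<omega> * S)" .
  show int: "integrable lborel f"
    using le meas nonneg by (intro integrableI_nonneg) (auto intro: le_less_trans)
  show "(\<integral>z. f z \<partial>lborel) \<le> measure lborel (ball (0::'a) 1) * S"
    using le S nonneg nn_integral_eq_integral[OF int]
    by (simp add: \<omega>_def)
qed

text \<open>Division by zero makes the value at \<open>z = 0\<close> equal to 0, so the singular
  point never spoils a pointwise bound from above.\<close>

definition kern :: "real \<Rightarrow> 'a::euclidean_space \<Rightarrow> real" where
  "kern s z = 1 / norm z powr (real DIM('a) + 2 * s)"

definition trunc_kern :: "real \<Rightarrow> real \<Rightarrow> 'a::euclidean_space \<Rightarrow> real" where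
  "trunc_kern s \<delta> z = (if \<delta> \<le> norm z then kern s z else 0)"

text \<open>The kernel as seen by a paraboloid: the factor \<open>(norm z)\<^sup>2\<close>
  compensates the singularity, and the product is integrable at the origin because
  \<open>s < 1\<close>.\<close>

definition moment_kern :: "real \<Rightarrow> real \<Rightarrow> 'a::euclidean_space \<Rightarrow> real" where
  "moment_kern s \<delta> z = (if norm z < \<delta> then (norm z)\<^sup>2 * kern s z else 0)"

definition kern_tail :: "'a::euclidean_space itself \<Rightarrow> real \<Rightarrow> real \<Rightarrow> real" where
  "kern_tail _ s \<delta> = (\<integral>z. trunc_kern s \<delta> (z::'a) \<partial>lborel)"

definition kern_moment :: "'a::euclidean_space itself \<Rightarrow> real \<Rightarrow> real \<Rightarrow> real" where
  "kern_moment _ s \<delta> = (\<integral>z. moment_kern s \<delta> (z::'a) \<partial>lborel)"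

lemma kern_nonneg [simp]: "0 \<le> kern s z" by (simp add: kern_def)
lemma kern_minus [simp]: "kern s (- z) = kern s z" by (simp add: kern_def)
lemma kern_pos: "z \<noteq> 0 \<Longrightarrow> 0 < kern s z" by (simp add: kern_def)
lemma kern_antimono:
  fixes y z :: "'a::euclidean_space"
  assumes "0 < s" "0 < norm y" "norm y \<le> norm z" shows "kern s z \<le> kern s y"
  unfolding kern_def using assms by (intro divide_left_mono powr_mono2 mult_pos_pos) auto
lemma trunc_kern_nonneg [simp]: "0 \<le> trunc_kern s \<delta> z" by (simp add: trunc_kern_def)
lemma moment_kern_nonneg [simp]: "0 \<le> moment_kern s \<delta> z" by (simp add: moment_kern_def)
lemma trunc_kern_minus [simp]: "trunc_kern s \<delta> (- z) = trunc_kern s \<delta> z" by (simp add: trunc_kern_def)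

lemma kern_measurable [measurable]: "kern s \<in> borel_measurable borel"
  unfolding kern_def by measurable
lemma trunc_kern_measurable [measurable]: "trunc_kern s \<delta> \<in> borel_measurable borel"
  unfolding trunc_kern_def by measurable
lemma moment_kern_measurable [measurable]: "moment_kern s \<delta> \<in> borel_measurable borel"
  unfolding moment_kern_def by measurable

lemma dyadic_shell_outer:
  fixes x \<delta> :: real
  assumes "0 < \<delta>" "\<delta> \<le> x"
  obtains j :: nat where "2 ^ j * \<delta> \<le> x" "x < 2 ^ Suc j * \<delta>"
proof -
  obtain m :: nat where m: "x / \<delta> < 2 ^ m"
    using real_arch_pow[of 2 "x / \<delta>"] by auto
  define k where "k = (LEAST m. x / \<delta> < 2 ^ m)"
  have k: "x / \<delta> < 2 ^ k" unfolding k_def using m by (rule LeastI)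
  have "k \<noteq> 0" using k assms by (intro notI) (auto simp: field_simps)
  then obtain j where j: "k = Suc j" using not0_implies_Suc by blast
  have "\<not> x / \<delta> < 2 ^ j" using not_less_Least[of j "\<lambda>m. x / \<delta> < 2 ^ m"] j by (simp add: k_def)
  then show ?thesis using that[of j] k j assms by (auto simp: field_simps)
qed

lemma dyadic_shell_inner:
  fixes x \<delta> :: real
  assumes "0 < x" "x < \<delta>"
  obtains j :: nat where "\<delta> / 2 ^ Suc j \<le> x" "x < \<delta> / 2 ^ j"
proof -
  obtain m :: nat where m: "\<delta> / x < 2 ^ m"
    using real_arch_pow[of 2 "\<delta> / x"] by auto
  define k where "k = (LEAST m. \<delta> / x \<le> 2 ^ m)"
  have k: "\<delta> / x \<le> 2 ^ k" unfolding k_def using less_imp_le[OF m] by (rule LeastI)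
  have "k \<noteq> 0" using k assms by (intro notI) (auto simp: field_simps)
  then obtain j where j: "k = Suc j" using not0_implies_Suc by blast
  have "\<not> \<delta> / x \<le> 2 ^ j" using not_less_Least[of j "\<lambda>m. \<delta> / x \<le> 2 ^ m"] j by (simp add: k_def)
  then show ?thesis using that[of j] k j assms by (auto simp: field_simps)
qed

text \<open>On the shell between \<open>2 ^ j * \<delta>\<close> and
  \<open>2 ^ Suc j * \<delta>\<close> the bound for the kernel times the volume of the enclosing
  ball is a constant times \<open>(2 powr (- 2 * s)) ^ j\<close>, a convergent geometric series
  because \<open>0 < s\<close>. The exact power of \<open>\<delta>\<close> is recorded for the
  scaling argument at the boundary.\<close>

lemma trunc_kern_integral_aux:
  assumes "0 < s"
  shows "\<exists>K>0. \<forall>\<delta>>0. integrable lborel (trunc_kern s \<delta> :: 'a::euclidean_space \<Rightarrow> real)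
     \<and> kern_tail TYPE('a) s \<delta> \<le> K * \<delta> powr (- 2 * s)"
proof -
  define n where "n = real DIM('a)"
  define \<omega> where "\<omega> = measure lborel (ball (0::'a) 1)"
  have \<omega>: "0 < \<omega>" using content_ball_pos[of 1 "0::'a"] by (simp add: \<omega>_def)
  define q where "q = 2 powr (- 2 * s)"
  have q: "0 < q" "q < 1" using assms by (auto simp: q_def powr_minus field_simps)
  define T where "T = (2 powr n) * (1 / (1 - q))"
  have T: "0 < T" using q by (simp add: T_def)
  have "integrable lborel (trunc_kern s \<delta> :: 'a \<Rightarrow> real) \<and> kern_tail TYPE('a) s \<delta> \<le> \<omega> * T * \<delta> powr (- 2 * s)"
    if \<delta>: "0 < \<delta>" for \<delta>
  proof -
    define c where "c = (\<lambda>j::nat. 1 / (2 ^ j * \<delta>) powr (n + 2 * s))"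
    define r where "r = (\<lambda>j::nat. 2 ^ Suc j * \<delta>)"
    have eq: "c j * r j ^ DIM('a) = (2 powr n * \<delta> powr (- 2 * s)) * q ^ j" for j
    proof -
      have pj: "(2::real) ^ j = 2 powr j" by (simp add: powr_realpow)
      have "r j ^ DIM('a) = (2 powr (real j + 1) * \<delta>) powr n"
        using \<delta> by (simp add: r_def n_def powr_realpow powr_add mult.commute)
      also have "\<dots> = 2 powr ((real j + 1) * n) * \<delta> powr n"
        using \<delta> by (simp add: powr_mult powr_powr)
      finally have 1: "r j ^ DIM('a) = 2 powr ((real j + 1) * n) * \<delta> powr n" .
      have 2: "c j = 2 powr (- real j * (n + 2 * s)) * \<delta> powr (- (n + 2 * s))"
      proof -
        have "c j = (2 powr j * \<delta>) powr (- (n + 2 * s))"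
          unfolding c_def pj by (subst powr_minus) (simp add: divide_inverse)
        then show ?thesis using \<delta> by (simp add: powr_mult powr_powr algebra_simps)
      qed
      have 3: "q ^ j = 2 powr (- 2 * s * j)"
        by (simp add: q_def powr_powr flip: powr_realpow)
      have "c j * r j ^ DIM('a) = (\<delta> powr (- (n + 2 * s)) * \<delta> powr n) *
          (2 powr (- real j * (n + 2 * s)) * 2 powr ((real j + 1) * n))"
        unfolding 1 2 by (simp only: mult_ac)
      also have "\<dots> = \<delta> powr (- 2 * s) * 2 powr (n + (- 2 * s * j))"
        unfolding powr_add[symmetric] by (simp add: algebra_simps)
      finally show ?thesis unfolding 3 powr_add by (simp only: mult_ac)
    qed
    have sums: "(\<lambda>j. c j * r j ^ DIM('a)) sums (T * \<delta> powr (- 2 * s))"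
      unfolding eq using sums_mult[OF geometric_sums[of q], of "2 powr n * \<delta> powr (- 2 * s)"] q
      by (simp add: T_def mult_ac)
    have cover: "\<exists>j. trunc_kern s \<delta> z \<le> c j \<and> norm z < r j" if "trunc_kern s \<delta> z \<noteq> 0" for z :: 'a
    proof -
      have "\<delta> \<le> norm z" using that by (auto simp: trunc_kern_def split: if_splits)
      then obtain j where j: "2 ^ j * \<delta> \<le> norm z" "norm z < 2 ^ Suc j * \<delta>"
        using dyadic_shell_outer \<delta> by blast
      have "trunc_kern s \<delta> z \<le> c j"
        unfolding trunc_kern_def kern_def c_def n_def using j \<delta> assms
        by (auto intro!: divide_left_mono powr_mono2 mult_pos_pos)
      then show ?thesis using j by (auto simp: r_def)
    qed
    show ?thesis
      using integrable_dyadic[OF trunc_kern_measurable trunc_kern_nonneg _ _ cover sums] \<delta>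
      by (simp add: kern_tail_def \<omega>_def c_def r_def mult.assoc)
  qed
  then show ?thesis using \<omega> T by (intro exI[of _ "\<omega> * T"]) auto
qed

text \<open>Here the shells shrink to the origin. The outer radius bounds
  \<open>(norm z)\<^sup>2\<close>, the inner one bounds the kernel, and the ratio of the series is
  \<open>2 powr (- (2 - 2 * s))\<close>, which is below 1 because \<open>s < 1\<close>.\<close>

lemma moment_kern_integral_aux:
  assumes "0 < s" "s < 1"
  shows "\<exists>K>0. \<forall>\<delta>>0. integrable lborel (moment_kern s \<delta> :: 'a::euclidean_space \<Rightarrow> real)
     \<and> kern_moment TYPE('a) s \<delta> \<le> K * \<delta> powr (2 - 2 * s)"
proof -
  define n where "n = real DIM('a)"
  define \<omega> where "\<omega> = measure lborel (ball (0::'a) 1)"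
  have \<omega>: "0 < \<omega>" using content_ball_pos[of 1 "0::'a"] by (simp add: \<omega>_def)
  define q where "q = 2 powr (- (2 - 2 * s))"
  have q: "0 < q" "q < 1" using assms unfolding q_def by (auto simp: powr_minus powr_less_one)
  define T where "T = (2 powr (n + 2 * s)) * (1 / (1 - q))"
  have T: "0 < T" using q by (simp add: T_def)
  have "integrable lborel (moment_kern s \<delta> :: 'a \<Rightarrow> real) \<and> kern_moment TYPE('a) s \<delta> \<le> \<omega> * T * \<delta> powr (2 - 2 * s)"
    if \<delta>: "0 < \<delta>" for \<delta>
  proof -
    define c where "c = (\<lambda>j::nat. (\<delta> / 2 ^ j)\<^sup>2 * (1 / (\<delta> / 2 ^ Suc j) powr (n + 2 * s)))"
    define r where "r = (\<lambda>j::nat. \<delta> / 2 ^ j)"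
    have eq: "c j * r j ^ DIM('a) = (2 powr (n + 2 * s) * \<delta> powr (2 - 2 * s)) * q ^ j" for j
    proof -
      have pj: "\<delta> / (2::real) ^ j = \<delta> * 2 powr (- real j)" for j by (simp add: powr_realpow powr_minus divide_inverse)
      have "r j ^ DIM('a) = (\<delta> * 2 powr (- real j)) powr n"
        using \<delta> by (simp add: r_def n_def powr_realpow pj)
      also have "\<dots> = 2 powr (- real j * n) * \<delta> powr n"
        using \<delta> by (simp add: powr_mult powr_powr)
      finally have 1: "r j ^ DIM('a) = 2 powr (- real j * n) * \<delta> powr n" .
      have sq: "(\<delta> / 2 ^ j)\<^sup>2 = \<delta> powr 2 * 2 powr (- real j * 2)"
      proof -
        have "(\<delta> / 2 ^ j)\<^sup>2 = (\<delta> * 2 powr (- real j)) powr 2"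
          using \<delta> by (simp add: pj)
        then show ?thesis using \<delta> by (simp only: powr_mult powr_powr)
      qed
      have iv: "1 / (\<delta> / 2 ^ Suc j) powr (n + 2 * s) = \<delta> powr (- (n + 2 * s)) * 2 powr ((real j + 1) * (n + 2 * s))"
      proof -
        have "1 / (\<delta> / 2 ^ Suc j) powr (n + 2 * s) = (\<delta> * 2 powr (- real (Suc j))) powr (- (n + 2 * s))"
          unfolding pj by (subst powr_minus) (simp add: divide_inverse)
        also have "\<dots> = \<delta> powr (- (n + 2 * s)) * 2 powr ((- real (Suc j)) * (- (n + 2 * s)))"
          using \<delta> by (simp only: powr_mult powr_powr)
        also have "(- real (Suc j)) * (- (n + 2 * s)) = (real j + 1) * (n + 2 * s)"
          by (simp add: algebra_simps)
        finally show ?thesis .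
      qed
      have 3: "q ^ j = 2 powr (- (2 - 2 * s) * j)"
        unfolding q_def by (subst powr_realpow[symmetric]) (simp_all only: powr_powr, simp)
      have "c j * r j ^ DIM('a) = (\<delta> powr 2 * \<delta> powr (- (n + 2 * s)) * \<delta> powr n) *
          (2 powr (- real j * 2) * 2 powr ((real j + 1) * (n + 2 * s)) * 2 powr (- real j * n))"
        unfolding c_def 1 sq iv by (simp only: mult_ac)
      also have "\<dots> = \<delta> powr (2 - 2 * s) * 2 powr (n + 2 * s + - (2 - 2 * s) * j)"
        unfolding powr_add[symmetric] by (simp add: algebra_simps)
      finally show ?thesis unfolding 3 powr_add by (simp only: mult_ac)
    qed
    have sums: "(\<lambda>j. c j * r j ^ DIM('a)) sums (T * \<delta> powr (2 - 2 * s))"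
      unfolding eq using sums_mult[OF geometric_sums[of q], of "2 powr (n + 2 * s) * \<delta> powr (2 - 2 * s)"] q
      by (simp add: T_def mult_ac)
    have cover: "\<exists>j. moment_kern s \<delta> z \<le> c j \<and> norm z < r j" if "moment_kern s \<delta> z \<noteq> 0" for z :: 'a
    proof -
      have "norm z < \<delta>" "0 < norm z" using that by (auto simp: moment_kern_def split: if_splits)
      then obtain j where j: "\<delta> / 2 ^ Suc j \<le> norm z" "norm z < \<delta> / 2 ^ j"
        using dyadic_shell_inner by blast
      have "1 / norm z powr (n + 2 * s) \<le> 1 / (\<delta> / 2 ^ Suc j) powr (n + 2 * s)"
        using j \<delta> assms \<open>0 < norm z\<close> unfolding n_def
        by (intro divide_left_mono powr_mono2 mult_pos_pos) auto
      moreover have "(norm z)\<^sup>2 \<le> (\<delta> / 2 ^ j)\<^sup>2" using j by (intro power_mono) auto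
      ultimately have "(norm z)\<^sup>2 * (1 / norm z powr (n + 2 * s)) \<le> c j"
        unfolding c_def by (intro mult_mono) auto
      then show ?thesis using j \<open>norm z < \<delta>\<close> by (auto simp: r_def moment_kern_def kern_def n_def)
    qed
    show ?thesis
      using integrable_dyadic[OF moment_kern_measurable moment_kern_nonneg _ _ cover sums] \<delta>
      by (simp add: kern_moment_def \<omega>_def c_def r_def mult.assoc)
  qed
  then show ?thesis using \<omega> T by (intro exI[of _ "\<omega> * T"]) auto
qed

section \<open>Symmetries of Lebesgue integrals and a lower bound on balls\<close>

lemma lborel_integral_uminus:
  fixes f :: "'a::euclidean_space \<Rightarrow> real"
  assumes "f \<in> borel_measurable borel"
  shows "(\<integral>z. f (- z) \<partial>lborel) = (\<integral>z. f z \<partial>lborel)"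
proof -
  have "lborel = distr lborel borel (uminus :: 'a \<Rightarrow> 'a)"
    using lborel_affine[of "-1" "0::'a"] by (simp add: density_1)
  then have "(\<integral>z. f z \<partial>lborel) = (\<integral>z. f z \<partial>distr lborel borel (uminus :: 'a \<Rightarrow> 'a))" by metis
  also have "\<dots> = (\<integral>z. f (- z) \<partial>lborel)"
    using assms by (intro integral_distr) auto
  finally show ?thesis ..
qed

lemma lborel_integral_odd:
  fixes f :: "'a::euclidean_space \<Rightarrow> real"
  assumes "f \<in> borel_measurable borel" "\<And>z. f (- z) = - f z"
  shows "(\<integral>z. f z \<partial>lborel) = 0"
  using lborel_integral_uminus[OF assms(1)] by (simp add: assms(2))

lemma lborel_integral_translate:
  fixes f :: "'a::euclidean_space \<Rightarrow> real"
  assumes "f \<in> borel_measurable borel"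
  shows "(\<integral>z. f (x + z) \<partial>lborel) = (\<integral>z. f z \<partial>lborel)"
proof -
  have "(\<integral>z. f z \<partial>lborel) = (\<integral>z. f z \<partial>distr lborel borel ((+) x))"
    by (simp add: lborel_distr_plus)
  also have "\<dots> = (\<integral>z. f (x + z) \<partial>lborel)"
    using assms by (intro integral_distr) auto
  finally show ?thesis ..
qed

lemma integral_ge_on_ball:
  fixes f :: "'a::euclidean_space \<Rightarrow> real"
  assumes "integrable lborel f" "\<And>z. 0 \<le> f z" "\<And>z. z \<in> ball y r \<Longrightarrow> c \<le> f z"
  shows "c * measure lborel (ball y r) \<le> (\<integral>z. f z \<partial>lborel)"
proof -
  have int: "integrable lborel (indicat_real (ball y r))"
    using emeasure_lborel_ball_finite[of y r] by (intro integrable_real_indicator) auto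
  have "c * measure lborel (ball y r) = (\<integral>z. c * indicat_real (ball y r) z \<partial>lborel)"
    by simp
  also have "\<dots> \<le> (\<integral>z. f z \<partial>lborel)"
    using assms by (intro integral_mono integrable_mult_right int) (auto simp: indicator_def)
  finally show ?thesis .
qed

section \<open>Bounded Borel functions, on which the truncated operator acts\<close>

definition bounded_borel :: "('a::euclidean_space \<Rightarrow> real) \<Rightarrow> bool" where
  "bounded_borel w \<longleftrightarrow> w \<in> borel_measurable borel \<and> bounded (range w)"

lemma bounded_borelI: "w \<in> borel_measurable borel \<Longrightarrow> (\<And>x. \<bar>w x\<bar> \<le> M) \<Longrightarrow> bounded_borel w"
  unfolding bounded_borel_def bounded_iff by auto

lemma bounded_borelE:
  assumes "bounded_borel w" obtains M where "0 < M" "\<And>x. \<bar>w x\<bar> \<le> M"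
proof -
  obtain M where "0 < M" "\<forall>x\<in>range w. norm x \<le> M" using assms unfolding bounded_borel_def bounded_pos by blast
  then show thesis by (intro that) auto
qed

lemma bounded_borel_measurable [measurable_dest]: "bounded_borel w \<Longrightarrow> w \<in> borel_measurable borel" by (simp add: bounded_borel_def)

lemma bounded_borel_minus [simp]: "bounded_borel (\<lambda>x. - w x) \<longleftrightarrow> bounded_borel w"
proof
  show "bounded_borel (\<lambda>x. - w x)" if "bounded_borel w" for w :: "'a \<Rightarrow> real"
  proof -
    obtain M where "\<And>x. \<bar>w x\<bar> \<le> M" using bounded_borelE[OF \<open>bounded_borel w\<close>] by blast
    then show ?thesis
      using borel_measurable_uminus[OF bounded_borel_measurable[OF that]] by (intro bounded_borelI[of _ M]) auto
  qed
  from this[of "\<lambda>x. - w x"] show "bounded_borel w" if "bounded_borel (\<lambda>x. - w x)" using that by simp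
qed

lemma bounded_borel_add: "bounded_borel u \<Longrightarrow> bounded_borel w \<Longrightarrow> bounded_borel (\<lambda>x. u x + w x)"
proof -
  assume a: "bounded_borel u" "bounded_borel w"
  obtain M N where MN: "\<And>x. \<bar>u x\<bar> \<le> M" "\<And>x. \<bar>w x\<bar> \<le> N" using a by (metis bounded_borelE)
  have "\<bar>u x + w x\<bar> \<le> M + N" for x
    using abs_triangle_ineq[of "u x" "w x"] MN[of x] by linarith
  then show ?thesis using a by (intro bounded_borelI[of _ "M + N"]) (auto dest: bounded_borel_measurable)
qed

lemma bounded_borel_diff: "bounded_borel u \<Longrightarrow> bounded_borel w \<Longrightarrow> bounded_borel (\<lambda>x. u x - w x)"
  using bounded_borel_add[of u "\<lambda>x. - w x"] by simp

lemma bounded_borel_cmult: "bounded_borel u \<Longrightarrow> bounded_borel (\<lambda>x. c * u x)"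
proof -
  assume a: "bounded_borel u"
  obtain M where M: "\<And>x. \<bar>u x\<bar> \<le> M" using a by (metis bounded_borelE)
  then have "\<bar>c * u x\<bar> \<le> \<bar>c\<bar> * M" for x by (simp add: abs_mult mult_left_mono)
  then show ?thesis using a by (intro bounded_borelI[of _ "\<bar>c\<bar> * M"]) (auto dest: bounded_borel_measurable)
qed

section \<open>The truncated operator and pointwise sub- and supersolutions\<close>

definition trunc_lap :: "real \<Rightarrow> real \<Rightarrow> ('a::euclidean_space \<Rightarrow> real) \<Rightarrow> 'a \<Rightarrow> real" where
  "trunc_lap s \<delta> w x = (\<integral>z. (w x - w (x + z)) * trunc_kern s \<delta> z \<partial>lborel)"

text \<open>A principal-value-free form of \<open>(- \<Delta>)\<^sup>s w \<le> f\<close> at \<open>x\<close> in the viscosity sense, up to the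
  constant \<open>C(n,s)\<close>: a paraboloid of opening \<open>N\<close> touching \<open>w\<close> from above at \<open>x\<close> can lower the integral
  over a ball of radius \<open>\<delta>\<close> by at most \<open>N\<close> times the second moment of the kernel there.\<close>

definition sub_at :: "real \<Rightarrow> ('a::euclidean_space \<Rightarrow> real) \<Rightarrow> real \<Rightarrow> 'a \<Rightarrow> bool" where
  "sub_at s w f x \<longleftrightarrow> (\<forall>\<rho> b N. 0 < \<rho> \<and> 0 \<le> N \<and>
     (\<forall>z. norm z < \<rho> \<longrightarrow> w (x + z) \<le> w x + b \<bullet> z + N * (norm z)\<^sup>2) \<longrightarrow>
     (\<forall>\<delta>. 0 < \<delta> \<and> \<delta> < \<rho> \<longrightarrow> trunc_lap s \<delta> w x \<le> f + N * kern_moment TYPE('a) s \<delta>))"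

text \<open>Defined by negation so that each estimate is proved once, for \<open>sub_at\<close>: a
  paraboloid touching \<open>w\<close> from below becomes one touching \<open>- w\<close> from
  above.\<close>

definition super_at :: "real \<Rightarrow> ('a::euclidean_space \<Rightarrow> real) \<Rightarrow> real \<Rightarrow> 'a \<Rightarrow> bool" where
  "super_at s w f x \<longleftrightarrow> sub_at s (\<lambda>y. - w y) (- f) x"

lemma sub_atD:
  assumes "sub_at s w f x" "0 \<le> N" "0 < \<delta>" "\<delta> < \<rho>"
    "\<And>z. norm z < \<rho> \<Longrightarrow> w (x + z) \<le> w x + b \<bullet> z + N * (norm z)\<^sup>2"
  shows "trunc_lap s \<delta> w (x::'a::euclidean_space) \<le> f + N * kern_moment TYPE('a) s \<delta>"
proof -
  have "0 < \<rho>" using assms by simp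
  then show ?thesis using assms unfolding sub_at_def by blast
qed

lemma sub_at_mono: "sub_at s w f x \<Longrightarrow> f \<le> g \<Longrightarrow> sub_at s w g x"
  unfolding sub_at_def by (meson add_right_mono order_trans)

lemma trunc_lap_minus [simp]: "trunc_lap s \<delta> (\<lambda>x. - w x) x = - trunc_lap s \<delta> w x"
  unfolding trunc_lap_def by (subst integral_minus[symmetric]) (rule Bochner_Integration.integral_cong, auto simp: algebra_simps)

lemma trunc_lap_cmult [simp]: "trunc_lap s \<delta> (\<lambda>x. c * w x) x = c * trunc_lap s \<delta> w x"
  unfolding trunc_lap_def integral_mult_right_zero[symmetric]
  by (rule Bochner_Integration.integral_cong) (auto simp: algebra_simps)

lemma sub_at_cmult:
  assumes "sub_at s w f x" "0 < c"
  shows "sub_at s (\<lambda>x. c * w x) (c * f) x"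
  unfolding sub_at_def
proof (intro allI impI, elim conjE, goal_cases)
  case (1 \<rho> b N \<delta>)
  have "trunc_lap s \<delta> w x \<le> f + N / c * kern_moment TYPE('a) s \<delta>"
  proof (rule sub_atD[OF assms(1), where b = "(1 / c) *\<^sub>R b"])
    fix z :: 'a assume "norm z < \<rho>"
    then have "(c * w (x + z)) / c \<le> (c * w x + b \<bullet> z + N * (norm z)\<^sup>2) / c"
      using 1 assms(2) by (intro divide_right_mono) auto
    then show "w (x + z) \<le> w x + (1 / c) *\<^sub>R b \<bullet> z + N / c * (norm z)\<^sup>2"
      using assms(2) by (simp add: add_divide_distrib)
  qed (use 1 assms in auto)
  then show ?case using assms(2) by (simp add: field_simps)
qed

lemma super_at_cmult: "super_at s w f x \<Longrightarrow> 0 < c \<Longrightarrow> super_at s (\<lambda>x. c * w x) (c * f) x"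
  unfolding super_at_def using sub_at_cmult[of s "\<lambda>x. - w x" "- f" x c] by simp

section \<open>Integrability and basic estimates for the truncated operator\<close>

context
  fixes s :: real
  assumes s: "0 < s" "s < 1"
begin

lemma trunc_kern_integrable [simp, intro]: "0 < \<delta> \<Longrightarrow> integrable lborel (trunc_kern s \<delta> :: 'a::euclidean_space \<Rightarrow> real)"
  using trunc_kern_integral_aux[where 'a='a, OF s(1)] by blast

lemma moment_kern_integrable [simp, intro]: "integrable lborel (moment_kern s \<delta> :: 'a::euclidean_space \<Rightarrow> real)"
proof (cases "0 < \<delta>")
  case False
  then have "moment_kern s \<delta> = (\<lambda>z::'a. 0)" by (auto simp: moment_kern_def fun_eq_iff) (smt (verit) norm_ge_zero)
  then show ?thesis by simp
qed (use moment_kern_integral_aux[where 'a='a, OF s] in blast)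

lemma kern_tail_bound:
  obtains K where "0 < K" "\<And>\<delta>. 0 < \<delta> \<Longrightarrow> kern_tail TYPE('a::euclidean_space) s \<delta> \<le> K * \<delta> powr (- 2 * s)"
  using trunc_kern_integral_aux[where 'a='a, OF s(1)] by blast

lemma kern_moment_bound:
  obtains K where "0 < K" "\<And>\<delta>. 0 < \<delta> \<Longrightarrow> kern_moment TYPE('a::euclidean_space) s \<delta> \<le> K * \<delta> powr (2 - 2 * s)"
  using moment_kern_integral_aux[where 'a='a, OF s] by blast

lemma kern_moment_nonneg [simp]: "0 \<le> kern_moment TYPE('a::euclidean_space) s \<delta>"
  unfolding kern_moment_def by (intro integral_nonneg_AE) auto

lemma kern_tail_nonneg [simp]: "0 \<le> kern_tail TYPE('a::euclidean_space) s \<delta>"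
  unfolding kern_tail_def by (intro integral_nonneg_AE) auto

text \<open>This renders the error term in \<open>sub_at\<close> harmless: for a fixed opening
  \<open>N\<close> it disappears as the cut-off radius shrinks. The exponent
  \<open>2 - 2 * s\<close> of the moment bound is positive.\<close>

lemma kern_moment_tendsto_0: "((\<lambda>\<delta>. kern_moment TYPE('a::euclidean_space) s \<delta>) \<longlongrightarrow> 0) (at_right 0)"
proof -
  obtain K where K: "0 < K" "\<And>\<delta>. 0 < \<delta> \<Longrightarrow> kern_moment TYPE('a) s \<delta> \<le> K * \<delta> powr (2 - 2 * s)"
    using kern_moment_bound[where 'a='a] by metis
  have "((\<lambda>\<delta>. K * \<delta> powr (2 - 2 * s)) \<longlongrightarrow> K * 0 powr (2 - 2 * s)) (at_right 0)"
    using s by (intro tendsto_intros tendsto_powr') (auto simp: eventually_at_right_less eventually_at_filter)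
  then have lim: "((\<lambda>\<delta>. K * \<delta> powr (2 - 2 * s)) \<longlongrightarrow> 0) (at_right 0)" by simp
  show ?thesis
    by (rule tendsto_sandwich[OF _ _ tendsto_const lim])
       (auto simp: eventually_at_filter K)
qed

lemma kern_moment_small:
  assumes "0 < e" "0 < r"
  obtains \<delta> where "0 < \<delta>" "\<delta> < r" "kern_moment TYPE('a::euclidean_space) s \<delta> < e"
proof -
  have "eventually (\<lambda>\<delta>. kern_moment TYPE('a) s \<delta> < e) (at_right 0)"
    using kern_moment_tendsto_0[where 'a='a] assms by (intro order_tendstoD)
  moreover have "eventually (\<lambda>\<delta>. \<delta> < r \<and> 0 < \<delta>) (at_right (0::real))"
    using assms by (auto simp: eventually_at intro!: exI[of _ r])
  ultimately have "eventually (\<lambda>\<delta>. kern_moment TYPE('a) s \<delta> < e \<and> \<delta> < r \<and> 0 < \<delta>) (at_right 0)"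
    by (rule eventually_conj)
  then obtain \<delta> where "kern_moment TYPE('a) s \<delta> < e \<and> \<delta> < r \<and> 0 < \<delta>"
    using eventually_happens' trivial_limit_at_right_real by blast
  then show ?thesis using that by blast
qed

text \<open>This mass is the source of strictness in the comparison principle, where it multiplies
  the difference of the two functions. It is also the divisor in the fixed-point form of the
  truncated equation.\<close>

lemma kern_tail_pos:
  assumes "0 < \<delta>" shows "0 < kern_tail TYPE('a::euclidean_space) s \<delta>"
proof -
  obtain y :: 'a where y: "norm y = \<delta> + 1" using vector_choose_size[of "\<delta> + 1"] assms by auto
  have norms: "\<delta> \<le> norm z" "norm z \<le> \<delta> + 2" if "z \<in> ball y 1" for z
    using that y norm_triangle_ineq2[of y z] norm_triangle_ineq[of y "z - y"]
    by (auto simp: dist_norm norm_minus_commute)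
  obtain y' :: 'a where nb: "norm y' = \<delta> + 2" using vector_choose_size[of "\<delta> + 2"] assms by auto
  define c where "c = kern s y'"
  have c: "0 < c" unfolding c_def using nb assms by (intro kern_pos) auto
  have "c \<le> trunc_kern s \<delta> z" if "z \<in> ball y 1" for z :: 'a
    using norms[OF that] assms s nb unfolding c_def trunc_kern_def by (auto intro!: kern_antimono)
  then have "c * measure lborel (ball y 1) \<le> kern_tail TYPE('a) s \<delta>"
    unfolding kern_tail_def using assms by (intro integral_ge_on_ball) auto
  moreover have "0 < measure lborel (ball y 1)" using content_ball_pos[of 1 y] by simp
  ultimately show ?thesis using c by (smt (verit) mult_pos_pos)
qed

lemma integrable_times_trunc_kern:
  assumes "bounded_borel w" "0 < \<delta>"
  shows "integrable lborel (\<lambda>z. w (x + z) * trunc_kern s \<delta> (z::'a::euclidean_space))"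
    and "integrable lborel (\<lambda>z. w z * trunc_kern s \<delta> (z::'a::euclidean_space))"
proof -
  obtain M where M: "\<And>x. \<bar>w x\<bar> \<le> M" using assms bounded_borelE by metis
  note [measurable] = bounded_borel_measurable[OF assms(1)]
  have i: "integrable lborel (\<lambda>z. M * trunc_kern s \<delta> (z::'a))" using assms by auto
  show "integrable lborel (\<lambda>z. w (x + z) * trunc_kern s \<delta> (z::'a))" "integrable lborel (\<lambda>z. w z * trunc_kern s \<delta> (z::'a))"
    by (auto intro!: Bochner_Integration.integrable_bound[OF i] AE_I2 mult_right_mono
        simp: abs_mult order_trans[OF M abs_ge_self])
qed

lemma integrable_trunc:
  assumes "bounded_borel w" "0 < \<delta>"
  shows "integrable lborel (\<lambda>z. (w x - w (x + z)) * trunc_kern s \<delta> (z::'a::euclidean_space))"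
  using integrable_times_trunc_kern(1)[OF assms, of x] assms(2)
  by (auto simp: left_diff_distrib)

lemma trunc_lap_eq:
  assumes "bounded_borel w" "0 < \<delta>"
  shows "trunc_lap s \<delta> w (x::'a::euclidean_space) = w x * kern_tail TYPE('a) s \<delta> - (\<integral>z. w (x + z) * trunc_kern s \<delta> z \<partial>lborel)"
  unfolding trunc_lap_def kern_tail_def left_diff_distrib using assms
  by (subst Bochner_Integration.integral_diff) (auto intro: integrable_times_trunc_kern)

lemma trunc_lap_diff:
  assumes "bounded_borel u" "bounded_borel w" "0 < \<delta>"
  shows "trunc_lap s \<delta> (\<lambda>x. u x - w x) (x::'a::euclidean_space) = trunc_lap s \<delta> u x - trunc_lap s \<delta> w x"
proof -
  have "trunc_lap s \<delta> (\<lambda>x. u x - w x) x = (\<integral>z. (u x - u (x + z)) * trunc_kern s \<delta> z - (w x - w (x + z)) * trunc_kern s \<delta> z \<partial>lborel)"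
    unfolding trunc_lap_def by (rule Bochner_Integration.integral_cong) (auto simp: algebra_simps)
  also have "\<dots> = trunc_lap s \<delta> u x - trunc_lap s \<delta> w x"
    unfolding trunc_lap_def using assms by (intro Bochner_Integration.integral_diff integrable_trunc)
  finally show ?thesis .
qed

lemma trunc_lap_mono:
  assumes "bounded_borel u" "bounded_borel w" "0 < \<delta>" "u x - w x \<le> 0" "\<And>y. u x - u y \<le> w x - w y"
  shows "trunc_lap s \<delta> u (x::'a::euclidean_space) \<le> trunc_lap s \<delta> w x"
  unfolding trunc_lap_def using assms
  by (intro integral_mono integrable_trunc mult_right_mono) auto

text \<open>The ring between the radii \<open>\<delta>\<close> and \<open>\<rho>\<close> is
  symmetric and a linear function is odd. This is the cancellation behind the principal value: it
  removes the gradient of a touching paraboloid from every estimate.\<close>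

lemma ring_linear:
  fixes b :: "'a::euclidean_space"
  assumes \<delta>: "0 < \<delta>" "\<delta> \<le> \<rho>"
  shows "integrable lborel (\<lambda>z. (b \<bullet> z) * (trunc_kern s \<delta> z - trunc_kern s \<rho> z))"
    and "(\<integral>z. (b \<bullet> z) * (trunc_kern s \<delta> z - trunc_kern s \<rho> z) \<partial>lborel) = 0"
proof -
  have \<rho>: "0 < \<rho>" using \<delta> by simp
  define g where "g = (\<lambda>z::'a. (b \<bullet> z) * (trunc_kern s \<delta> z - trunc_kern s \<rho> z))"
  have g_odd: "g (- z) = - g z" for z by (simp add: g_def)
  have [measurable]: "g \<in> borel_measurable borel" unfolding g_def by measurable
  have "integrable lborel g"
  proof (rule Bochner_Integration.integrable_bound)
    show "integrable lborel (\<lambda>z::'a. (norm b * \<rho>) * trunc_kern s \<delta> z)" using \<delta> by auto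
    show "AE z in lborel. norm (g z) \<le> norm (norm b * \<rho> * trunc_kern s \<delta> z)"
    proof (rule AE_I2)
      fix z :: 'a
      show "norm (g z) \<le> norm (norm b * \<rho> * trunc_kern s \<delta> z)"
      proof (cases "norm z < \<rho>")
        case True
        have "\<bar>b \<bullet> z\<bar> \<le> norm b * norm z" by (rule Cauchy_Schwarz_ineq2)
        also have "\<dots> \<le> norm b * \<rho>" using True by (intro mult_left_mono) auto
        finally have "\<bar>b \<bullet> z\<bar> * trunc_kern s \<delta> z \<le> norm b * \<rho> * trunc_kern s \<delta> z" by (intro mult_right_mono) auto
        then show ?thesis using True \<rho> by (simp add: g_def abs_mult trunc_kern_def)
      qed (use \<delta> \<rho> in \<open>auto simp: g_def trunc_kern_def\<close>)
    qed
  qed auto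
  then show "integrable lborel (\<lambda>z. (b \<bullet> z) * (trunc_kern s \<delta> z - trunc_kern s \<rho> z))" by (simp only: g_def)
  have "(\<integral>z. g z \<partial>lborel) = 0" by (rule lborel_integral_odd) (auto simp: g_odd)
  then show "(\<integral>z. (b \<bullet> z) * (trunc_kern s \<delta> z - trunc_kern s \<rho> z) \<partial>lborel) = 0" by (simp only: g_def)
qed

text \<open>Lowering the cut-off radius from \<open>\<rho>\<close> to \<open>\<delta>\<close> adds
  only the ring, where \<open>touch\<close> bounds the integrand from below: the linear part
  cancels, the quadratic part costs at most the second moment, and the slack \<open>\<eta>\<close>
  costs at most the tail. A positive slack serves near-maximum points of functions that may attain
  no maximum; at genuine touching points it is 0.\<close>

lemma trunc_lap_ring_ge:
  fixes x :: "'a::euclidean_space"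
  assumes w: "bounded_borel w" and \<delta>: "0 < \<delta>" "\<delta> \<le> \<rho>" and N: "0 \<le> N" and \<eta>: "0 \<le> \<eta>"
    and touch: "\<And>z. norm z < \<rho> \<Longrightarrow> w (x + z) \<le> w x + b \<bullet> z + N * (norm z)\<^sup>2 + \<eta>"
  shows "trunc_lap s \<rho> w x - N * kern_moment TYPE('a) s \<rho> - \<eta> * kern_tail TYPE('a) s \<delta> \<le> trunc_lap s \<delta> w x"
proof -
  have \<rho>: "0 < \<rho>" using \<delta> by simp
  define g where "g = (\<lambda>z::'a. (b \<bullet> z) * (trunc_kern s \<delta> z - trunc_kern s \<rho> z))"
  have gi: "integrable lborel g" and g0: "(\<integral>z. g z \<partial>lborel) = 0"
    unfolding g_def by (rule ring_linear[OF \<delta>])+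
  have "(\<integral>z. (w x - w (x + z)) * trunc_kern s \<rho> z - g z - N * moment_kern s \<rho> z - \<eta> * trunc_kern s \<delta> z \<partial>lborel)
      \<le> trunc_lap s \<delta> w x"
    unfolding trunc_lap_def
  proof (rule integral_mono)
    show "integrable lborel (\<lambda>z. (w x - w (x + z)) * trunc_kern s \<rho> z - g z - N * moment_kern s \<rho> z - \<eta> * trunc_kern s \<delta> z)"
      using gi \<delta> \<rho> w by (intro Bochner_Integration.integrable_diff integrable_trunc integrable_mult_right) auto
    fix z :: 'a
    show "(w x - w (x + z)) * trunc_kern s \<rho> z - g z - N * moment_kern s \<rho> z - \<eta> * trunc_kern s \<delta> z \<le> (w x - w (x + z)) * trunc_kern s \<delta> z"
    proof (cases "norm z < \<rho>")
      case True
      have "- (b \<bullet> z) - N * (norm z)\<^sup>2 - \<eta> \<le> w x - w (x + z)" using touch[OF True] by simp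
      then have "(- (b \<bullet> z) - N * (norm z)\<^sup>2 - \<eta>) * trunc_kern s \<delta> z \<le> (w x - w (x + z)) * trunc_kern s \<delta> z"
        by (intro mult_right_mono) auto
      moreover have "N * ((norm z)\<^sup>2 * trunc_kern s \<delta> z) \<le> N * moment_kern s \<rho> z"
        using N True by (intro mult_left_mono) (auto simp: trunc_kern_def moment_kern_def)
      ultimately show ?thesis using True by (simp add: g_def trunc_kern_def algebra_simps split: if_splits)
    next
      case False
      then have "g z = 0" "trunc_kern s \<rho> z = trunc_kern s \<delta> z" "moment_kern s \<rho> z = 0"
        using \<delta> by (auto simp: g_def trunc_kern_def moment_kern_def)
      then show ?thesis using \<eta> by simp
    qed
  qed (use w \<delta> in \<open>auto intro: integrable_trunc\<close>)
  also have "(\<integral>z. (w x - w (x + z)) * trunc_kern s \<rho> z - g z - N * moment_kern s \<rho> z - \<eta> * trunc_kern s \<delta> z \<partial>lborel)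
     = trunc_lap s \<rho> w x - N * kern_moment TYPE('a) s \<rho> - \<eta> * kern_tail TYPE('a) s \<delta>"
    using gi \<delta> \<rho> w g0 by (simp add: trunc_lap_def kern_moment_def kern_tail_def integrable_trunc)
  finally show ?thesis .
qed

end

section \<open>Comparison by doubling of variables\<close>

definition usc :: "('a::topological_space \<Rightarrow> real) \<Rightarrow> bool" where
  "usc f \<longleftrightarrow> (\<forall>a. open {x. f x < a})"

lemma usc_measurable: "usc f \<Longrightarrow> f \<in> borel_measurable borel"
  unfolding usc_def by (intro borel_measurableI_less) (auto simp: borel_open)

lemma continuous_imp_usc: "continuous_on UNIV f \<Longrightarrow> usc f"
  unfolding usc_def by (auto intro: open_Collect_less continuous_on_const)

text \<open>Otherwise the open sets \<open>{x. f x < f y}\<close> with \<open>y\<close> in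
  \<open>K\<close> would cover \<open>K\<close>, but a point with the largest value among the
  finitely many \<open>y\<close> of a subcover lies in none of its sets.\<close>

lemma usc_attains_sup:
  assumes "usc f" "compact K" "K \<noteq> {}"
  shows "\<exists>x\<in>K. \<forall>y\<in>K. f y \<le> f x"
proof (rule ccontr)
  assume "\<not> ?thesis"
  then have "K \<subseteq> (\<Union>y\<in>K. {x. f x < f y})" by (auto simp: not_le)
  moreover have "\<forall>y\<in>K. open {x. f x < f y}" using assms(1) by (auto simp: usc_def)
  ultimately obtain D where D: "D \<subseteq> K" "finite D" "K \<subseteq> (\<Union>y\<in>D. {x. f x < f y})"
    using compactE_image[OF assms(2)] by metis
  then have "D \<noteq> {}" using assms(3) by auto
  then have "Max (f ` D) \<in> f ` D" using D(2) by (intro Max_in) auto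
  then obtain y0 where y0: "y0 \<in> D" "f y0 = Max (f ` D)" by auto
  then obtain y where y: "y \<in> D" "f y0 < f y" using D by blast
  then have "f y \<le> Max (f ` D)" using D(2) by (intro Max_ge) auto
  then show False using y y0 by simp
qed

lemma usc_add:
  assumes "usc f" "usc g" shows "usc (\<lambda>x. f x + g x)"
  unfolding usc_def
proof
  fix a
  have "{x. f x + g x < a} = (\<Union>r. {x. f x < r} \<inter> {x. g x < a - r})"
  proof (intro set_eqI iffI)
    fix x assume "x \<in> {x. f x + g x < a}"
    then have "f x < (f x + a - g x) / 2" "g x < a - (f x + a - g x) / 2" by (auto simp: field_simps)
    then show "x \<in> (\<Union>r. {x. f x < r} \<inter> {x. g x < a - r})" by blast
  qed auto
  then show "open {x. f x + g x < a}" using assms by (auto simp: usc_def intro!: open_UN)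
qed

lemma usc_compose:
  assumes "usc f" "continuous_on UNIV h" shows "usc (\<lambda>x. f (h x))"
  using assms open_vimage[of "{x. f x < a}" h for a] unfolding usc_def vimage_def by auto

lemma usc_eventually:
  assumes "usc f" "X \<longlonglongrightarrow> x" "f x < a"
  shows "eventually (\<lambda>n. f (X n) < a) sequentially"
  using topological_tendstoD[OF assms(2), of "{x. f x < a}"] assms by (auto simp: usc_def)

lemma norm_diff_square:
  fixes x z :: "'a::real_inner"
  shows "(norm (x + z))\<^sup>2 = (norm x)\<^sup>2 + 2 * (x \<bullet> z) + (norm z)\<^sup>2"
  by (simp add: power2_norm_eq_inner inner_add_left inner_add_right inner_commute)

text \<open>Outside the compact product the functional is at most 0, while it is positive at
  \<open>(x0, x0)\<close>. If one point is beyond radius \<open>R + 1\<close> and the other within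
  \<open>R\<close>, their distance is at least 1 and the penalty \<open>N \<ge> 2 * A\<close>
  absorbs both values; if both are beyond \<open>R\<close>, both values vanish.\<close>

lemma doubling_maximum:
  fixes u w :: "'a::euclidean_space \<Rightarrow> real"
  assumes "usc u" "usc (\<lambda>x. - w x)"
    and bound: "\<And>x. \<bar>u x\<bar> \<le> A" "\<And>x. \<bar>w x\<bar> \<le> A"
    and zero: "\<And>x. R \<le> norm x \<Longrightarrow> u x = 0 \<and> w x = 0"
    and pos: "w x0 < u x0" and N: "2 * A \<le> N"
  obtains x y where "norm x \<le> R + 1" "norm y \<le> R + 1"
    "\<And>x' y'. u x' - w y' - N * (norm (x' - y'))\<^sup>2 \<le> u x - w y - N * (norm (x - y))\<^sup>2"
proof -
  define F where "F = (\<lambda>p. u (fst p) - w (snd p) - N * (norm (fst p - snd p))\<^sup>2)"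
  define K where "K = cball (0::'a) (R + 1) \<times> cball (0::'a) (R + 1)"
  have "usc (\<lambda>p. (u (fst p) + - w (snd p)) + - (N * (norm (fst p - snd p))\<^sup>2))"
    by (intro usc_add usc_compose[OF assms(1)] usc_compose[OF assms(2)] continuous_imp_usc continuous_intros)
  then have usc: "usc F" by (simp add: F_def)
  have x0: "norm x0 < R" using zero[of x0] pos by (auto simp: not_le[symmetric])
  then have x0K: "(x0, x0) \<in> K" by (auto simp: K_def)
  have F0: "0 < F (x0, x0)" using pos by (simp add: F_def)
  obtain p where p: "p \<in> K" "\<And>q. q \<in> K \<Longrightarrow> F q \<le> F p"
    using usc_attains_sup[OF usc, of K] x0K unfolding K_def by (metis compact_Times compact_cball empty_iff)
  have "F q \<le> F p" for q
  proof (cases "q \<in> K")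
    case False
    have "F q \<le> 0"
    proof (cases "norm (fst q) < R \<or> norm (snd q) < R")
      case True
      have "1 \<le> norm (fst q - snd q)"
        using True False norm_triangle_ineq2[of "fst q" "snd q"] norm_triangle_ineq2[of "snd q" "fst q"]
        by (cases q) (auto simp: K_def norm_minus_commute)
      then have "1 \<le> (norm (fst q - snd q))\<^sup>2" by (simp add: one_le_power)
      moreover have "0 \<le> N" using N bound(1)[of x0] by linarith
      ultimately have "N \<le> N * (norm (fst q - snd q))\<^sup>2" by (simp add: mult_left_le[of 1 N] mult_le_cancel_left1)
      then show ?thesis using bound(1)[of "fst q"] bound(2)[of "snd q"] N by (simp add: F_def)
    next
      case False
      moreover have "0 \<le> N" using N bound(1)[of x0] by linarith
      ultimately show ?thesis using zero[of "fst q"] zero[of "snd q"] by (simp add: F_def)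
    qed
    also have "0 < F p" using F0 p(2)[OF x0K] by simp
    finally show ?thesis by simp
  qed (use p in auto)
  then show thesis
    using p(1) by (intro that[of "fst p" "snd p"]) (auto simp: F_def K_def mem_Times_iff)
qed

context
  fixes s :: real
  assumes s: "0 < s" "s < 1"
begin

text \<open>Freezing one of the two variables in \<open>max\<close> gives paraboloids of opening
  \<open>N\<close> for \<open>u\<close> and \<open>- w\<close>, with opposite gradients. For
  \<open>norm z \<ge> 2 * R + 1\<close> both shifted values vanish, and the difference of the
  integrands is exactly \<open>u x - w y\<close> times the kernel; this produces the left side.
  Since \<open>N\<close> is fixed while \<open>\<delta>\<close> tends to 0, the moment errors vanish
  for each \<open>N\<close> separately.\<close>

lemma doubling_estimate:
  fixes u w :: "'a::euclidean_space \<Rightarrow> real"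
  assumes u: "bounded_borel u" and w: "bounded_borel w"
    and zero: "\<And>x. R \<le> norm x \<Longrightarrow> u x = 0 \<and> w x = 0"
    and sub: "sub_at s u f x" and super: "super_at s w g y"
    and xy: "norm x \<le> R + 1" "norm y \<le> R + 1" and N: "0 \<le> N" and R: "0 < R"
    and max: "\<And>x' y'. u x' - w y' - N * (norm (x' - y'))\<^sup>2 \<le> u x - w y - N * (norm (x - y))\<^sup>2"
  shows "(u x - w y) * kern_tail TYPE('a) s (2 * R + 1) \<le> f - g"
proof -
  have D: "u (x + z) - w (y + z) \<le> u x - w y" for z using max[of "x + z" "y + z"] by simp
  define b where "b = (2 * N) *\<^sub>R (x - y)"
  have touch1: "u (x + z) \<le> u x + b \<bullet> z + N * (norm z)\<^sup>2" for z
  proof -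
    have "N * (norm (x + z - y))\<^sup>2 = N * (norm (x - y))\<^sup>2 + b \<bullet> z + N * (norm z)\<^sup>2"
    proof -
      have e: "x + z - y = (x - y) + z" by simp
      show ?thesis unfolding e norm_diff_square by (simp add: b_def algebra_simps)
    qed
    then show ?thesis using max[of "x + z" y] by simp
  qed
  have touch2: "- w (y + z) \<le> - w y + (- b) \<bullet> z + N * (norm z)\<^sup>2" for z
  proof -
    have "N * (norm (x - (y + z)))\<^sup>2 = N * (norm (x - y))\<^sup>2 + (- b) \<bullet> z + N * (norm z)\<^sup>2"
    proof -
      have e: "x - (y + z) = (x - y) + - z" by simp
      show ?thesis unfolding e norm_diff_square by (simp add: b_def algebra_simps)
    qed
    then show ?thesis using max[of x "y + z"] by simp
  qed
  have le: "(u x - w y) * kern_tail TYPE('a) s (2 * R + 1) \<le> f - g + 2 * N * kern_moment TYPE('a) s \<delta>"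
    if \<delta>: "0 < \<delta>" "\<delta> < 1" for \<delta>
  proof -
    have 1: "trunc_lap s \<delta> u x \<le> f + N * kern_moment TYPE('a) s \<delta>"
      using sub_atD[OF sub N \<delta> touch1] .
    have 2: "- trunc_lap s \<delta> w y \<le> - g + N * kern_moment TYPE('a) s \<delta>"
      using sub_atD[OF super[unfolded super_at_def] N \<delta> touch2] by simp
    have "(u x - w y) * kern_tail TYPE('a) s (2 * R + 1)
        \<le> (\<integral>z. (u x - u (x + z)) * trunc_kern s \<delta> z - (w y - w (y + z)) * trunc_kern s \<delta> z \<partial>lborel)"
      unfolding kern_tail_def integral_mult_right_zero[symmetric]
    proof (rule integral_mono)
      fix z :: 'a
      show "(u x - w y) * trunc_kern s (2 * R + 1) z \<le> (u x - u (x + z)) * trunc_kern s \<delta> z - (w y - w (y + z)) * trunc_kern s \<delta> z"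
      proof (cases "2 * R + 1 \<le> norm z")
        case True
        then have "R \<le> norm (x + z)" "R \<le> norm (y + z)"
          using xy norm_diff_ineq[of z x] norm_diff_ineq[of z y] by (auto simp: add.commute)
        then show ?thesis using zero True \<delta> R by (simp add: trunc_kern_def algebra_simps)
      next
        case False
        have "0 \<le> ((u x - u (x + z)) - (w y - w (y + z))) * trunc_kern s \<delta> z"
          using D[of z] by (intro mult_nonneg_nonneg) auto
        then show ?thesis using False by (simp add: trunc_kern_def left_diff_distrib)
      qed
    qed (use u w \<delta> s R in \<open>auto intro!: integrable_trunc Bochner_Integration.integrable_diff integrable_mult_right\<close>)
    also have "\<dots> = trunc_lap s \<delta> u x - trunc_lap s \<delta> w y"
      unfolding trunc_lap_def using u w \<delta> s by (intro Bochner_Integration.integral_diff integrable_trunc)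
    finally show ?thesis using 1 2 by simp
  qed
  have lim: "((\<lambda>\<delta>. f - g + 2 * N * kern_moment TYPE('a) s \<delta>) \<longlongrightarrow> f - g + 2 * N * 0) (at_right 0)"
    using s by (intro tendsto_intros kern_moment_tendsto_0)
  have "eventually (\<lambda>\<delta>. (u x - w y) * kern_tail TYPE('a) s (2 * R + 1) \<le> f - g + 2 * N * kern_moment TYPE('a) s \<delta>) (at_right 0)"
    unfolding eventually_at using le by (intro exI[of _ 1]) auto
  then show ?thesis using tendsto_lowerbound[OF lim] by simp
qed

text \<open>The far mass of the kernel stands in for a zeroth-order term: it bounds a positive value
  \<open>M\<close> of \<open>u - w\<close>, times a fixed constant, by \<open>f - g\<close> at the
  doubled points. Growing penalties force these points to a common limit \<open>z\<close> with
  \<open>w z < u z\<close>, which therefore lies in \<open>V\<close>. Semicontinuity of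
  \<open>f\<close> and \<open>- g\<close> carries the bound to \<open>z\<close>, against
  \<open>f z \<le> g z\<close>.\<close>

lemma comparison:
  fixes u w :: "'a::euclidean_space \<Rightarrow> real"
  assumes u: "bounded_borel u" "usc u" and w: "bounded_borel w" "usc (\<lambda>x. - w x)" and V: "open V"
    and zero: "\<And>x. R \<le> norm x \<Longrightarrow> u x = 0 \<and> w x = 0" and R: "0 < R"
    and outside: "\<And>x. x \<notin> V \<Longrightarrow> u x \<le> w x"
    and sub: "\<And>x. x \<in> V \<Longrightarrow> sub_at s u (f x) x"
    and super: "\<And>x. x \<in> V \<Longrightarrow> super_at s w (g x) x"
    and f: "usc f" and g: "usc (\<lambda>x. - g x)"
    and order: "\<And>x. x \<in> V \<Longrightarrow> w x < u x \<Longrightarrow> f x \<le> g x"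
  shows "u x \<le> w x"
proof (rule ccontr)
  assume "\<not> u x \<le> w x"
  then have pos: "w x < u x" by simp
  define M where "M = u x - w x"
  have M: "0 < M" using pos by (simp add: M_def)
  obtain A1 A2 where A12: "\<And>x. \<bar>u x\<bar> \<le> A1" "\<And>x. \<bar>w x\<bar> \<le> A2" using u w by (metis bounded_borelE)
  define A where "A = max A1 A2"
  have A: "\<And>x. \<bar>u x\<bar> \<le> A" "\<And>x. \<bar>w x\<bar> \<le> A"
    using A12 by (simp_all add: A_def le_max_iff_disj)
  have A0: "0 \<le> A" using A(1)[of x] by linarith
  \<comment> \<open>At least \<open>2 * A\<close>, as the existence of a maximum requires, and
    unbounded in \<open>k\<close>, to force the two points together.\<close>
  define N where "N = (\<lambda>k::nat. 2 * A + real (Suc k))"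
  have "\<exists>p. norm (fst p) \<le> R + 1 \<and> norm (snd p) \<le> R + 1 \<and>
     (\<forall>x' y'. u x' - w y' - N k * (norm (x' - y'))\<^sup>2 \<le> u (fst p) - w (snd p) - N k * (norm (fst p - snd p))\<^sup>2)" for k
  proof -
    have Nk: "2 * A \<le> N k" by (simp add: N_def)
    obtain x y where "norm x \<le> R + 1" "norm y \<le> R + 1"
      "\<And>x' y'. u x' - w y' - N k * (norm (x' - y'))\<^sup>2 \<le> u x - w y - N k * (norm (x - y))\<^sup>2"
      using doubling_maximum[where R = R, OF u(2) w(2) A zero pos Nk] by blast
    then show ?thesis by (intro exI[of _ "(x, y)"]) auto
  qed
  then obtain P where P: "\<And>k. norm (fst (P k)) \<le> R + 1" "\<And>k. norm (snd (P k)) \<le> R + 1"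
     "\<And>k x' y'. u x' - w y' - N k * (norm (x' - y'))\<^sup>2 \<le> u (fst (P k)) - w (snd (P k)) - N k * (norm (fst (P k) - snd (P k)))\<^sup>2"
    by metis
  have Mle: "M + N k * (norm (fst (P k) - snd (P k)))\<^sup>2 \<le> u (fst (P k)) - w (snd (P k))" for k
    using P(3)[of x x k] by (simp add: M_def)
  have "compact (cball (0::'a) (R + 1) \<times> cball (0::'a) (R + 1))" by (intro compact_Times compact_cball)
  moreover have "\<forall>k. P k \<in> cball (0::'a) (R + 1) \<times> cball (0::'a) (R + 1)"
    using P(1,2) by (auto simp: mem_Times_iff)
  ultimately obtain l r where lr: "strict_mono (r::nat\<Rightarrow>nat)" "(P \<circ> r) \<longlonglongrightarrow> l"
    unfolding compact_def by blast
  define X where "X = (\<lambda>k. fst (P (r k)))"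
  define Y where "Y = (\<lambda>k. snd (P (r k)))"
  have X: "X \<longlonglongrightarrow> fst l" and Y: "Y \<longlonglongrightarrow> snd l"
    using tendsto_fst[OF lr(2)] tendsto_snd[OF lr(2)] by (simp_all add: X_def Y_def o_def)
  have sq_le: "(norm (X k - Y k))\<^sup>2 \<le> (2 * A) * (1 / real (Suc k))" for k
  proof -
    have "real (Suc k) * (norm (X k - Y k))\<^sup>2 \<le> N (r k) * (norm (X k - Y k))\<^sup>2"
      using seq_suble[OF lr(1), of k] A0 by (intro mult_right_mono) (auto simp: N_def)
    also have "\<dots> \<le> 2 * A" using Mle[of "r k"] M A(1)[of "X k"] A(2)[of "Y k"] by (simp add: X_def Y_def)
    finally show ?thesis by (simp add: field_simps)
  qed
  have "(\<lambda>k. (2 * A) * (1 / real (Suc k))) \<longlonglongrightarrow> (2 * A) * 0"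
    by (intro tendsto_intros LIMSEQ_Suc lim_1_over_n)
  then have sq_lim: "(\<lambda>k. (2 * A) * (1 / real (Suc k))) \<longlonglongrightarrow> 0" by (simp only: mult_zero_right)
  have "(\<lambda>k. (norm (X k - Y k))\<^sup>2) \<longlonglongrightarrow> 0"
    by (rule tendsto_sandwich[OF always_eventually always_eventually tendsto_const sq_lim])
       (intro allI zero_le_power2, intro allI sq_le)
  moreover have "(\<lambda>k. (norm (X k - Y k))\<^sup>2) \<longlonglongrightarrow> (norm (fst l - snd l))\<^sup>2"
    by (intro tendsto_intros X Y)
  ultimately have "(norm (fst l - snd l))\<^sup>2 = 0" using LIMSEQ_unique by blast
  then have ll: "snd l = fst l" by simp
  define z where "z = fst l"
  have Xz: "X \<longlonglongrightarrow> z" and Yz: "Y \<longlonglongrightarrow> z" using X Y ll by (auto simp: z_def)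
  have ge: "M \<le> u (X k) - w (Y k)" for k
  proof -
    have "0 \<le> N (r k) * (norm (fst (P (r k)) - snd (P (r k))))\<^sup>2" using A0 by (simp add: N_def)
    then show ?thesis using Mle[of "r k"] by (simp add: X_def Y_def)
  qed
  have uw: "w z < u z"
  proof (rule ccontr)
    assume "\<not> w z < u z"
    then have "u z < u z + M / 2" "- w z < - u z + M / 2" using M by auto
    from usc_eventually[OF u(2) Xz this(1)] usc_eventually[OF w(2) Yz this(2)]
    have "eventually (\<lambda>k. u (X k) - w (Y k) < M) sequentially" by eventually_elim simp
    then obtain k where "u (X k) - w (Y k) < M"
      using eventually_happens' sequentially_bot by blast
    then show False using ge[of k] by simp
  qed
  then have zV: "z \<in> V" using outside[of z] by force
  have Lp: "0 < kern_tail TYPE('a) s (2 * R + 1)" using R s by (intro kern_tail_pos) auto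
  \<comment> \<open>Half of the strict gain: near \<open>z\<close>, \<open>f\<close> and
    \<open>- g\<close> may each exceed their limit value by less than \<open>\<eta>\<close>,
    together less than the gain.\<close>
  define \<eta> where "\<eta> = M * kern_tail TYPE('a) s (2 * R + 1) / 2"
  have \<eta>: "0 < \<eta>" using M Lp by (simp add: \<eta>_def)
  have fz: "eventually (\<lambda>k. f (X k) < f z + \<eta>) sequentially" using usc_eventually[OF f Xz] \<eta> by simp
  have gz: "eventually (\<lambda>k. - g (Y k) < - g z + \<eta>) sequentially" using usc_eventually[OF g Yz] \<eta> by simp
  have "eventually (\<lambda>k. X k \<in> V) sequentially" "eventually (\<lambda>k. Y k \<in> V) sequentially"
    using topological_tendstoD[OF Xz V zV] topological_tendstoD[OF Yz V zV] by auto
  with fz gz have "eventually (\<lambda>k. f (X k) < f z + \<eta> \<and> - g (Y k) < - g z + \<eta> \<and> X k \<in> V \<and> Y k \<in> V) sequentially"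
    by eventually_elim auto
  then obtain k where k: "f (X k) < f z + \<eta>" "- g (Y k) < - g z + \<eta>" "X k \<in> V" "Y k \<in> V"
    using eventually_happens' sequentially_bot by blast
  have "(u (X k) - w (Y k)) * kern_tail TYPE('a) s (2 * R + 1) \<le> f (X k) - g (Y k)"
  proof (rule doubling_estimate[OF u(1) w(1) zero sub[OF k(3)] super[OF k(4)]])
    show "0 \<le> N (r k)" using A0 by (simp add: N_def)
  qed (use P R in \<open>auto simp: X_def Y_def\<close>)
  moreover have "M * kern_tail TYPE('a) s (2 * R + 1) \<le> (u (X k) - w (Y k)) * kern_tail TYPE('a) s (2 * R + 1)"
    using ge[of k] Lp by (intro mult_right_mono) auto
  moreover have "f z \<le> g z" using order[OF zV uw] .
  ultimately show False using k(1,2) by (simp add: \<eta>_def)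
qed

end

section \<open>Comparison for the sublinear system\<close>

text \<open>Continuity of \<open>g\<close> provides a level \<open>t\<close> strictly above
  \<open>f x\<close> with \<open>g t < a\<close>, so the sublevel set of the composition is a union
  of open sublevel sets of \<open>f\<close>.\<close>

lemma usc_mono_compose:
  fixes g :: "real \<Rightarrow> real"
  assumes "usc f" "mono g" "continuous_on UNIV g"
  shows "usc (\<lambda>x. g (f x))"
  unfolding usc_def
proof
  fix a
  have "{x. g (f x) < a} = (\<Union>t\<in>{t. g t < a}. {x. f x < t})"
  proof (intro set_eqI iffI)
    fix x assume "x \<in> {x. g (f x) < a}"
    moreover have "open {t. g t < a}" using assms(3) by (auto intro: open_Collect_less continuous_on_const)
    ultimately obtain e where "0 < e" "\<forall>t. dist t (f x) < e \<longrightarrow> g t < a"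
      unfolding open_dist by auto
    then have "g (f x + e / 2) < a" "f x < f x + e / 2" by (auto simp: dist_real_def)
    then show "x \<in> (\<Union>t\<in>{t. g t < a}. {x. f x < t})" by blast
  next
    fix x assume "x \<in> (\<Union>t\<in>{t. g t < a}. {x. f x < t})"
    then obtain t where "g t < a" "f x < t" by auto
    then show "x \<in> {x. g (f x) < a}" using monoD[OF assms(2), of "f x" t] by auto
  qed
  then show "open {x. g (f x) < a}" using assms(1) by (auto simp: usc_def intro!: open_UN)
qed

text \<open>Clamping at 0 extends the power continuously to the whole line, where it can be composed
  with semicontinuous functions; on nonnegative functions the clamp is invisible.\<close>

lemma continuous_powr_pos:
  fixes p :: real assumes "0 < p" shows "continuous_on UNIV (\<lambda>t. max 0 t powr p)"
  by (intro continuous_on_powr' continuous_intros) (use assms in auto)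

lemma usc_cmult_powr:
  assumes "usc f" "\<And>x. 0 \<le> f x" "0 < c" "0 < p"
  shows "usc (\<lambda>x. c * f x powr p)"
proof -
  have "usc (\<lambda>x. c * max 0 (f x) powr p)"
    using assms by (intro usc_mono_compose[OF assms(1), where g = "\<lambda>t. c * max 0 t powr p"] monoI mult_left_mono powr_mono2
        continuous_on_mult continuous_on_const continuous_powr_pos) auto
  then show ?thesis using assms(2) by (simp add: max_absorb2)
qed

lemma lsc_cmult_powr:
  assumes "usc (\<lambda>x. - f x)" "\<And>x. 0 \<le> f x" "0 < c" "0 < p"
  shows "usc (\<lambda>x. - (c * f x powr p))"
proof -
  have "continuous_on UNIV ((\<lambda>t. max 0 t powr p) \<circ> uminus)"
    using assms(4) by (intro continuous_on_compose continuous_intros continuous_on_subset[OF continuous_powr_pos]) auto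
  then have "usc (\<lambda>x. - (c * max 0 (- (- f x)) powr p))"
    using assms by (intro usc_mono_compose[OF assms(1), where g = "\<lambda>t. - (c * max 0 (- t) powr p)"] monoI
        continuous_on_minus continuous_on_mult continuous_on_const) (auto simp: o_def intro!: mult_left_mono powr_mono2)
  then show ?thesis using assms(2) by (simp add: max_absorb2)
qed

context
  fixes s :: real
  assumes s: "0 < s" "s < 1"
begin

text \<open>A large radius \<open>\<delta>\<close> reduces to a small one \<open>\<delta>'\<close>:
  by the ring estimate the values of \<open>trunc_lap\<close> at the two radii differ in the
  relevant direction by at most \<open>N * kern_moment\<close> at \<open>\<delta>\<close>, and the
  error at \<open>\<delta>'\<close> vanishes in the limit. The threshold \<open>d\<close> may depend
  on the paraboloid.\<close>

lemma sub_atI_small: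
  fixes x :: "'a::euclidean_space"
  assumes w: "bounded_borel w"
    and ev: "\<And>\<rho> b N. 0 < \<rho> \<Longrightarrow> 0 \<le> N \<Longrightarrow> (\<And>z. norm z < \<rho> \<Longrightarrow> w (x + z) \<le> w x + b \<bullet> z + N * (norm z)\<^sup>2)
      \<Longrightarrow> \<exists>d>0. \<forall>\<delta>. 0 < \<delta> \<and> \<delta> < d \<longrightarrow> trunc_lap s \<delta> w x \<le> f + N * kern_moment TYPE('a) s \<delta>"
  shows "sub_at s w f x"
  unfolding sub_at_def
proof (intro allI impI, elim conjE, goal_cases)
  case (1 \<rho> b N \<delta>)
  obtain d where d: "0 < d" "\<And>\<delta>. 0 < \<delta> \<Longrightarrow> \<delta> < d \<Longrightarrow> trunc_lap s \<delta> w x \<le> f + N * kern_moment TYPE('a) s \<delta>"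
    using ev[of \<rho> N b] 1 by auto
  have "trunc_lap s \<delta> w x - N * kern_moment TYPE('a) s \<delta> - f \<le> N * kern_moment TYPE('a) s \<delta>'"
    if "0 < \<delta>'" "\<delta>' < min d \<delta>" for \<delta>'
  proof -
    have "trunc_lap s \<delta> w x - N * kern_moment TYPE('a) s \<delta> - 0 * kern_tail TYPE('a) s \<delta>' \<le> trunc_lap s \<delta>' w x"
      by (rule trunc_lap_ring_ge[OF s w, where b = b]) (use 1 that in auto)
    then show ?thesis using d(2)[of \<delta>'] that by simp
  qed
  then have "eventually (\<lambda>\<delta>'. trunc_lap s \<delta> w x - N * kern_moment TYPE('a) s \<delta> - f \<le> N * kern_moment TYPE('a) s \<delta>') (at_right 0)"
    unfolding eventually_at using d(1) 1 by (intro exI[of _ "min d \<delta>"]) auto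
  moreover have "((\<lambda>\<delta>'. N * kern_moment TYPE('a) s \<delta>') \<longlongrightarrow> N * 0) (at_right 0)"
    using s by (intro tendsto_intros kern_moment_tendsto_0)
  ultimately have "trunc_lap s \<delta> w x - N * kern_moment TYPE('a) s \<delta> - f \<le> N * 0"
    by (intro tendsto_lowerbound) auto
  then show ?case by simp
qed

text \<open>The tent subtracted here costs nothing away from its support, but by nonlocality it makes
  \<open>(- \<Delta>)\<^sup>s\<close> strictly positive there; this replaces a boundary Hopf lemma.\<close>

lemma super_at_diff_tent:
  fixes w :: "'a::euclidean_space \<Rightarrow> real"
  assumes w: "bounded_borel w" "super_at s w 0 y" and r: "0 < r" and m: "0 < m"
    and y: "norm y \<le> R" "y \<notin> cball x1 r" and x1: "cball x1 r \<subseteq> cball 0 R"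
  defines "\<eta> \<equiv> \<lambda>x. (m / 2) * max 0 (1 - dist x1 x / (r / 2))"
  defines "c' \<equiv> (m / 4) * (1 / (2 * R) powr (real DIM('a) + 2 * s)) * measure lborel (ball x1 (r / 4))"
  shows "super_at s (\<lambda>x. w x - \<eta> x) c' y"
proof -
  have "\<bar>\<eta> x\<bar> \<le> m / 2" for x using r m unfolding \<eta>_def by (auto simp: abs_mult max_def divide_simps)
  moreover have "\<eta> \<in> borel_measurable borel" unfolding \<eta>_def by (intro borel_measurable_continuous_onI continuous_intros) (use r in auto)
  ultimately have \<eta>: "bounded_borel \<eta>" by (intro bounded_borelI)
  have \<eta>0: "0 \<le> \<eta> x" for x using m by (simp add: \<eta>_def)
  have dist: "r < dist x1 y" using y by simp
  have \<eta>near: "\<eta> (y + z) = 0" if "norm z < r / 2" for z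
  proof -
    have "dist x1 y \<le> dist x1 (y + z) + dist (y + z) y" by (rule dist_triangle)
    then have "r / 2 \<le> dist x1 (y + z)" using dist that by (simp add: dist_norm)
    then have "1 - dist x1 (y + z) / (r / 2) \<le> 0" using r by (simp add: field_simps)
    then show ?thesis by (simp add: \<eta>_def)
  qed
  have \<eta>y: "\<eta> y = 0" using \<eta>near[of 0] r by simp
  have R: "0 < R"
  proof -
    have "x1 \<in> cball 0 R" using subsetD[OF x1, of x1] r by simp
    then show ?thesis using y dist norm_triangle_ineq4[of x1 y] r by (auto simp: dist_norm)
  qed
  have tr: "trunc_lap s \<delta> \<eta> y \<le> - c'" if \<delta>: "0 < \<delta>" "\<delta> < r / 2" for \<delta>
  proof -
    \<comment> \<open>The tent is at least \<open>m / 4\<close> on the ball of radius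
      \<open>r / 4\<close> about \<open>x1\<close>. Seen from \<open>y\<close>, this ball lies
      beyond the cut-off and within distance \<open>2 * R\<close>, where the kernel has the lower
      bound that enters \<open>c'\<close>.\<close>
    have "c' \<le> (\<integral>z. \<eta> (y + z) * trunc_kern s \<delta> z \<partial>lborel)"
    proof -
      have "measure lborel (ball x1 (r / 4)) = measure lborel (ball (x1 - y) (r / 4))"
        using content_ball_conv_unit_ball[of "r / 4" x1] content_ball_conv_unit_ball[of "r / 4" "x1 - y"] r by simp
      then have "c' = (m / 4) * (1 / (2 * R) powr (real DIM('a) + 2 * s)) * measure lborel (ball (x1 - y) (r / 4))"
        by (simp add: c'_def)
      also have "\<dots> \<le> (\<integral>z. \<eta> (y + z) * trunc_kern s \<delta> z \<partial>lborel)"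
      proof (rule integral_ge_on_ball)
        show "integrable lborel (\<lambda>z. \<eta> (y + z) * trunc_kern s \<delta> z)" using \<eta> \<delta> s by (intro integrable_times_trunc_kern)
        show "0 \<le> \<eta> (y + z) * trunc_kern s \<delta> z" for z using \<eta>0 by simp
        fix z assume "z \<in> ball (x1 - y) (r / 4)"
        then have z: "dist x1 (y + z) < r / 4" by (simp add: dist_norm algebra_simps)
        have "dist x1 y \<le> dist x1 (y + z) + dist (y + z) y" by (rule dist_triangle)
        then have nz: "r / 2 < norm z" using z dist r by (simp add: dist_norm)
        have "y + z \<in> cball 0 R" using x1 z r by (auto simp: subset_iff)
        then have "norm z \<le> 2 * R" using y norm_triangle_ineq4[of "y + z" y] by simp
        then have "1 / (2 * R) powr (real DIM('a) + 2 * s) \<le> trunc_kern s \<delta> z"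
          using nz \<delta> R s r unfolding trunc_kern_def kern_def by (auto intro!: divide_left_mono powr_mono2 mult_pos_pos)
        moreover have "m / 4 \<le> \<eta> (y + z)"
        proof -
          have "1 / 2 \<le> 1 - dist x1 (y + z) / (r / 2)" using z r by (simp add: field_simps)
          then have half: "1 / 2 \<le> max 0 (1 - dist x1 (y + z) / (r / 2))" by simp
          have "(m / 2) * (1 / 2) \<le> \<eta> (y + z)"
            unfolding \<eta>_def by (rule mult_left_mono[OF half]) (use m in simp)
          then show ?thesis by simp
        qed
        ultimately show "(m / 4) * (1 / (2 * R) powr (real DIM('a) + 2 * s)) \<le> \<eta> (y + z) * trunc_kern s \<delta> z"
          using m by (intro mult_mono) auto
      qed
      finally show ?thesis .
    qed
    then show ?thesis using \<eta> \<delta> s by (simp add: trunc_lap_eq \<eta>y)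
  qed
  show ?thesis unfolding super_at_def
  proof (rule sub_atI_small)
    show "bounded_borel (\<lambda>y. - (w y - \<eta> y))" using bounded_borel_diff[OF w(1) \<eta>] by (simp only: bounded_borel_minus)
    fix \<rho> b N assume \<rho>: "0 < \<rho>" and N: "0 \<le> N"
      and touch: "\<And>z. norm z < \<rho> \<Longrightarrow> - (w (y + z) - \<eta> (y + z)) \<le> - (w y - \<eta> y) + b \<bullet> z + N * (norm z)\<^sup>2"
    have "trunc_lap s \<delta> (\<lambda>y. - (w y - \<eta> y)) y \<le> - c' + N * kern_moment TYPE('a) s \<delta>"
      if \<delta>: "0 < \<delta>" "\<delta> < min \<rho> (r / 2)" for \<delta>
    proof -
      have "trunc_lap s \<delta> (\<lambda>y. - w y) y \<le> - 0 + N * kern_moment TYPE('a) s \<delta>"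
      proof (rule sub_atD[OF w(2)[unfolded super_at_def] N \<delta>])
        fix z :: 'a assume "norm z < min \<rho> (r / 2)"
        then show "- w (y + z) \<le> - w y + b \<bullet> z + N * (norm z)\<^sup>2"
          using touch[of z] \<eta>near[of z] \<eta>y by simp
      qed
      moreover have "trunc_lap s \<delta> (\<lambda>y. w y - \<eta> y) y = trunc_lap s \<delta> w y - trunc_lap s \<delta> \<eta> y"
        using w \<eta> \<delta> s by (intro trunc_lap_diff) auto
      ultimately show ?thesis using tr[of \<delta>] \<delta> unfolding trunc_lap_minus by simp
    qed
    then show "\<exists>d>0. \<forall>\<delta>. 0 < \<delta> \<and> \<delta> < d \<longrightarrow> trunc_lap s \<delta> (\<lambda>y. - (w y - \<eta> y)) y \<le> - c' + N * kern_moment TYPE('a) s \<delta>"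
      using \<rho> r by (intro exI[of _ "min \<rho> (r / 2)"]) auto
  qed
qed

text \<open>The comparison takes place in \<open>\<Omega>\<close> without a closed ball on which
  \<open>w \<ge> m\<close>. There a multiple of \<open>w\<close> minus a tent has a right-hand side
  above \<open>F\<close>; on the ball the tent takes away at most half of \<open>w\<close>, so a
  large multiple dominates \<open>u\<close> by size alone.\<close>

lemma finite_ratio:
  fixes u w :: "'a::euclidean_space \<Rightarrow> real"
  assumes \<Omega>: "open \<Omega>" "\<Omega> \<subseteq> ball 0 R" "0 < R"
    and u: "bounded_borel u" "usc u" "\<And>x. x \<notin> \<Omega> \<Longrightarrow> u x = 0"
    and w: "bounded_borel w" "usc (\<lambda>x. - w x)" "\<And>x. x \<notin> \<Omega> \<Longrightarrow> w x = 0" "\<And>x. x \<in> \<Omega> \<Longrightarrow> 0 < w x"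
    and sub: "\<And>x. x \<in> \<Omega> \<Longrightarrow> sub_at s u F x" and super: "\<And>x. x \<in> \<Omega> \<Longrightarrow> super_at s w 0 x"
  shows "\<exists>\<theta>\<ge>1. \<forall>x. u x \<le> \<theta> * w x"
proof (cases "\<Omega> = {}")
  case True
  then show ?thesis using u(3) w(3) by (intro exI[of _ 1]) auto
next
  case False
  then obtain x1 where "x1 \<in> \<Omega>" by auto
  then obtain r where r: "0 < r" "cball x1 r \<subseteq> \<Omega>" using \<Omega>(1) open_contains_cball by blast
  have "\<exists>x\<in>cball x1 r. \<forall>y\<in>cball x1 r. - w y \<le> - w x"
    using r by (intro usc_attains_sup[OF w(2)]) auto
  then obtain xm where xm: "xm \<in> cball x1 r" "\<And>y. y \<in> cball x1 r \<Longrightarrow> w xm \<le> w y" by auto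
  define m where "m = w xm"
  have m: "0 < m" using xm(1) r w(4) by (auto simp: m_def)
  obtain M where M: "0 < M" "\<And>x. \<bar>u x\<bar> \<le> M" using u(1) bounded_borelE by metis
  define \<eta> where "\<eta> = (\<lambda>x. (m / 2) * max 0 (1 - dist x1 x / (r / 2)))"
  define c' where "c' = (m / 4) * (1 / (2 * R) powr (real DIM('a) + 2 * s)) * measure lborel (ball x1 (r / 4))"
  have c': "0 < c'" using m r \<Omega>(3) content_ball_pos[of "r / 4" x1] unfolding c'_def by simp
  \<comment> \<open>\<open>F / c'\<close> serves the equation off the ball, \<open>2 * M / m\<close>
    the inequality on the ball, and 1 keeps later powers of \<open>\<theta>\<close> monotone in the
    exponent.\<close>
  define \<theta> where "\<theta> = max 1 (max (F / c') (2 * M / m))"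
  have \<theta>: "1 \<le> \<theta>" "F / c' \<le> \<theta>" "2 * M / m \<le> \<theta>" by (auto simp: \<theta>_def)
  have \<eta>0: "0 \<le> \<eta> x" and \<eta>le: "\<eta> x \<le> m / 2" for x using m r by (auto simp: \<eta>_def max_def field_simps)
  have \<eta>out: "\<eta> x = 0" if "x \<notin> \<Omega>" for x
  proof -
    have "r < dist x1 x" using that r(2) by (meson in_mono mem_cball not_le)
    then have "1 - dist x1 x / (r / 2) \<le> 0" using r by (simp add: field_simps)
    then show ?thesis by (simp add: \<eta>_def)
  qed
  have \<eta>cont: "continuous_on UNIV \<eta>" unfolding \<eta>_def by (intro continuous_intros) (use r in auto)
  have \<eta>bounded_borel: "bounded_borel \<eta>"
    using \<eta>0 \<eta>le by (intro bounded_borelI[of _ "m / 2"] borel_measurable_continuous_onI \<eta>cont) auto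
  have "u x \<le> \<theta> * (w x - \<eta> x)" for x
  proof (rule comparison[OF s, where V = "\<Omega> - cball x1 r" and R = R and f = "\<lambda>_. F" and g = "\<lambda>_. \<theta> * c'"])
    have "usc (\<lambda>x. (- w x) + \<eta> x)" using \<eta>cont by (intro usc_add w(2) continuous_imp_usc)
    then have "usc (\<lambda>x. \<theta> * (- w x + \<eta> x))"
      using \<theta>(1) by (intro usc_mono_compose[where g = "\<lambda>t. \<theta> * t"] monoI mult_left_mono continuous_intros) auto
    then show "usc (\<lambda>x. - (\<theta> * (w x - \<eta> x)))" by (simp add: algebra_simps)
    show "bounded_borel (\<lambda>x. \<theta> * (w x - \<eta> x))" using w(1) \<eta>bounded_borel by (intro bounded_borel_cmult bounded_borel_diff)
    show "open (\<Omega> - cball x1 r)" using \<Omega>(1) by (intro open_Diff) auto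
    show "u x = 0 \<and> \<theta> * (w x - \<eta> x) = 0" if "R \<le> norm x" for x
    proof -
      have "x \<notin> \<Omega>" using that \<Omega>(2) by auto
      then show ?thesis using u w \<eta>out by simp
    qed
    show "u x \<le> \<theta> * (w x - \<eta> x)" if "x \<notin> \<Omega> - cball x1 r" for x
    proof (cases "x \<in> \<Omega>")
      case True
      then have "m \<le> w x" using that xm(2) by (auto simp: m_def)
      then have "m / 2 \<le> w x - \<eta> x" using \<eta>le[of x] by simp
      then have "(2 * M / m) * (m / 2) \<le> \<theta> * (w x - \<eta> x)" using \<theta> m M by (intro mult_mono) auto
      then show ?thesis using M(2)[of x] m by simp
    qed (use u w \<eta>out in simp)
    show "sub_at s u F x" if "x \<in> \<Omega> - cball x1 r" for x using sub that by simp
    show "super_at s (\<lambda>x. \<theta> * (w x - \<eta> x)) (\<theta> * c') x" if "x \<in> \<Omega> - cball x1 r" for x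
    proof (rule super_at_cmult)
      show "super_at s (\<lambda>x. w x - \<eta> x) c' x" unfolding \<eta>_def c'_def
        using that \<Omega>(2) r m w(1) super by (intro super_at_diff_tent) (auto simp: subset_iff less_imp_le)
    qed (use \<theta> in simp)
    show "F \<le> \<theta> * c'" using \<theta>(2) c' by (simp add: field_simps)
  qed (use u \<Omega> in \<open>auto intro: continuous_imp_usc\<close>)
  moreover have "\<theta> * (w x - \<eta> x) \<le> \<theta> * w x" for x using \<theta> \<eta>0[of x] by (intro mult_left_mono) auto
  ultimately show ?thesis using \<theta>(1) order_trans by blast
qed

text \<open>The first couple is only upper and the second only lower semicontinuous, and each
  satisfies one side of the system. The same result thus serves twice: for the two relaxed limits in
  the existence proof, and for two continuous solutions, in either order, in the uniqueness
  proof.\<close>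

lemma system_comparison:
  fixes u1 v1 u2 v2 :: "'a::euclidean_space \<Rightarrow> real"
  assumes \<Omega>: "open \<Omega>" "bounded \<Omega>" and c: "0 < c" and pq: "0 < p" "0 < q" "p * q < 1"
    and u1: "bounded_borel u1" "usc u1" "\<And>x. x \<notin> \<Omega> \<Longrightarrow> u1 x = 0" "\<And>x. 0 \<le> u1 x"
    and v1: "bounded_borel v1" "usc v1" "\<And>x. x \<notin> \<Omega> \<Longrightarrow> v1 x = 0" "\<And>x. 0 \<le> v1 x"
    and u2: "bounded_borel u2" "usc (\<lambda>x. - u2 x)" "\<And>x. x \<notin> \<Omega> \<Longrightarrow> u2 x = 0" "\<And>x. x \<in> \<Omega> \<Longrightarrow> 0 < u2 x"
    and v2: "bounded_borel v2" "usc (\<lambda>x. - v2 x)" "\<And>x. x \<notin> \<Omega> \<Longrightarrow> v2 x = 0" "\<And>x. x \<in> \<Omega> \<Longrightarrow> 0 < v2 x"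
    and sub: "\<And>x. x \<in> \<Omega> \<Longrightarrow> sub_at s u1 (c * v1 x powr p) x" "\<And>x. x \<in> \<Omega> \<Longrightarrow> sub_at s v1 (c * u1 x powr q) x"
    and super: "\<And>x. x \<in> \<Omega> \<Longrightarrow> super_at s u2 (c * v2 x powr p) x" "\<And>x. x \<in> \<Omega> \<Longrightarrow> super_at s v2 (c * u2 x powr q) x"
  shows "u1 x \<le> u2 x" and "v1 x \<le> v2 x"
proof -
  obtain R where R: "0 < R" "\<Omega> \<subseteq> ball 0 R" using bounded_subset_ballD[OF \<Omega>(2), of 0] by auto
  have out: "x \<notin> \<Omega>" if "R \<le> norm x" for x using that R by auto
  have u20: "0 \<le> u2 x" and v20: "0 \<le> v2 x" for x
    using u2(3,4)[of x] v2(3,4)[of x] by (cases "x \<in> \<Omega>"; simp)+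
  \<comment> \<open>One half of the iteration, stated for either equation. The right-hand sides
    inherit the factor \<open>\<theta> powr e\<close> from the power, and by linearity of the
    operator \<open>\<theta> powr e * b2\<close> is a supersolution with that factor.\<close>
  have transfer: "b1 x \<le> \<theta> powr e * b2 x"
    if le: "\<And>x. a1 x \<le> \<theta> * a2 x" and \<theta>: "1 \<le> \<theta>" and e: "0 < e"
      and a1: "usc a1" "\<And>x. 0 \<le> a1 x" and a2: "usc (\<lambda>x. - a2 x)" "\<And>x. 0 \<le> a2 x"
      and b1: "bounded_borel b1" "usc b1" "\<And>x. x \<notin> \<Omega> \<Longrightarrow> b1 x = 0"
      and b2: "bounded_borel b2" "usc (\<lambda>x. - b2 x)" "\<And>x. x \<notin> \<Omega> \<Longrightarrow> b2 x = 0"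
      and sub: "\<And>x. x \<in> \<Omega> \<Longrightarrow> sub_at s b1 (c * a1 x powr e) x"
      and super: "\<And>x. x \<in> \<Omega> \<Longrightarrow> super_at s b2 (c * a2 x powr e) x"
    for a1 a2 b1 b2 :: "'a \<Rightarrow> real" and \<theta> e x
  proof (rule comparison[OF s, where V = \<Omega> and R = R and f = "\<lambda>x. c * a1 x powr e" and g = "\<lambda>x. \<theta> powr e * (c * a2 x powr e)"])
    have l0: "0 < \<theta> powr e" using \<theta> by simp
    have "usc (\<lambda>x. \<theta> powr e * (- b2 x))" "usc (\<lambda>x. \<theta> powr e * (- (c * a2 x powr e)))"
      using l0 by (intro usc_mono_compose[where g = "\<lambda>t. \<theta> powr e * t"] b2 lsc_cmult_powr a2 c e monoI mult_left_mono continuous_intros; simp)+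
    then show "usc (\<lambda>x. - (\<theta> powr e * b2 x))" "usc (\<lambda>x. - (\<theta> powr e * (c * a2 x powr e)))" by simp_all
    show "usc (\<lambda>x. c * a1 x powr e)" using a1 c e by (intro usc_cmult_powr)
    show "super_at s (\<lambda>x. \<theta> powr e * b2 x) (\<theta> powr e * (c * a2 x powr e)) x" if "x \<in> \<Omega>" for x
      using super[OF that] l0 by (rule super_at_cmult)
    show "c * a1 x powr e \<le> \<theta> powr e * (c * a2 x powr e)" for x
    proof -
      have "a1 x powr e \<le> (\<theta> * a2 x) powr e" using le a1(2) e by (intro powr_mono2) auto
      also have "\<dots> = \<theta> powr e * a2 x powr e" using \<theta> a2(2) by (intro powr_mult)
      finally show ?thesis using c by (simp add: mult.left_commute)
    qed
  qed (use b1 b2 out R \<Omega> sub in \<open>auto intro: bounded_borel_cmult\<close>)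
  obtain B where B: "0 < B" "\<And>x. \<bar>v1 x\<bar> \<le> B" using v1(1) bounded_borelE by metis
  have "\<exists>\<theta>\<ge>1. \<forall>x. u1 x \<le> \<theta> * u2 x"
  proof (rule finite_ratio[OF \<Omega>(1) R(2,1) u1(1-3) u2])
    show "sub_at s u1 (c * B powr p) x" if "x \<in> \<Omega>" for x
      using sub(1)[OF that] by (rule sub_at_mono) (use B(2)[of x] v1(4)[of x] c pq in \<open>auto intro!: powr_mono2\<close>)
    show "super_at s u2 0 x" if "x \<in> \<Omega>" for x
      using super(1)[OF that] c unfolding super_at_def by (elim sub_at_mono) simp
  qed
  then obtain \<theta> where \<theta>: "1 \<le> \<theta>" "\<And>x. u1 x \<le> \<theta> * u2 x" by blast
  have iter: "\<forall>x. u1 x \<le> \<theta> powr ((p * q) ^ k) * u2 x" for k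
  proof (induction k)
    case 0
    then show ?case using \<theta> by simp
  next
    case (Suc k)
    define \<mu> where "\<mu> = \<theta> powr ((p * q) ^ k)"
    have \<mu>: "1 \<le> \<mu>" using \<theta>(1) pq by (simp add: \<mu>_def ge_one_powr_ge_zero)
    have "v1 x \<le> \<mu> powr q * v2 x" for x
      using Suc by (intro transfer[of u1 \<mu> u2 q v1 v2] \<mu> u1 u2 v1 v2 u20 sub super pq) (auto simp: \<mu>_def)
    then have "u1 x \<le> (\<mu> powr q) powr p * u2 x" for x
      using \<mu> pq by (intro transfer[of v1 _ v2 p u1 u2] u1 u2 v1 v2 v20 sub super ge_one_powr_ge_zero) auto
    then show ?case by (simp add: \<mu>_def powr_powr mult_ac)
  qed
  show le: "u1 x \<le> u2 x" for x
  proof -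
    \<comment> \<open>The exponents \<open>(p * q) ^ k\<close> tend to 0, so the factors tend to
      \<open>\<theta> powr 0 = 1\<close>.\<close>
    have "(\<lambda>k. \<theta> powr ((p * q) ^ k) * u2 x) \<longlonglongrightarrow> \<theta> powr 0 * u2 x"
      using pq \<theta> by (intro tendsto_intros LIMSEQ_power_zero) auto
    then have "(\<lambda>k. \<theta> powr ((p * q) ^ k) * u2 x) \<longlonglongrightarrow> u2 x" using \<theta> by simp
    then show ?thesis by (rule LIMSEQ_le_const) (use iter in blast)
  qed
  \<comment> \<open>With the sharp bound on the first components, the case
    \<open>\<theta> = 1\<close> of the transfer step settles the second ones.\<close>
  have "v1 x \<le> 1 powr q * v2 x"
    by (rule transfer[of u1 1 u2 q v1 v2]) (use le in \<open>auto intro: u1 u2 v1 v2 u20 sub super pq\<close>)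
  then show "v1 x \<le> v2 x" by simp
qed

end

section \<open>Viscosity inequalities and the pointwise notion\<close>

lemma real_polynomial_function_frechet_derivative:
  fixes f :: "'a::euclidean_space \<Rightarrow> real"
  assumes "real_polynomial_function f"
  shows "real_polynomial_function (\<lambda>x. frechet_derivative f (at x) b)"
  using assms
proof (induction f rule: real_polynomial_function.induct)
  case (linear f)
  have "frechet_derivative f (at x) = f" for x
    using frechet_derivative_at[OF bounded_linear_imp_has_derivative[OF linear]] by simp
  then show ?case by auto
next
  case (add f g)
  have "frechet_derivative (\<lambda>x. f x + g x) (at x) = (\<lambda>b. frechet_derivative f (at x) b + frechet_derivative g (at x) b)" for x
    using add.hyps by (intro frechet_derivative_at[symmetric] has_derivative_add)
      (auto intro: differentiable_at_real_polynomial_function simp flip: frechet_derivative_works)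
  then show ?case using add.IH by auto
next
  case (mult f g)
  have "frechet_derivative (\<lambda>x. f x * g x) (at x) = (\<lambda>b. f x * frechet_derivative g (at x) b + frechet_derivative f (at x) b * g x)" for x
    using mult.hyps by (intro frechet_derivative_at[symmetric] has_derivative_mult)
      (auto intro: differentiable_at_real_polynomial_function simp flip: frechet_derivative_works)
  then show ?case using mult by auto
qed auto

text \<open>All iterated partial derivatives of a polynomial are polynomials. Each is its own
  continuous extension to the closure, which settles every order at once.\<close>

lemma Ck_closure_polynomial:
  fixes f :: "'a::euclidean_space \<Rightarrow> real"
  assumes "real_polynomial_function f"
  shows "Ck_closure k U f"
proof -
  have poly: "real_polynomial_function (iter_partial bs f)" for bs
    by (induction bs) (auto intro: assms real_polynomial_function_frechet_derivative)
  then have cont: "continuous_on A (iter_partial bs f)" for A bs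
    by (intro continuous_on_polymonial_function) (simp add: real_polynomial_function_eq[symmetric])
  then show ?thesis
    unfolding Ck_closure_def Ck_on_def using poly by (auto intro: differentiable_at_real_polynomial_function)
qed

lemma linear_bound_Basis:
  fixes l :: "'a::euclidean_space \<Rightarrow> real" and M :: real
  assumes "linear l" "\<And>i. i \<in> Basis \<Longrightarrow> \<bar>l i\<bar> \<le> M"
  shows "\<bar>l v\<bar> \<le> DIM('a) * M * norm v"
proof -
  have "l v = l (\<Sum>i\<in>Basis. (v \<bullet> i) *\<^sub>R i)" by (simp only: euclidean_representation)
  also have "\<dots> = (\<Sum>i\<in>Basis. (v \<bullet> i) * l i)"
    by (simp only: linear_sum[OF assms(1)] linear_scale[OF assms(1)] real_scaleR_def)
  finally have "\<bar>l v\<bar> = \<bar>\<Sum>i\<in>Basis. (v \<bullet> i) * l i\<bar>" by simp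
  also have "\<dots> \<le> (\<Sum>i\<in>Basis. \<bar>(v \<bullet> i) * l i\<bar>)" by (rule sum_abs)
  also have "\<dots> \<le> (\<Sum>i\<in>(Basis::'a set). norm v * M)"
    unfolding abs_mult using assms(2) Basis_le_norm by (intro sum_mono mult_mono) auto
  finally show ?thesis by (simp add: mult_ac)
qed

text \<open>Two mean value estimates replace a Taylor formula. Bounded second partials on a closed
  ball give a Lipschitz estimate at \<open>x0\<close> for the first partials, so the derivative of
  \<open>\<phi> x - b \<bullet> x\<close> is of order \<open>norm z\<close> on the ball of radius
  \<open>norm z\<close>. Each passage from partials to the operator norm costs a factor
  \<open>n\<close>, the dimension.\<close>

lemma Ck_on_2_taylor:
  fixes \<phi> :: "'a::euclidean_space \<Rightarrow> real"
  assumes "Ck_on 2 U \<phi>" "open U" "x0 \<in> U"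
  obtains \<rho> b N where "0 < \<rho>" "0 \<le> N" "ball x0 \<rho> \<subseteq> U"
    "\<And>z. norm z < \<rho> \<Longrightarrow> \<bar>\<phi> (x0 + z) - \<phi> x0 - b \<bullet> z\<bar> \<le> N * (norm z)\<^sup>2"
proof -
  obtain \<rho> where \<rho>: "0 < \<rho>" "cball x0 \<rho> \<subseteq> U" using assms open_contains_cball by blast
  define g where "g = (\<lambda>i x. frechet_derivative \<phi> (at x) i)"
  define h where "h = (\<lambda>j i x. frechet_derivative (g i) (at x) j)"
  have d0: "\<phi> differentiable (at x)" if "x \<in> U" for x
  proof -
    have "iter_partial [] \<phi> differentiable (at x)"
      using assms(1) that unfolding Ck_on_def by (elim conjE allE[of _ "[]"]) auto
    then show ?thesis by simp
  qed
  have d1: "g i differentiable (at x)" if "x \<in> U" "i \<in> Basis" for x i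
  proof -
    have "iter_partial [i] \<phi> differentiable (at x)"
      using assms(1) that unfolding Ck_on_def by (elim conjE allE[of _ "[i]"]) auto
    then show ?thesis by (simp add: g_def)
  qed
  have c2: "continuous_on U (h j i)" if "i \<in> Basis" "j \<in> Basis" for i j
  proof -
    have "continuous_on U (iter_partial [j, i] \<phi>)"
      using assms(1) that unfolding Ck_on_def by (elim conjE allE[of _ "[j, i]"]) auto
    then show ?thesis by (simp add: h_def g_def)
  qed
  have "\<exists>M. \<forall>x\<in>cball x0 \<rho>. \<bar>h j i x\<bar> \<le> M" if "i \<in> Basis" "j \<in> Basis" for i j
  proof -
    have "bounded (h j i ` cball x0 \<rho>)"
      using continuous_on_subset[OF c2[OF that] \<rho>(2)] by (intro compact_imp_bounded compact_continuous_image) auto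
    then show ?thesis unfolding bounded_iff by auto
  qed
  then obtain M where M: "\<And>i j x. i \<in> Basis \<Longrightarrow> j \<in> Basis \<Longrightarrow> x \<in> cball x0 \<rho> \<Longrightarrow> \<bar>h j i x\<bar> \<le> M i j" by metis
  define M' where "M' = (\<Sum>i\<in>Basis. \<Sum>j\<in>Basis. \<bar>M i j\<bar>)"
  have M'0: "0 \<le> M'" unfolding M'_def by (intro sum_nonneg) auto
  have M': "\<bar>h j i x\<bar> \<le> M'" if "i \<in> Basis" "j \<in> Basis" "x \<in> cball x0 \<rho>" for i j x
  proof -
    have "\<bar>M i j\<bar> \<le> (\<Sum>j\<in>Basis. \<bar>M i j\<bar>)" using that by (intro member_le_sum) auto
    also have "\<dots> \<le> M'" unfolding M'_def
      by (rule member_le_sum[where f = "\<lambda>i. \<Sum>j\<in>Basis. \<bar>M i j\<bar>"]) (use that in \<open>auto intro: sum_nonneg\<close>)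
    finally show ?thesis using M[OF that] by linarith
  qed
  define n where "n = real DIM('a)"
  have lip: "\<bar>g i x - g i x0\<bar> \<le> n * M' * norm (x - x0)" if "i \<in> Basis" "x \<in> cball x0 \<rho>" for i x
  proof -
    have "norm (g i x - g i x0) \<le> n * M' * norm (x - x0)"
    proof (rule differentiable_bound[where S = "cball x0 \<rho>" and f' = "\<lambda>x. frechet_derivative (g i) (at x)"])
      fix y assume y: "y \<in> cball x0 \<rho>"
      then have deriv: "(g i has_derivative frechet_derivative (g i) (at y)) (at y)"
        using d1 that \<rho> by (auto simp flip: frechet_derivative_works)
      then show "(g i has_derivative frechet_derivative (g i) (at y)) (at y within cball x0 \<rho>)"
        by (rule has_derivative_at_withinI)
      show "onorm (frechet_derivative (g i) (at y)) \<le> n * M'"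
      proof (rule onorm_le)
        fix v
        show "norm (frechet_derivative (g i) (at y) v) \<le> n * M' * norm v"
          using linear_bound_Basis[OF has_derivative_linear[OF deriv], of M' v] M'[OF that(1) _ y]
          by (simp add: h_def n_def)
      qed
    qed (use that \<rho> in auto)
    then show ?thesis by simp
  qed
  define b where "b = (\<Sum>i\<in>Basis. g i x0 *\<^sub>R i)"
  have deriv0: "(\<phi> has_derivative frechet_derivative \<phi> (at x)) (at x)" if "x \<in> U" for x
    using d0[OF that] by (simp flip: frechet_derivative_works)
  have bi: "b \<bullet> i = g i x0" if "i \<in> Basis" for i
    using that by (simp add: b_def inner_sum_left inner_Basis if_distrib cong: if_cong)
  have "\<bar>\<phi> (x0 + z) - \<phi> x0 - b \<bullet> z\<bar> \<le> (n * (n * M')) * (norm z)\<^sup>2" if z: "norm z < \<rho>" for z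
  proof -
    define G where "G = (\<lambda>x. \<phi> x - b \<bullet> x)"
    have "norm (G (x0 + z) - G x0) \<le> n * (n * M' * norm z) * norm ((x0 + z) - x0)"
    proof (rule differentiable_bound[where S = "cball x0 (norm z)" and f' = "\<lambda>x v. frechet_derivative \<phi> (at x) v - b \<bullet> v"])
      fix y assume "y \<in> cball x0 (norm z)"
      then have y: "norm (y - x0) \<le> norm z" "y \<in> cball x0 \<rho>" using z by (auto simp: dist_norm norm_minus_commute)
      then have yU: "y \<in> U" using \<rho> by auto
      have deriv: "(G has_derivative (\<lambda>v. frechet_derivative \<phi> (at y) v - b \<bullet> v)) (at y)"
        unfolding G_def by (intro derivative_intros deriv0[OF yU])
      then show "(G has_derivative (\<lambda>v. frechet_derivative \<phi> (at y) v - b \<bullet> v)) (at y within cball x0 (norm z))"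
        by (rule has_derivative_at_withinI)
      show "onorm (\<lambda>v. frechet_derivative \<phi> (at y) v - b \<bullet> v) \<le> n * (n * M' * norm z)"
      proof (rule onorm_le)
        fix v
        show "norm (frechet_derivative \<phi> (at y) v - b \<bullet> v) \<le> n * (n * M' * norm z) * norm v"
          unfolding real_norm_def n_def
        proof (rule linear_bound_Basis[OF has_derivative_linear[OF deriv]])
          fix i :: 'a assume i: "i \<in> Basis"
          have "\<bar>g i y - g i x0\<bar> \<le> n * M' * norm (y - x0)" using lip[OF i y(2)] .
          also have "\<dots> \<le> n * M' * norm z" using y(1) M'0 by (intro mult_left_mono) (auto simp: n_def)
          finally show "\<bar>frechet_derivative \<phi> (at y) i - b \<bullet> i\<bar> \<le> real DIM('a) * M' * norm z"
            using bi[OF i] by (simp add: g_def n_def)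
        qed
      qed
    qed (auto simp: dist_norm)
    then show ?thesis by (simp add: G_def inner_add_right power2_eq_square algebra_simps)
  qed
  moreover have "0 \<le> n * (n * M')" using M'0 by (simp add: n_def)
  moreover have "ball x0 \<rho> \<subseteq> U" using \<rho>(2) by auto
  ultimately show thesis using \<rho>(1) that[of \<rho> "n * (n * M')" b] by blast
qed

section \<open>Existence of the principal value\<close>

context
  fixes s :: real
  assumes s: "0 < s" "s < 1"
begin

text \<open>Adding the ring integral of \<open>b \<bullet> z\<close>, which is 0, does not change
  the truncated integral but turns the integrand into \<open>h\<close>. Near the origin
  \<open>h\<close> is bounded by \<open>N\<close> times the moment kernel, elsewhere by the tail, so
  dominated convergence applies.\<close>

lemma trunc_lap_converges:
  fixes x :: "'a::euclidean_space"
  assumes w: "bounded_borel w" and \<rho>: "0 < \<rho>"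
    and taylor: "\<And>z. norm z < \<rho> \<Longrightarrow> \<bar>w (x + z) - w x - b \<bullet> z\<bar> \<le> N * (norm z)\<^sup>2"
  obtains L where "((\<lambda>\<epsilon>. trunc_lap s \<epsilon> w x) \<longlongrightarrow> L) (at_right 0)"
proof -
  note [measurable] = bounded_borel_measurable[OF w]
  obtain M where M: "\<And>x. \<bar>w x\<bar> \<le> M" using w bounded_borelE by metis
  define h where "h = (\<lambda>z. (w x - w (x + z) + (if norm z < \<rho> then b \<bullet> z else 0)) * kern s z)"
  have [measurable]: "h \<in> borel_measurable borel" unfolding h_def by measurable
  have h_bound: "\<bar>h z\<bar> \<le> N * moment_kern s \<rho> z + 2 * M * trunc_kern s \<rho> z" for z
  proof (cases "norm z < \<rho>")
    case True
    have "\<bar>h z\<bar> = \<bar>w x - w (x + z) + b \<bullet> z\<bar> * kern s z" using True by (simp add: h_def abs_mult)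
    also have "\<dots> \<le> (N * (norm z)\<^sup>2) * kern s z" using taylor[OF True] by (intro mult_right_mono) auto
    finally show ?thesis using True by (simp add: moment_kern_def trunc_kern_def)
  next
    case False
    have "\<bar>h z\<bar> = \<bar>w x - w (x + z)\<bar> * kern s z" using False by (simp add: h_def abs_mult)
    also have "\<dots> \<le> (2 * M) * kern s z"
      using M[of x] M[of "x + z"] by (intro mult_right_mono) auto
    finally show ?thesis using False by (simp add: moment_kern_def trunc_kern_def)
  qed
  have int: "integrable lborel (\<lambda>z::'a. N * moment_kern s \<rho> z + 2 * M * trunc_kern s \<rho> z)"
    using s \<rho> by (intro Bochner_Integration.integrable_add integrable_mult_right) auto
  have eq: "trunc_lap s \<epsilon> w x = (\<integral>z. h z * indicator {z. \<epsilon> \<le> norm z} z \<partial>lborel)" if \<epsilon>: "0 < \<epsilon>" "\<epsilon> < \<rho>" for \<epsilon>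
  proof -
    have \<epsilon>': "\<epsilon> \<le> \<rho>" using \<epsilon> by simp
    have "trunc_lap s \<epsilon> w x = trunc_lap s \<epsilon> w x + (\<integral>z. (b \<bullet> z) * (trunc_kern s \<epsilon> z - trunc_kern s \<rho> z) \<partial>lborel)"
      using ring_linear(2)[OF s \<epsilon>(1) \<epsilon>'] by simp
    also have "\<dots> = (\<integral>z. (w x - w (x + z)) * trunc_kern s \<epsilon> z + (b \<bullet> z) * (trunc_kern s \<epsilon> z - trunc_kern s \<rho> z) \<partial>lborel)"
      unfolding trunc_lap_def
      by (intro Bochner_Integration.integral_add[symmetric] integrable_trunc[OF s w \<epsilon>(1)] ring_linear(1)[OF s \<epsilon>(1) \<epsilon>'])
    also have "\<dots> = (\<integral>z. h z * indicator {z. \<epsilon> \<le> norm z} z \<partial>lborel)"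
      by (rule Bochner_Integration.integral_cong) (use \<epsilon> in \<open>auto simp: h_def trunc_kern_def algebra_simps\<close>)
    finally show ?thesis .
  qed
  have "((\<lambda>\<epsilon>. \<integral>z. h z * indicator {z. \<epsilon> \<le> norm z} z \<partial>lborel) \<longlongrightarrow> (\<integral>z. h z \<partial>lborel)) (at_right 0)"
    unfolding tendsto_at_iff_sequentially
  proof (intro allI impI)
    fix X :: "nat \<Rightarrow> real" assume X: "\<forall>i. X i \<in> {0<..} - {0}" "X \<longlonglongrightarrow> 0"
    have "(\<lambda>i. \<integral>z. h z * indicator {z. X i \<le> norm z} z \<partial>lborel) \<longlonglongrightarrow> (\<integral>z. h z \<partial>lborel)"
    proof (rule integral_dominated_convergence[OF _ _ int])
      show "AE z in lborel. (\<lambda>i. h z * indicator {z. X i \<le> norm z} z) \<longlonglongrightarrow> h z"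
      proof (rule AE_I2)
        fix z :: 'a
        show "(\<lambda>i. h z * indicator {z. X i \<le> norm z} z) \<longlonglongrightarrow> h z"
        proof (cases "z = 0")
          case False
          then have "eventually (\<lambda>i. X i < norm z) sequentially" using X(2) by (intro order_tendstoD) auto
          then have "eventually (\<lambda>i. h z * indicator {z. X i \<le> norm z} z = h z) sequentially"
            by eventually_elim auto
          then show ?thesis by (rule tendsto_eventually)
        qed (simp add: h_def kern_def)
      qed
      show "AE z in lborel. norm (h z * indicator {z. X i \<le> norm z} z) \<le> N * moment_kern s \<rho> z + 2 * M * trunc_kern s \<rho> z" for i
      proof (rule AE_I2)
        fix z :: 'a
        have "norm (h z * indicator {z. X i \<le> norm z} z) \<le> \<bar>h z\<bar>" by (simp add: indicator_def)
        then show "norm (h z * indicator {z. X i \<le> norm z} z) \<le> N * moment_kern s \<rho> z + 2 * M * trunc_kern s \<rho> z"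
          using h_bound[of z] by linarith
      qed
      show "h \<in> borel_measurable lborel"
        "(\<lambda>z. h z * indicator {z. X i \<le> norm z} z) \<in> borel_measurable lborel" for i
        by measurable
    qed
    then show "((\<lambda>\<epsilon>. \<integral>z. h z * indicator {z. \<epsilon> \<le> norm z} z \<partial>lborel) \<circ> X) \<longlonglongrightarrow> (\<integral>z. h z \<partial>lborel)"
      by (simp add: o_def)
  qed
  moreover have "eventually (\<lambda>\<epsilon>. (\<integral>z. h z * indicator {z. \<epsilon> \<le> norm z} z \<partial>lborel) = trunc_lap s \<epsilon> w x) (at_right 0)"
    by (rule eventually_at_rightI[OF _ \<rho>]) (simp only: eq greaterThanLessThan_iff)
  ultimately show thesis by (intro that[OF Lim_transform_eventually])
qed

end

text \<open>\<open>Lim\<close> is informative only if a limit exists, hence the hypothesis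
  \<open>lim\<close>. The substitution \<open>y = x + z\<close> turns each integral over the
  complement of a ball into \<open>trunc_lap\<close>.\<close>

lemma frac_laplacian_eq:
  fixes w :: "real^'n::{finite,wellorder} \<Rightarrow> real"
  assumes w: "w \<in> borel_measurable borel" and lim: "((\<lambda>\<epsilon>. trunc_lap s \<epsilon> w x) \<longlongrightarrow> L) (at_right 0)"
  shows "frac_laplacian s w x = frac_const TYPE('n) s * L"
proof -
  note [measurable] = w
  have "(LINT y:- ball x \<epsilon>|lborel. (w x - w y) / norm (x - y) powr (real CARD('n) + 2 * s)) = trunc_lap s \<epsilon> w x" for \<epsilon>
  proof -
    define G where "G = (\<lambda>y. indicator (- ball x \<epsilon>) y * ((w x - w y) / norm (x - y) powr (real CARD('n) + 2 * s)))"
    have [measurable]: "G \<in> borel_measurable borel" unfolding G_def by measurable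
    have "(LINT y:- ball x \<epsilon>|lborel. (w x - w y) / norm (x - y) powr (real CARD('n) + 2 * s)) = (\<integral>y. G y \<partial>lborel)"
      by (simp add: set_lebesgue_integral_def G_def)
    also have "\<dots> = (\<integral>z. G (x + z) \<partial>lborel)" by (rule lborel_integral_translate[symmetric]) measurable
    also have "\<dots> = trunc_lap s \<epsilon> w x"
      unfolding trunc_lap_def G_def by (rule Bochner_Integration.integral_cong) (auto simp: trunc_kern_def kern_def dist_norm)
    finally show ?thesis .
  qed
  then show ?thesis unfolding frac_laplacian_def using tendsto_Lim[OF _ lim] by simp
qed

text \<open>A divergent integral would evaluate to 0, and so would its inverse; integrability must
  therefore be shown along with positivity. Near the origin \<open>1 - cos t \<le> t\<^sup>2\<close>
  leads to the moment kernel, elsewhere the bound 2 leads to the tail.\<close>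

lemma frac_const_pos:
  assumes s: "0 < s" "s < 1"
  shows "0 < frac_const TYPE('n::{finite,wellorder}) s"
proof -
  define k where "k = (Min UNIV :: 'n)"
  define f where "f = (\<lambda>\<zeta>::real^'n::_. (1 - cos (\<zeta> $ k)) * kern s \<zeta>)"
  have [measurable]: "(\<lambda>\<zeta>::real^'n::_. \<zeta> $ k) \<in> borel_measurable borel"
    by (intro borel_measurable_continuous_onI continuous_intros)
  have [measurable]: "f \<in> borel_measurable borel" unfolding f_def by measurable
  have f0: "0 \<le> f z" for z by (simp add: f_def)
  have int: "integrable lborel f"
  proof (rule Bochner_Integration.integrable_bound)
    show "integrable lborel (\<lambda>z::real^'n::_. moment_kern s 1 z + 2 * trunc_kern s 1 z)"
      using s by (intro Bochner_Integration.integrable_add integrable_mult_right) auto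
    show "AE z in lborel. norm (f z) \<le> norm (moment_kern s 1 z + 2 * trunc_kern s 1 z)"
    proof (rule AE_I2)
      fix z :: "real^'n::_"
      have "f z \<le> moment_kern s 1 z + 2 * trunc_kern s 1 z"
      proof (cases "norm z < 1")
        case True
        have "1 - cos (z $ k) = 2 * (sin (z $ k / 2))\<^sup>2"
          using cos_double_sin[of "z $ k / 2"] by simp
        also have "\<dots> \<le> 2 * (z $ k / 2)\<^sup>2"
          using power_mono[OF abs_sin_x_le_abs_x[of "z $ k / 2"], of 2] by (simp add: power_divide)
        also have "\<dots> \<le> (z $ k)\<^sup>2" by (simp add: power2_eq_square)
        also have "\<dots> \<le> (norm z)\<^sup>2"
          using component_le_norm_cart[of z k] power_mono[of "\<bar>z $ k\<bar>" "norm z" 2] by simp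
        finally have "f z \<le> (norm z)\<^sup>2 * kern s z" unfolding f_def by (intro mult_right_mono) auto
        then show ?thesis using True by (simp add: moment_kern_def trunc_kern_def)
      next
        case False
        have "f z \<le> 2 * kern s z" unfolding f_def
          using cos_ge_minus_one[of "z $ k"] by (intro mult_right_mono) auto
        then show ?thesis using False by (simp add: trunc_kern_def moment_kern_def)
      qed
      then show "norm (f z) \<le> norm (moment_kern s 1 z + 2 * trunc_kern s 1 z)" using f0[of z] by simp
    qed
  qed measurable
  \<comment> \<open>In the ball of radius \<open>1/2\<close> about this unit vector the coordinate
    stays in \<open>[1/2, 3/2]\<close>, where the cosine decreases and is at most
    \<open>cos (1/2) < 1\<close>; the kernel is at least its value at norm
    \<open>3/2\<close>.\<close>
  define y where "y = (axis k 1 :: real^'n::_)"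
  have ny: "norm y = 1" by (simp add: y_def)
  have "((1 - cos (1/2)) * kern s ((3/2) *\<^sub>R y)) * measure lborel (ball y (1/2)) \<le> (\<integral>z. f z \<partial>lborel)"
  proof (rule integral_ge_on_ball[OF int f0])
    fix z assume "z \<in> ball y (1/2)"
    then have z: "norm (z - y) < 1/2" by (simp add: dist_norm norm_minus_commute)
    have "\<bar>(z - y) $ k\<bar> < 1/2" using component_le_norm_cart[of "z - y" k] z by linarith
    moreover have "(z - y) $ k = z $ k - 1" by (simp add: y_def)
    ultimately have zk: "1/2 \<le> z $ k" "z $ k \<le> 3/2" by linarith+
    then have "cos (z $ k) \<le> cos (1/2)" using pi_gt3 by (intro cos_monotone_0_pi_le) auto
    moreover have "norm z \<le> 3/2" "1/2 \<le> norm z"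
      using z ny norm_triangle_ineq2[of z y] norm_triangle_ineq2[of y z] by (auto simp: norm_minus_commute)
    then have "kern s ((3/2) *\<^sub>R y) \<le> kern s z" using s ny by (intro kern_antimono) auto
    ultimately show "(1 - cos (1/2)) * kern s ((3/2) *\<^sub>R y) \<le> f z"
      unfolding f_def by (intro mult_mono) auto
  qed
  moreover have "cos (1/2::real) < 1"
    using cos_monotone_0_pi[of 0 "1/2"] pi_gt3 by simp
  moreover have "0 < kern s ((3/2) *\<^sub>R y)" using ny by (intro kern_pos) auto
  ultimately have "0 < (\<integral>z. f z \<partial>lborel)"
    using content_ball_pos[of "1/2" y] by (elim less_le_trans[rotated]) (intro mult_pos_pos, auto)
  then show ?thesis unfolding frac_const_def f_def k_def kern_def by simp
qed

section \<open>Equivalence of the test-function inequalities and the pointwise notion\<close>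

lemma bounded_borel_glue:
  assumes "bounded_borel u" "open U" "compact (closure U)" "Ck_closure 2 U \<phi>"
  shows "bounded_borel (glue U \<phi> u)"
proof -
  obtain M where M: "\<And>x. \<bar>u x\<bar> \<le> M" using assms(1) bounded_borelE by metis
  \<comment> \<open>The order-zero case of the extension property. Continuity on \<open>U\<close>
    alone would not bound \<open>\<phi>\<close>; the extension lives on a compact set.\<close>
  obtain g where g: "continuous_on (closure U) g" "\<And>x. x \<in> U \<Longrightarrow> g x = \<phi> x"
    using assms(4) unfolding Ck_closure_def by (elim conjE allE[of _ "[]"]) auto
  have "bounded (g ` closure U)" using g(1) assms(3) by (intro compact_imp_bounded compact_continuous_image)
  then obtain K where K: "\<And>x. x \<in> closure U \<Longrightarrow> \<bar>g x\<bar> \<le> K" unfolding bounded_iff by auto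
  have "\<bar>glue U \<phi> u x\<bar> \<le> max M K" for x
  proof (cases "x \<in> U")
    case True
    then have "\<bar>\<phi> x\<bar> \<le> K" using g(2)[OF True] K[of x] closure_subset[of U] by auto
    then show ?thesis using True by (simp add: glue_def)
  qed (use M[of x] in \<open>auto simp: glue_def\<close>)
  moreover have "glue U \<phi> u \<in> borel_measurable borel"
  proof -
    have "continuous_on U \<phi>"
      using assms(4) unfolding Ck_closure_def Ck_on_def by (elim conjE allE[of _ "[]"]) auto
    then have "(\<lambda>x. if x \<in> U then \<phi> x else 0) \<in> borel_measurable borel"
      using assms(2) by (intro borel_measurable_continuous_on_if) (auto simp: borel_open)
    then have "(\<lambda>x. if x \<in> U then (if x \<in> U then \<phi> x else 0) else u x) \<in> borel_measurable borel"
      using assms(1,2) by (intro measurable_If_set[where f = "\<lambda>x. if x \<in> U then \<phi> x else 0"]) (auto simp: bounded_borel_def borel_open)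
    moreover have "(\<lambda>x. if x \<in> U then (if x \<in> U then \<phi> x else 0) else u x) = glue U \<phi> u"
      by (auto simp: glue_def)
    ultimately show ?thesis by simp
  qed
  ultimately show ?thesis by (intro bounded_borelI)
qed

lemma test_above_taylor:
  fixes u :: "real^'n::{finite,wellorder} \<Rightarrow> real"
  assumes s: "0 < s" "s < 1" and U: "open U" "x0 \<in> U" "compact (closure U)" and u: "bounded_borel u"
    and t: "test_above U x0 u \<phi>"
  obtains \<rho> b N L where "0 < \<rho>" "0 \<le> N" "ball x0 \<rho> \<subseteq> U"
    "\<And>z. norm z < \<rho> \<Longrightarrow> \<bar>\<phi> (x0 + z) - \<phi> x0 - b \<bullet> z\<bar> \<le> N * (norm z)\<^sup>2"
    "((\<lambda>\<epsilon>. trunc_lap s \<epsilon> (glue U \<phi> u) x0) \<longlongrightarrow> L) (at_right 0)"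
    "frac_laplacian s (glue U \<phi> u) x0 = frac_const TYPE('n) s * L"
proof -
  have Ck: "Ck_closure 2 U \<phi>" using t by (simp add: test_above_def)
  note bounded_borel = bounded_borel_glue[OF u U(1,3) Ck]
  have "Ck_on 2 U \<phi>" using Ck by (simp add: Ck_closure_def)
  then obtain \<rho> b N where T: "0 < \<rho>" "0 \<le> N" "ball x0 \<rho> \<subseteq> U"
    "\<And>z. norm z < \<rho> \<Longrightarrow> \<bar>\<phi> (x0 + z) - \<phi> x0 - b \<bullet> z\<bar> \<le> N * (norm z)\<^sup>2"
    using Ck_on_2_taylor[OF _ U(1,2)] by metis
  have "x0 + z \<in> U" if "norm z < \<rho>" for z
    using T(3) that by (auto simp: subset_iff dist_norm)
  then obtain L where L: "((\<lambda>\<epsilon>. trunc_lap s \<epsilon> (glue U \<phi> u) x0) \<longlongrightarrow> L) (at_right 0)"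
    using trunc_lap_converges[OF s bounded_borel T(1), of x0 b N] T(4) U(2) by (auto simp: glue_def)
  show thesis
    by (rule that[OF T L frac_laplacian_eq[OF _ L]]) (use bounded_borel in \<open>auto simp: bounded_borel_def\<close>)
qed

text \<open>The glued function lies above \<open>u\<close> and agrees with it at \<open>x0\<close>,
  so its truncated operator is smaller. The Taylor bound of \<open>\<phi>\<close> is a paraboloid
  touching \<open>u\<close> from above, to which \<open>sub\<close> applies, and its error vanishes
  with \<open>\<delta>\<close>.\<close>

lemma sub_at_imp_viscosity:
  fixes u :: "real^'n::{finite,wellorder} \<Rightarrow> real"
  assumes s: "0 < s" "s < 1" and U: "open U" "x0 \<in> U" "compact (closure U)" and u: "bounded_borel u"
    and sub: "sub_at s u f x0" and t: "test_above U x0 u \<phi>"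
  shows "frac_laplacian s (glue U \<phi> u) x0 \<le> frac_const TYPE('n) s * f"
proof -
  obtain \<rho> b N L where T: "0 < \<rho>" "0 \<le> N" "ball x0 \<rho> \<subseteq> U"
    "\<And>z. norm z < \<rho> \<Longrightarrow> \<bar>\<phi> (x0 + z) - \<phi> x0 - b \<bullet> z\<bar> \<le> N * (norm z)\<^sup>2"
    "((\<lambda>\<epsilon>. trunc_lap s \<epsilon> (glue U \<phi> u) x0) \<longlongrightarrow> L) (at_right 0)"
    "frac_laplacian s (glue U \<phi> u) x0 = frac_const TYPE('n) s * L"
    using test_above_taylor[OF s U u t] by metis
  have ux0: "u x0 = \<phi> x0" and ule: "\<And>x. x \<in> U \<Longrightarrow> u x \<le> \<phi> x" using t by (auto simp: test_above_def)
  have le: "trunc_lap s \<delta> (glue U \<phi> u) x0 \<le> f + N * kern_moment TYPE(real^'n::_) s \<delta>" if \<delta>: "0 < \<delta>" "\<delta> < \<rho>" for \<delta>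
  proof -
    have "trunc_lap s \<delta> (glue U \<phi> u) x0 \<le> trunc_lap s \<delta> u x0"
      using ux0 ule U(2) t
      by (intro trunc_lap_mono[OF s _ u \<delta>(1)] bounded_borel_glue[OF u U(1,3)]) (auto simp: glue_def test_above_def)
    also have "\<dots> \<le> f + N * kern_moment TYPE(real^'n::_) s \<delta>"
    proof (rule sub_atD[OF sub T(2) \<delta>])
      fix z :: "real^'n::_" assume z: "norm z < \<rho>"
      then have "x0 + z \<in> U" using T(3) by (auto simp: subset_iff dist_norm)
      then show "u (x0 + z) \<le> u x0 + b \<bullet> z + N * (norm z)\<^sup>2" using ule[of "x0 + z"] T(4)[OF z] ux0 by linarith
    qed
    finally show ?thesis .
  qed
  have "((\<lambda>\<delta>. f + N * kern_moment TYPE(real^'n::_) s \<delta>) \<longlongrightarrow> f + N * 0) (at_right 0)"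
    using s by (intro tendsto_intros kern_moment_tendsto_0)
  moreover have "eventually (\<lambda>\<delta>. trunc_lap s \<delta> (glue U \<phi> u) x0 \<le> f + N * kern_moment TYPE(real^'n::_) s \<delta>) (at_right 0)"
    unfolding eventually_at using T(1) le by (intro exI[of _ \<rho>]) auto
  ultimately have "L \<le> f + N * 0" using tendsto_le[OF trivial_limit_at_right_real _ T(5)] by blast
  then show ?thesis using T(6) frac_const_pos[OF s, where 'n='n] by simp
qed

text \<open>The test function is the quadratic \<open>Q\<close> plus \<open>(norm (x - x\<^sub>0))\<^sup>2\<close> times a polynomial
  approximating \<open>(u - Q) / (norm (x - x\<^sub>0))\<^sup>2\<close>, cut off near \<open>x\<^sub>0\<close>, from above. Being a polynomial,
  it is smooth without further ado.\<close>

lemma quadratic_touch_polynomial: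
  fixes u :: "'a::euclidean_space \<Rightarrow> real"
  assumes U: "open U" "x0 \<in> U" "compact (closure U)" and u: "continuous_on UNIV u"
    and N: "0 \<le> N" and \<delta>: "0 < \<delta>" and \<eta>: "0 < \<eta>"
    and touch: "\<And>z. norm z < 2 * \<delta> \<Longrightarrow> u (x0 + z) \<le> u x0 + b \<bullet> z + N * (norm z)\<^sup>2"
  obtains \<psi> where "test_above U x0 u \<psi>"
    "\<And>z. norm z < 2 * \<delta> \<Longrightarrow> x0 + z \<in> U \<Longrightarrow> \<psi> (x0 + z) \<le> u x0 + b \<bullet> z + (N + \<eta>) * (norm z)\<^sup>2"
    "\<And>x. x \<in> U \<Longrightarrow> 2 * \<delta> \<le> norm (x - x0) \<Longrightarrow> \<psi> x \<le> u x + \<eta> * (norm (x - x0))\<^sup>2"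
proof -
  define Q where "Q = (\<lambda>x. u x0 + b \<bullet> (x - x0) + N * (norm (x - x0))\<^sup>2)"
  \<comment> \<open>A cut-off that is 0 within radius \<open>\<delta>\<close> and 1 beyond
    \<open>2 * \<delta>\<close>.\<close>
  define t where "t = (\<lambda>x. max 0 (min 1 (norm (x - x0) / \<delta> - 1)))"
  \<comment> \<open>The continuous quotient to be approximated. The maximum in the denominator only
    avoids division by zero: where it differs from \<open>norm (x - x0)\<close>, the factor
    \<open>t x\<close> is 0.\<close>
  define m where "m = (\<lambda>x. (u x - Q x) / (max \<delta> (norm (x - x0)))\<^sup>2 * t x)"
  have m1: "m x = 0" if "norm (x - x0) < \<delta>" for x
    using that \<delta> by (simp add: m_def t_def field_simps)
  have m2: "m x * (norm (x - x0))\<^sup>2 = (u x - Q x) * t x" if "\<delta> \<le> norm (x - x0)" for x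
    using that \<delta> by (cases "x = x0") (auto simp: m_def max_absorb2)
  have t3: "t x = 1" if "2 * \<delta> \<le> norm (x - x0)" for x
    using that \<delta> by (simp add: t_def field_simps)
  have t01: "0 \<le> t x" "t x \<le> 1" for x by (auto simp: t_def)
  have uQ: "u x \<le> Q x" if "norm (x - x0) < 2 * \<delta>" for x
    using touch[OF that] by (simp add: Q_def)
  have mneg: "m x \<le> 0" if "norm (x - x0) < 2 * \<delta>" for x
    using uQ[OF that] t01[of x] unfolding m_def by (intro mult_nonpos_nonneg divide_nonpos_nonneg) auto
  have mlow: "u x - Q x \<le> m x * (norm (x - x0))\<^sup>2" for x
  proof -
    consider "norm (x - x0) < \<delta>" | "\<delta> \<le> norm (x - x0)" "norm (x - x0) < 2 * \<delta>" | "2 * \<delta> \<le> norm (x - x0)"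
      by linarith
    then show ?thesis
    proof cases
      case 1
      then show ?thesis using m1[OF 1] uQ[of x] \<delta> by simp
    next
      case 2
      then have "(u x - Q x) * 1 \<le> (u x - Q x) * t x"
        using uQ[of x] t01[of x] by (intro mult_left_mono_neg) auto
      then show ?thesis using m2[OF 2(1)] by simp
    next
      case 3
      then show ?thesis using m2[of x] t3[OF 3] \<delta> by simp
    qed
  qed
  have mcont: "continuous_on UNIV m"
    unfolding m_def Q_def t_def using \<delta> by (intro continuous_intros u) auto
  \<comment> \<open>Approximating \<open>m + \<eta> / 2\<close> within \<open>\<eta> / 2\<close>
    makes the approximation one-sided, between \<open>m\<close> and
    \<open>m + \<eta>\<close>.\<close>
  have mcont': "continuous_on (closure U) (\<lambda>x. m x + \<eta> / 2)"
    using continuous_on_subset[OF mcont] by (intro continuous_intros) auto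
  have \<eta>2: "0 < \<eta> / 2" using \<eta> by simp
  obtain P where P: "real_polynomial_function P" "\<And>x. x \<in> closure U \<Longrightarrow> \<bar>(m x + \<eta> / 2) - P x\<bar> < \<eta> / 2"
    using Stone_Weierstrass_real_polynomial_function[OF U(3) mcont' \<eta>2] by blast
  have P1: "m x \<le> P x" and P2: "P x \<le> m x + \<eta>" if "x \<in> U" for x
  proof -
    have "x \<in> closure U" using that closure_subset by blast
    then have "\<bar>(m x + \<eta> / 2) - P x\<bar> < \<eta> / 2" by (rule P(2))
    then show "m x \<le> P x" "P x \<le> m x + \<eta>" unfolding abs_less_iff by linarith+
  qed
  define \<psi> where "\<psi> = (\<lambda>x. Q x + P x * (norm (x - x0))\<^sup>2)"
  have sq: "real_polynomial_function (\<lambda>x. (norm (x - x0))\<^sup>2)"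
    unfolding power2_norm_eq_inner inner_diff_left inner_diff_right
  proof (intro real_polynomial_function_diff)
    have "real_polynomial_function (\<lambda>x::'a. \<Sum>i\<in>Basis. (x \<bullet> i) * (x \<bullet> i))"
      by (intro real_polynomial_function_sum real_polynomial_function.intros(4) real_polynomial_function.intros(1) bounded_linear_inner_left) auto
    then show "real_polynomial_function (\<lambda>x::'a. x \<bullet> x)" by (subst euclidean_inner)
  qed (auto intro: bounded_linear_inner_left bounded_linear_inner_right)
  have "real_polynomial_function Q"
    unfolding Q_def inner_diff_right using sq
    by (intro real_polynomial_function.intros(3) real_polynomial_function.intros(4) real_polynomial_function_diff)
       (auto intro: bounded_linear_inner_right)
  then have poly: "real_polynomial_function \<psi>"
    unfolding \<psi>_def using sq P(1) by (intro real_polynomial_function.intros(3) real_polynomial_function.intros(4))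
  show thesis
  proof (rule that[of \<psi>])
    show "test_above U x0 u \<psi>"
      unfolding test_above_def
    proof (intro conjI ballI)
      show "Ck_closure 2 U \<psi>" by (rule Ck_closure_polynomial[OF poly])
      show "u x0 = \<psi> x0" by (simp add: \<psi>_def Q_def)
      fix x assume "x \<in> U"
      then have "m x * (norm (x - x0))\<^sup>2 \<le> P x * (norm (x - x0))\<^sup>2" using P1 by (intro mult_right_mono) auto
      then show "u x \<le> \<psi> x" using mlow[of x] by (simp add: \<psi>_def)
    qed
    fix z assume z: "norm z < 2 * \<delta>" "x0 + z \<in> U"
    have "P (x0 + z) \<le> \<eta>" using P2[OF z(2)] mneg[of "x0 + z"] z by simp
    then have "P (x0 + z) * (norm z)\<^sup>2 \<le> \<eta> * (norm z)\<^sup>2" by (intro mult_right_mono) auto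
    then show "\<psi> (x0 + z) \<le> u x0 + b \<bullet> z + (N + \<eta>) * (norm z)\<^sup>2"
      by (simp add: \<psi>_def Q_def algebra_simps)
  next
    fix x assume x: "x \<in> U" "2 * \<delta> \<le> norm (x - x0)"
    have "P x * (norm (x - x0))\<^sup>2 \<le> (m x + \<eta>) * (norm (x - x0))\<^sup>2"
      using P2[OF x(1)] by (intro mult_right_mono) auto
    also have "\<dots> = (u x - Q x) + \<eta> * (norm (x - x0))\<^sup>2"
      using m2[of x] t3[OF x(2)] x(2) \<delta> by (simp add: algebra_simps)
    finally show "\<psi> x \<le> u x + \<eta> * (norm (x - x0))\<^sup>2" by (simp add: \<psi>_def)
  qed
qed

text \<open>The set \<open>U\<close> is prescribed, so a test function replaces \<open>u\<close> on
  all of it and not only near \<open>x0\<close>. The polynomial from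
  \<open>quadratic_touch_polynomial\<close> obeys the paraboloid bound within radius
  \<open>2 * \<delta>\<close> and exceeds \<open>u\<close> by at most
  \<open>\<eta> * R\<^sup>2\<close> in the rest of \<open>U\<close>. The inequality for the glued
  function becomes one for \<open>u\<close>, up to a multiple of \<open>\<eta>\<close>.\<close>

lemma viscosity_imp_sub_at:
  fixes u :: "real^'n::{finite,wellorder} \<Rightarrow> real"
  assumes s: "0 < s" "s < 1" and U: "open U" "x0 \<in> U" "compact (closure U)"
    and u: "bounded_borel u" "continuous_on UNIV u"
    and visc: "\<And>\<phi>. test_above U x0 u \<phi> \<Longrightarrow> frac_laplacian s (glue U \<phi> u) x0 \<le> frac_const TYPE('n) s * f"
  shows "sub_at s u f x0"
proof (rule sub_atI_small[OF s u(1)])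
  fix \<rho> b N
  assume \<rho>: "0 < \<rho>" and N: "0 \<le> N"
    and touch: "\<And>z. norm z < \<rho> \<Longrightarrow> u (x0 + z) \<le> u x0 + b \<bullet> z + N * (norm z)\<^sup>2"
  obtain r where r: "0 < r" "ball x0 r \<subseteq> U" using U open_contains_ball by blast
  have inU: "x0 + z \<in> U" if "norm z < r" for z
    using r(2) that by (auto simp: subset_iff dist_norm)
  have "bounded U" using U(3) bounded_subset[OF compact_imp_bounded closure_subset] by blast
  then obtain R where R: "0 < R" "U \<subseteq> ball x0 R" using bounded_subset_ballD by blast
  have "trunc_lap s (2 * \<delta>) u x0 \<le> f + N * kern_moment TYPE(real^'n::_) s (2 * \<delta>)"
    if \<delta>: "0 < \<delta>" "2 * \<delta> < min \<rho> r" for \<delta>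
  proof -
    \<comment> \<open>Both costs of \<open>\<eta>\<close>: the wider opening
      \<open>N + \<eta>\<close> inside the small ball and the excess over \<open>u\<close> outside
      it.\<close>
    define K where "K = kern_moment TYPE(real^'n::_) s (2 * \<delta>) + R\<^sup>2 * kern_tail TYPE(real^'n::_) s (2 * \<delta>)"
    have le: "trunc_lap s (2 * \<delta>) u x0 \<le> f + N * kern_moment TYPE(real^'n::_) s (2 * \<delta>) + \<eta> * K" if \<eta>: "0 < \<eta>" for \<eta>
    proof -
      have touch': "u (x0 + z) \<le> u x0 + b \<bullet> z + N * (norm z)\<^sup>2" if "norm z < 2 * \<delta>" for z
        using touch that \<delta> by simp
      obtain \<psi> where \<psi>: "test_above U x0 u \<psi>"
        "\<And>z. norm z < 2 * \<delta> \<Longrightarrow> x0 + z \<in> U \<Longrightarrow> \<psi> (x0 + z) \<le> u x0 + b \<bullet> z + (N + \<eta>) * (norm z)\<^sup>2"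
        "\<And>x. x \<in> U \<Longrightarrow> 2 * \<delta> \<le> norm (x - x0) \<Longrightarrow> \<psi> x \<le> u x + \<eta> * (norm (x - x0))\<^sup>2"
        using quadratic_touch_polynomial[OF U u(2) N \<delta>(1) \<eta> touch'] by metis
      define w where "w = glue U \<psi> u"
      obtain L where L: "((\<lambda>\<epsilon>. trunc_lap s \<epsilon> w x0) \<longlongrightarrow> L) (at_right 0)"
          "frac_laplacian s w x0 = frac_const TYPE('n) s * L"
        using test_above_taylor[OF s U u(1) \<psi>(1)] unfolding w_def by metis
      have "frac_const TYPE('n) s * L \<le> frac_const TYPE('n) s * f"
        using visc[OF \<psi>(1)] L(2) by (simp add: w_def)
      then have Lf: "L \<le> f" using frac_const_pos[OF s, where 'n='n] by simp
      have wbm: "bounded_borel w" unfolding w_def using \<psi>(1) by (intro bounded_borel_glue[OF u(1) U(1,3)]) (simp add: test_above_def)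
      have wx0: "w x0 = u x0" using \<psi>(1) U(2) by (simp add: w_def glue_def test_above_def)
      have wtouch: "w (x0 + z) \<le> w x0 + b \<bullet> z + (N + \<eta>) * (norm z)\<^sup>2 + 0" if "norm z < 2 * \<delta>" for z
        using \<psi>(2)[OF that] inU[of z] that \<delta> by (simp add: w_def glue_def wx0[unfolded w_def glue_def])
      have ring: "trunc_lap s (2 * \<delta>) w x0 - (N + \<eta>) * kern_moment TYPE(real^'n::_) s (2 * \<delta>) - 0 * kern_tail TYPE(real^'n::_) s \<epsilon> \<le> trunc_lap s \<epsilon> w x0"
        if "0 < \<epsilon>" "\<epsilon> < 2 * \<delta>" for \<epsilon>
        using that N \<eta> wtouch by (intro trunc_lap_ring_ge[OF s wbm, where b = b]) auto
      have "eventually (\<lambda>\<epsilon>. trunc_lap s (2 * \<delta>) w x0 - (N + \<eta>) * kern_moment TYPE(real^'n::_) s (2 * \<delta>) \<le> trunc_lap s \<epsilon> w x0) (at_right 0)"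
        by (rule eventually_at_rightI[where b = "2 * \<delta>"]) (use ring \<delta> in auto)
      then have "trunc_lap s (2 * \<delta>) w x0 - (N + \<eta>) * kern_moment TYPE(real^'n::_) s (2 * \<delta>) \<le> L"
        using tendsto_lowerbound[OF L(1)] trivial_limit_at_right_real by blast
      moreover have "trunc_lap s (2 * \<delta>) u x0 - \<eta> * R\<^sup>2 * kern_tail TYPE(real^'n::_) s (2 * \<delta>) \<le> trunc_lap s (2 * \<delta>) w x0"
      proof -
        have "(\<integral>z. (u x0 - u (x0 + z)) * trunc_kern s (2 * \<delta>) z - (\<eta> * R\<^sup>2) * trunc_kern s (2 * \<delta>) z \<partial>lborel) \<le> trunc_lap s (2 * \<delta>) w x0"
          unfolding trunc_lap_def
        proof (rule integral_mono)
          show "integrable lborel (\<lambda>z. (u x0 - u (x0 + z)) * trunc_kern s (2 * \<delta>) z - (\<eta> * R\<^sup>2) * trunc_kern s (2 * \<delta>) z)"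
            using \<delta> s by (intro Bochner_Integration.integrable_diff integrable_trunc u integrable_mult_right) auto
          show "integrable lborel (\<lambda>z. (w x0 - w (x0 + z)) * trunc_kern s (2 * \<delta>) z)"
            using \<delta> s by (intro integrable_trunc wbm) auto
          fix z :: "real^'n::_"
          show "(u x0 - u (x0 + z)) * trunc_kern s (2 * \<delta>) z - (\<eta> * R\<^sup>2) * trunc_kern s (2 * \<delta>) z \<le> (w x0 - w (x0 + z)) * trunc_kern s (2 * \<delta>) z"
          proof (cases "2 * \<delta> \<le> norm z")
            case True
            have "w (x0 + z) \<le> u (x0 + z) + \<eta> * R\<^sup>2"
            proof (cases "x0 + z \<in> U")
              case in_U: True
              then have "norm z < R" using R(2) by (auto simp: subset_iff dist_norm)
              then have "\<eta> * (norm z)\<^sup>2 \<le> \<eta> * R\<^sup>2" using \<eta> by (intro mult_left_mono power_mono) auto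
              then show ?thesis using \<psi>(3)[OF in_U] True in_U by (simp add: w_def glue_def)
            next
              case False
              then show ?thesis using \<eta> by (simp add: w_def glue_def)
            qed
            then have "(u x0 - u (x0 + z) - \<eta> * R\<^sup>2) * trunc_kern s (2 * \<delta>) z \<le> (w x0 - w (x0 + z)) * trunc_kern s (2 * \<delta>) z"
              using wx0 by (intro mult_right_mono) auto
            then show ?thesis by (simp add: left_diff_distrib)
          qed (simp add: trunc_kern_def)
        qed
        moreover have "(\<integral>z. (u x0 - u (x0 + z)) * trunc_kern s (2 * \<delta>) z - (\<eta> * R\<^sup>2) * trunc_kern s (2 * \<delta>) z \<partial>lborel)
          = trunc_lap s (2 * \<delta>) u x0 - \<eta> * R\<^sup>2 * kern_tail TYPE(real^'n::_) s (2 * \<delta>)"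
          unfolding trunc_lap_def kern_tail_def integral_mult_right_zero[symmetric] using \<delta> s
          by (intro Bochner_Integration.integral_diff integrable_trunc u integrable_mult_right) auto
        ultimately show ?thesis by simp
      qed
      ultimately show ?thesis using Lf by (simp add: K_def algebra_simps)
    qed
    have "((\<lambda>\<eta>. f + N * kern_moment TYPE(real^'n::_) s (2 * \<delta>) + \<eta> * K) \<longlongrightarrow> f + N * kern_moment TYPE(real^'n::_) s (2 * \<delta>) + 0 * K) (at_right 0)"
      by (intro tendsto_intros)
    moreover have "eventually (\<lambda>\<eta>. trunc_lap s (2 * \<delta>) u x0 \<le> f + N * kern_moment TYPE(real^'n::_) s (2 * \<delta>) + \<eta> * K) (at_right 0)"
      by (rule eventually_at_rightI[where b = 1]) (use le in auto)
    ultimately show ?thesis using tendsto_lowerbound trivial_limit_at_right_real by fastforce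
  qed
  from this[of "\<delta> / 2" for \<delta>]
  show "\<exists>d>0. \<forall>\<delta>. 0 < \<delta> \<and> \<delta> < d \<longrightarrow> trunc_lap s \<delta> u x0 \<le> f + N * kern_moment TYPE(real^'n::_) s \<delta>"
    using \<rho> r(1) by (intro exI[of _ "min \<rho> r"]) auto
qed

section \<open>Passing from subsolutions to supersolutions by negation\<close>

lemma iter_partial_minus:
  fixes \<phi> :: "'a::euclidean_space \<Rightarrow> real" and bs :: "'a list"
  assumes "Ck_on k U \<phi>" "open U"
  shows "set bs \<subseteq> Basis \<Longrightarrow> length bs \<le> k \<Longrightarrow> x \<in> U \<Longrightarrow> iter_partial bs (\<lambda>x. - \<phi> x) x = - iter_partial bs \<phi> x"
proof (induction bs arbitrary: x)
  case (Cons i bs)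
  have d: "iter_partial bs \<phi> differentiable (at x)"
    using assms(1) Cons.prems unfolding Ck_on_def by auto
  then have "((\<lambda>y. - iter_partial bs \<phi> y) has_derivative (\<lambda>h. - frechet_derivative (iter_partial bs \<phi>) (at x) h)) (at x)"
    by (intro has_derivative_minus) (simp flip: frechet_derivative_works)
  \<comment> \<open>The induction hypothesis is an identity on \<open>U\<close> only; openness of
    \<open>U\<close> suffices to transfer the derivative at \<open>x\<close>.\<close>
  then have "(iter_partial bs (\<lambda>x. - \<phi> x) has_derivative (\<lambda>h. - frechet_derivative (iter_partial bs \<phi>) (at x) h)) (at x)"
    by (rule has_derivative_transform_within_open[OF _ assms(2) Cons.prems(3)]) (use Cons in auto)
  from frechet_derivative_at[OF this] show ?case by (simp add: fun_eq_iff)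
qed simp

lemma Ck_closure_minus:
  fixes \<phi> :: "'a::euclidean_space \<Rightarrow> real"
  assumes "Ck_closure k U \<phi>" "open U"
  shows "Ck_closure k U (\<lambda>x. - \<phi> x)"
proof -
  have Ck: "Ck_on k U \<phi>" using assms(1) by (simp add: Ck_closure_def)
  note eq = iter_partial_minus[OF Ck assms(2)]
  show ?thesis unfolding Ck_closure_def Ck_on_def
  proof (intro conjI allI impI ballI; elim conjE)
    fix bs :: "'a list" assume bs: "set bs \<subseteq> Basis" "length bs \<le> k"
    have "continuous_on U (\<lambda>x. - iter_partial bs \<phi> x)"
      using Ck bs unfolding Ck_on_def by (intro continuous_on_minus) auto
    then show "continuous_on U (iter_partial bs (\<lambda>x. - \<phi> x))"
      using eq[OF bs] by (simp cong: continuous_on_cong_simp)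
    obtain g where "continuous_on (closure U) g" "\<forall>x\<in>U. g x = iter_partial bs \<phi> x"
      using assms(1) bs unfolding Ck_closure_def by auto
    then show "\<exists>g. continuous_on (closure U) g \<and> (\<forall>x\<in>U. g x = iter_partial bs (\<lambda>x. - \<phi> x) x)"
      using eq[OF bs] by (intro exI[of _ "\<lambda>x. - g x"]) (auto intro: continuous_on_minus)
  next
    fix bs :: "'a list" and x assume bs: "set bs \<subseteq> Basis" "length bs < k" and x: "x \<in> U"
    have d: "iter_partial bs \<phi> differentiable (at x)" using Ck bs x unfolding Ck_on_def by auto
    then obtain D where "(iter_partial bs \<phi> has_derivative D) (at x)" unfolding differentiable_def by blast
    then have "((\<lambda>y. - iter_partial bs \<phi> y) has_derivative (\<lambda>h. - D h)) (at x)" by (rule has_derivative_minus)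
    then have "(iter_partial bs (\<lambda>x. - \<phi> x) has_derivative (\<lambda>h. - D h)) (at x)"
      by (rule has_derivative_transform_within_open[OF _ assms(2) x]) (use eq bs in auto)
    then show "iter_partial bs (\<lambda>x. - \<phi> x) differentiable (at x)" unfolding differentiable_def by blast
  qed
qed

lemma test_below_minus:
  assumes "test_below U x0 u \<phi>" "open U"
  shows "test_above U x0 (\<lambda>x. - u x) (\<lambda>x. - \<phi> x)"
  using assms Ck_closure_minus[of 2 U \<phi>] by (auto simp: test_below_def test_above_def)

lemma test_above_minus:
  assumes "test_above U x0 u \<phi>" "open U"
  shows "test_below U x0 (\<lambda>x. - u x) (\<lambda>x. - \<phi> x)"
  using assms Ck_closure_minus[of 2 U \<phi>] by (auto simp: test_below_def test_above_def)

text \<open>\<open>Lim\<close> commutes with negation because the principal value exists for the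
  glued function; without convergence the two sides would be unrelated.\<close>

lemma frac_laplacian_glue_minus:
  fixes u :: "real^'n::{finite,wellorder} \<Rightarrow> real"
  assumes s: "0 < s" "s < 1" and U: "open U" "x0 \<in> U" "compact (closure U)" and u: "bounded_borel u"
    and t: "test_above U x0 u \<phi>"
  shows "frac_laplacian s (glue U (\<lambda>x. - \<phi> x) (\<lambda>x. - u x)) x0 = - frac_laplacian s (glue U \<phi> u) x0"
proof -
  obtain L where L: "((\<lambda>\<epsilon>. trunc_lap s \<epsilon> (glue U \<phi> u) x0) \<longlongrightarrow> L) (at_right 0)"
    "frac_laplacian s (glue U \<phi> u) x0 = frac_const TYPE('n) s * L"
    using test_above_taylor[OF s U u t] by metis
  have eq: "glue U (\<lambda>x. - \<phi> x) (\<lambda>x. - u x) = (\<lambda>x. - glue U \<phi> u x)" by (auto simp: glue_def)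
  have "bounded_borel (glue U \<phi> u)" using t by (intro bounded_borel_glue[OF u U(1,3)]) (simp add: test_above_def)
  then have "(\<lambda>x. - glue U \<phi> u x) \<in> borel_measurable borel" by (simp add: bounded_borel_def)
  moreover have "((\<lambda>\<epsilon>. trunc_lap s \<epsilon> (\<lambda>x. - glue U \<phi> u x) x0) \<longlongrightarrow> - L) (at_right 0)"
    using tendsto_minus[OF L(1)] by simp
  ultimately show ?thesis unfolding eq using L(2) by (simp add: frac_laplacian_eq)
qed

lemma super_at_imp_viscosity:
  fixes u :: "real^'n::{finite,wellorder} \<Rightarrow> real"
  assumes s: "0 < s" "s < 1" and U: "open U" "x0 \<in> U" "compact (closure U)" and u: "bounded_borel u"
    and super: "super_at s u f x0" and t: "test_below U x0 u \<phi>"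
  shows "frac_const TYPE('n) s * f \<le> frac_laplacian s (glue U \<phi> u) x0"
proof -
  note t' = test_below_minus[OF t U(1)]
  have "frac_laplacian s (glue U (\<lambda>x. - \<phi> x) (\<lambda>x. - u x)) x0 \<le> frac_const TYPE('n) s * (- f)"
    using super unfolding super_at_def by (intro sub_at_imp_viscosity[OF s U _ _ t']) (simp_all add: u)
  moreover have "frac_laplacian s (glue U \<phi> u) x0 = - frac_laplacian s (glue U (\<lambda>x. - \<phi> x) (\<lambda>x. - u x)) x0"
    using frac_laplacian_glue_minus[OF s U _ t'] u by simp
  ultimately show ?thesis by simp
qed

lemma viscosity_imp_super_at:
  fixes u :: "real^'n::{finite,wellorder} \<Rightarrow> real"
  assumes s: "0 < s" "s < 1" and U: "open U" "x0 \<in> U" "compact (closure U)"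
    and u: "bounded_borel u" "continuous_on UNIV u"
    and visc: "\<And>\<phi>. test_below U x0 u \<phi> \<Longrightarrow> frac_const TYPE('n) s * f \<le> frac_laplacian s (glue U \<phi> u) x0"
  shows "super_at s u f x0"
  unfolding super_at_def
proof (rule viscosity_imp_sub_at[OF s U])
  fix \<phi> assume t: "test_above U x0 (\<lambda>x. - u x) \<phi>"
  have bounded_borel: "bounded_borel (\<lambda>x. - u x)" using u by simp
  have "test_below U x0 u (\<lambda>x. - \<phi> x)" using test_above_minus[OF t U(1)] by simp
  from visc[OF this] have "frac_const TYPE('n) s * f \<le> frac_laplacian s (glue U (\<lambda>x. - \<phi> x) u) x0" .
  also have "\<dots> = - frac_laplacian s (glue U \<phi> (\<lambda>x. - u x)) x0"
    using frac_laplacian_glue_minus[OF s U bounded_borel t] by simp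
  finally show "frac_laplacian s (glue U \<phi> (\<lambda>x. - u x)) x0 \<le> frac_const TYPE('n) s * (- f)" by simp
qed (use u in \<open>auto intro: continuous_on_minus\<close>)

section \<open>Solutions of the truncated system\<close>

lemma bounded_borel_limit:
  assumes "\<And>k. bounded_borel (U k)" "\<And>k x. \<bar>U k x\<bar> \<le> M" "\<And>x. (\<lambda>k. U k x) \<longlonglongrightarrow> u x"
  shows "bounded_borel u"
proof (rule bounded_borelI)
  show "u \<in> borel_measurable borel"
    using assms(1,3) by (intro borel_measurable_LIMSEQ_real[of _ U u]) (auto dest: bounded_borel_measurable)
  show "\<bar>u x\<bar> \<le> M" for x
    by (rule LIMSEQ_le_const2[OF tendsto_rabs[OF assms(3)]]) (use assms(2) in blast)
qed

context
  fixes s :: real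
  assumes s: "0 < s" "s < 1"
begin

lemma trunc_kern_average_tendsto:
  fixes x :: "'a::euclidean_space"
  assumes U: "\<And>k. bounded_borel (U k)" "\<And>k x. \<bar>U k x\<bar> \<le> M" "\<And>x. (\<lambda>k. U k x) \<longlonglongrightarrow> u x" and \<epsilon>: "0 < \<epsilon>"
  shows "(\<lambda>k. \<integral>z. U k (x + z) * trunc_kern s \<epsilon> z \<partial>lborel) \<longlonglongrightarrow> (\<integral>z. u (x + z) * trunc_kern s \<epsilon> z \<partial>lborel)"
proof (rule integral_dominated_convergence)
  show "integrable lborel (\<lambda>z::'a. M * trunc_kern s \<epsilon> z)" using s \<epsilon> by auto
  have [measurable]: "u \<in> borel_measurable borel" "\<And>k. U k \<in> borel_measurable borel"
    using bounded_borel_limit[OF U] U(1) by (auto simp: bounded_borel_def)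
  show "(\<lambda>z. u (x + z) * trunc_kern s \<epsilon> z) \<in> borel_measurable lborel"
    "(\<lambda>z. U k (x + z) * trunc_kern s \<epsilon> z) \<in> borel_measurable lborel" for k by measurable
  show "AE z in lborel. (\<lambda>k. U k (x + z) * trunc_kern s \<epsilon> z) \<longlonglongrightarrow> u (x + z) * trunc_kern s \<epsilon> z"
    by (intro AE_I2 tendsto_intros U(3))
  show "AE z in lborel. norm (U k (x + z) * trunc_kern s \<epsilon> z) \<le> M * trunc_kern s \<epsilon> z" for k
    using U(2) by (intro AE_I2) (auto simp: abs_mult intro: mult_right_mono)
qed

text \<open>Since the truncated kernel is integrable, \<open>trunc_lap\<close> is multiplication by
  its mass minus an average. The system becomes a fixed-point problem for a map that is monotone on
  nonnegative couples. Iteration from the subsolution increases, stays below the constants on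
  \<open>\<Omega>\<close>, and dominated convergence passes to the pointwise limit.\<close>

lemma approximate_solution:
  fixes u0 v0 :: "'a::euclidean_space \<Rightarrow> real"
  assumes \<Omega>: "open \<Omega>" and \<epsilon>: "0 < \<epsilon>" and c: "0 < c" and pq: "0 < p" "0 < q"
    and u0: "bounded_borel u0" "\<And>x. 0 \<le> u0 x" "\<And>x. u0 x \<le> (if x \<in> \<Omega> then A else 0)"
    and v0: "bounded_borel v0" "\<And>x. 0 \<le> v0 x" "\<And>x. v0 x \<le> (if x \<in> \<Omega> then B else 0)"
    and sub: "\<And>x. x \<in> \<Omega> \<Longrightarrow> trunc_lap s \<epsilon> u0 x \<le> c * v0 x powr p"
      "\<And>x. x \<in> \<Omega> \<Longrightarrow> trunc_lap s \<epsilon> v0 x \<le> c * u0 x powr q"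
    and super: "\<And>x. x \<in> \<Omega> \<Longrightarrow> c * B powr p \<le> trunc_lap s \<epsilon> (\<lambda>x. if x \<in> \<Omega> then A else 0) x"
      "\<And>x. x \<in> \<Omega> \<Longrightarrow> c * A powr q \<le> trunc_lap s \<epsilon> (\<lambda>x. if x \<in> \<Omega> then B else 0) x"
  obtains u v where "bounded_borel u" "bounded_borel v" "\<And>x. u0 x \<le> u x" "\<And>x. v0 x \<le> v x"
    "\<And>x. u x \<le> (if x \<in> \<Omega> then A else 0)" "\<And>x. v x \<le> (if x \<in> \<Omega> then B else 0)"
    "\<And>x. x \<in> \<Omega> \<Longrightarrow> trunc_lap s \<epsilon> u x = c * v x powr p"
    "\<And>x. x \<in> \<Omega> \<Longrightarrow> trunc_lap s \<epsilon> v x = c * u x powr q"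
proof (cases "\<Omega> = {}")
  case True
  then show thesis using that[of u0 v0] u0 v0 by simp
next
  case False
  then obtain y where "y \<in> \<Omega>" by auto
  then have AB: "0 \<le> A" "0 \<le> B" using u0(2,3)[of y] v0(2,3)[of y] by auto
  define L where "L = kern_tail TYPE('a) s \<epsilon>"
  have L: "0 < L" unfolding L_def using s \<epsilon> by (rule kern_tail_pos)
  define J where "J = (\<lambda>u x. \<integral>z. u (x + z) * trunc_kern s \<epsilon> (z::'a) \<partial>lborel)"
  \<comment> \<open>The equation \<open>u x * L - J u x = c * v x powr e\<close> solved for
    \<open>u x\<close>, with the exterior value 0 imposed off \<open>\<Omega>\<close>.\<close>
  define step where "step = (\<lambda>e u v x. if x \<in> \<Omega> then (J u x + c * v x powr e) / L else (0::real))"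
  have tl: "trunc_lap s \<epsilon> u x = u x * L - J u x" if "bounded_borel u" for u and x :: 'a
    using trunc_lap_eq[OF s that \<epsilon>] by (simp add: L_def J_def)
  have J_mono: "J u x \<le> J v x" if "bounded_borel u" "bounded_borel v" "\<And>x. u x \<le> v x" for u v x
    unfolding J_def using that s \<epsilon> by (intro integral_mono integrable_times_trunc_kern mult_right_mono) auto
  have J_meas: "J u \<in> borel_measurable borel" if "bounded_borel u" for u
  proof -
    have [measurable]: "u \<in> borel_measurable borel" using that by (rule bounded_borel_measurable)
    show ?thesis unfolding J_def by measurable
  qed
  have step_mono: "step e u v x \<le> step e u' v' x"
    if "bounded_borel u" "bounded_borel u'" "\<And>x. u x \<le> u' x" "\<And>x. 0 \<le> v x" "\<And>x. v x \<le> v' x" "0 < e" for e u v u' v' x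
    unfolding step_def using that L c J_mono[OF that(1-3), of x]
    by (auto intro!: divide_right_mono add_mono mult_left_mono powr_mono2)
  have step_bm: "bounded_borel (step e u v)" if "bounded_borel u" "bounded_borel v" "\<And>x. \<bar>step e u v x\<bar> \<le> M" for e u v M
  proof (rule bounded_borelI)
    have [measurable]: "J u \<in> borel_measurable borel" "v \<in> borel_measurable borel" "\<Omega> \<in> sets borel"
      using J_meas that \<Omega> by (auto dest: bounded_borel_measurable)
    show "step e u v \<in> borel_measurable borel" unfolding step_def by measurable
  qed (use that in auto)
  define uA where "uA = (\<lambda>x. if x \<in> \<Omega> then A else 0)"
  define vB where "vB = (\<lambda>x. if x \<in> \<Omega> then B else 0)"
  have "(\<lambda>x. if x \<in> \<Omega> then a else 0) \<in> borel_measurable borel" for a :: real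
    using \<Omega> by (intro measurable_If_set) auto
  then have bmAB: "bounded_borel uA" "bounded_borel vB"
    unfolding uA_def vB_def using AB by (intro bounded_borelI[of _ A] bounded_borelI[of _ B]; simp)+
  have step_sup: "step p uA vB x \<le> uA x" "step q vB uA x \<le> vB x" for x
    using super[of x] tl[OF bmAB(1), of x] tl[OF bmAB(2), of x] L
    by (auto simp: step_def uA_def vB_def field_simps)
  have step_sub: "u0 x \<le> step p u0 v0 x" "v0 x \<le> step q v0 u0 x" for x
    using sub[of x] tl[OF u0(1), of x] tl[OF v0(1), of x] u0(3)[of x] v0(3)[of x] L
    by (auto simp: step_def field_simps)
  define W where "W = (\<lambda>k. ((\<lambda>(u, v). (step p u v, step q v u)) ^^ k) (u0, v0))"
  define U where "U = (\<lambda>k. fst (W k))"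
  define V where "V = (\<lambda>k. snd (W k))"
  have U_0: "U 0 = u0" and V_0: "V 0 = v0" by (auto simp: U_def V_def W_def)
  have U_Suc: "U (Suc k) = step p (U k) (V k)" and V_Suc: "V (Suc k) = step q (V k) (U k)" for k
    by (auto simp: U_def V_def W_def split_beta)
  have uA_le: "uA x \<le> A" and vB_le: "vB x \<le> B" for x using AB by (auto simp: uA_def vB_def)
  have inv: "bounded_borel (U k) \<and> bounded_borel (V k) \<and> (\<forall>x. 0 \<le> U k x \<and> 0 \<le> V k x \<and> U k x \<le> uA x \<and> V k x \<le> vB x
      \<and> U k x \<le> U (Suc k) x \<and> V k x \<le> V (Suc k) x)" for k
  proof (induction k)
    case 0
    then show ?case using u0 v0 step_sub by (auto simp: U_0 V_0 U_Suc V_Suc uA_def vB_def)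
  next
    case (Suc k)
    have up: "U (Suc k) x \<le> uA x" "V (Suc k) x \<le> vB x" for x
    proof -
      have "U (Suc k) x \<le> step p uA vB x" "V (Suc k) x \<le> step q vB uA x"
        unfolding U_Suc V_Suc using Suc bmAB pq by (intro step_mono; simp)+
      then show "U (Suc k) x \<le> uA x" "V (Suc k) x \<le> vB x" using step_sup[of x] by linarith+
    qed
    have lo: "0 \<le> U (Suc k) x" "0 \<le> V (Suc k) x" for x using Suc order_trans by blast+
    have absSuc: "\<bar>step p (U k) (V k) x\<bar> \<le> A" "\<bar>step q (V k) (U k) x\<bar> \<le> B" for x
      using up[of x] lo[of x] uA_le[of x] vB_le[of x] unfolding U_Suc V_Suc by linarith+
    have bms: "bounded_borel (U (Suc k))" "bounded_borel (V (Suc k))"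
      unfolding U_Suc V_Suc using Suc by (blast intro: step_bm absSuc)+
    have "U (Suc k) x \<le> U (Suc (Suc k)) x" "V (Suc k) x \<le> V (Suc (Suc k)) x" for x
      unfolding U_Suc[of "Suc k"] V_Suc[of "Suc k"] U_Suc[of k] V_Suc[of k]
      using Suc bms pq by (intro step_mono; simp add: U_Suc V_Suc)+
    then show ?case using up lo bms by auto
  qed
  have inc: "incseq (\<lambda>k. U k x)" "incseq (\<lambda>k. V k x)" for x using inv by (auto intro!: incseq_SucI)
  have "\<exists>l. (\<lambda>k. U k x) \<longlonglongrightarrow> l" "\<exists>l. (\<lambda>k. V k x) \<longlonglongrightarrow> l" for x
  proof -
    have "\<forall>k. U k x \<le> uA x" "\<forall>k. V k x \<le> vB x" using inv by auto
    then show "\<exists>l. (\<lambda>k. U k x) \<longlonglongrightarrow> l" "\<exists>l. (\<lambda>k. V k x) \<longlonglongrightarrow> l"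
      using incseq_convergent[OF inc(1)[of x]] incseq_convergent[OF inc(2)[of x]] by metis+
  qed
  then obtain u v where lim: "\<And>x. (\<lambda>k. U k x) \<longlonglongrightarrow> u x" "\<And>x. (\<lambda>k. V k x) \<longlonglongrightarrow> v x" by metis
  have absU: "\<bar>U k x\<bar> \<le> A" and absV: "\<bar>V k x\<bar> \<le> B" for k x
    using inv[of k] uA_le[of x] vB_le[of x] by (auto intro: order_trans)
  have bmUV: "bounded_borel (U k)" "bounded_borel (V k)" for k using inv by auto
  have bmuv: "bounded_borel u" "bounded_borel v" using bounded_borel_limit[OF bmUV(1) absU lim(1)] bounded_borel_limit[OF bmUV(2) absV lim(2)] .
  have u_ge: "U k x \<le> u x" and v_ge: "V k x \<le> v x" for k x
    using incseq_le[OF inc(1) lim(1)] incseq_le[OF inc(2) lim(2)] by auto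
  have u_le: "u x \<le> uA x" and v_le: "v x \<le> vB x" for x
    using LIMSEQ_le_const2[OF lim(1), of x "uA x"] LIMSEQ_le_const2[OF lim(2), of x "vB x"] inv by auto
  have uv0: "0 \<le> u x" "0 \<le> v x" for x using u_ge[of 0 x] v_ge[of 0 x] u0(2)[of x] v0(2)[of x] U_0 V_0 by auto
  have eq: "step e u v x = u x"
    if "\<And>k. U (Suc k) = step e (U k) (V k)" "\<And>k. bounded_borel (U k)" "\<And>k x. \<bar>U k x\<bar> \<le> M"
      "\<And>x. (\<lambda>k. U k x) \<longlonglongrightarrow> u x" "\<And>x. (\<lambda>k. V k x) \<longlonglongrightarrow> v x" "\<And>k x. 0 \<le> V k x" "0 < e" for e U V u v x M
  proof -
    have "(\<lambda>k. step e (U k) (V k) x) \<longlonglongrightarrow> step e u v x"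
    proof (cases "x \<in> \<Omega>")
      case True
      have "(\<lambda>k. V k x powr e) \<longlonglongrightarrow> v x powr e"
        using that(5-7) by (intro tendsto_powr' tendsto_const) (auto simp: always_eventually)
      moreover have "(\<lambda>k. J (U k) x) \<longlonglongrightarrow> J u x"
        unfolding J_def using that(2-4) \<epsilon> by (rule trunc_kern_average_tendsto)
      ultimately show ?thesis using True L unfolding step_def by (auto intro!: tendsto_intros)
    qed (simp add: step_def)
    moreover have "(\<lambda>k. step e (U k) (V k) x) \<longlonglongrightarrow> u x"
      using LIMSEQ_Suc[OF that(4)] unfolding that(1) .
    ultimately show ?thesis by (rule LIMSEQ_unique)
  qed
  have eqs: "step p u v x = u x" "step q v u x = v x" for x
    using inv by (blast intro: eq[OF U_Suc bmUV(1) absU lim _ pq(1)] eq[OF V_Suc bmUV(2) absV lim(2,1) _ pq(2)])+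
  show thesis
  proof (rule that[of u v])
    show "trunc_lap s \<epsilon> u x = c * v x powr p" "trunc_lap s \<epsilon> v x = c * u x powr q" if "x \<in> \<Omega>" for x
      using eqs[of x] that L unfolding tl[OF bmuv(1)] tl[OF bmuv(2)] by (auto simp: step_def field_simps)
    show "u0 x \<le> u x" "v0 x \<le> v x" for x using u_ge[of 0 x] v_ge[of 0 x] by (auto simp: U_0 V_0)
  qed (use bmuv u_le v_le in \<open>auto simp: uA_def vB_def\<close>)
qed

section \<open>A bump as lower barrier, uniformly in the truncation\<close>

lemma lower_barrier:
  fixes x1 :: "'a::euclidean_space"
  assumes r: "0 < r"
  defines "h \<equiv> \<lambda>x. max 0 (r\<^sup>2 - (norm (x - x1))\<^sup>2)"
  obtains C \<tau> \<epsilon>0 where "0 < C" "0 < \<tau>" "0 < \<epsilon>0"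
    "\<And>\<epsilon> x. 0 < \<epsilon> \<Longrightarrow> \<epsilon> \<le> \<epsilon>0 \<Longrightarrow> trunc_lap s \<epsilon> h x \<le> C"
    "\<And>\<epsilon> x. 0 < \<epsilon> \<Longrightarrow> \<epsilon> \<le> \<epsilon>0 \<Longrightarrow> h x < \<tau> \<Longrightarrow> trunc_lap s \<epsilon> h x \<le> 0"
proof -
  \<comment> \<open>A lower bound for the average of \<open>h\<close> seen from points near the edge
    of its support: \<open>h\<close> is at least \<open>3 * r\<^sup>2 / 4\<close> on the half ball,
    and the kernel at distances up to \<open>2 * r\<close> is at least the second factor.\<close>
  define c0 where "c0 = (3 * r\<^sup>2 / 4) * (1 / (2 * r) powr (real DIM('a) + 2 * s)) * measure lborel (ball x1 (r / 2))"
  have c0: "0 < c0" unfolding c0_def using r content_ball_pos[of "r / 2" x1] by (intro mult_pos_pos) auto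
  obtain \<rho> where \<rho>: "0 < \<rho>" "\<rho> < r / 4" "kern_moment TYPE('a) s \<rho> < c0 / 2"
    using kern_moment_small[OF s, of "c0 / 2" "r / 4", where 'a='a] c0 r by auto
  define L where "L = kern_tail TYPE('a) s \<rho>"
  have L: "0 < L" unfolding L_def using s \<rho>(1) by (rule kern_tail_pos)
  \<comment> \<open>The bound \<open>7 * r\<^sup>2 / 16\<close> forces
    \<open>norm (x - x1) > 3 * r / 4\<close>, so the half ball lies beyond the cut-off
    \<open>\<rho> < r / 4\<close>. The other bound makes \<open>h x * L\<close> at most
    \<open>c0 / 2\<close>. With the local cost below \<open>c0 / 2\<close>, the average
    wins.\<close>
  define \<tau> where "\<tau> = min (7 * r\<^sup>2 / 16) (c0 / (2 * L))"
  have \<tau>: "0 < \<tau>" using r c0 L by (simp add: \<tau>_def)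
  define C where "C = r\<^sup>2 * L + kern_moment TYPE('a) s \<rho> + 1"
  have C: "0 < C" using L s by (simp add: C_def add_nonneg_pos)
  have h0: "0 \<le> h x" and hr: "h x \<le> r\<^sup>2" for x by (auto simp: h_def)
  have "h \<in> borel_measurable borel" unfolding h_def by (intro borel_measurable_continuous_onI continuous_intros)
  then have bounded_borel: "bounded_borel h" using h0 hr by (intro bounded_borelI[of _ "r\<^sup>2"]) auto
  have zero: "trunc_lap s \<epsilon> h x \<le> 0" if "h x = 0" for \<epsilon> x
  proof -
    have "0 \<le> (\<integral>z. - ((h x - h (x + z)) * trunc_kern s \<epsilon> z) \<partial>lborel)"
      using h0 that by (intro integral_nonneg_AE AE_I2) auto
    then show ?thesis by (simp add: trunc_lap_def)
  qed
  have ring: "trunc_lap s \<epsilon> h x \<le> trunc_lap s \<rho> h x + kern_moment TYPE('a) s \<rho>" if \<epsilon>: "0 < \<epsilon>" "\<epsilon> \<le> \<rho>" and hx: "h x \<noteq> 0" for \<epsilon> x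
  proof -
    have hx': "h x = r\<^sup>2 - (norm (x - x1))\<^sup>2" using hx by (auto simp: h_def max_def split: if_splits)
    \<comment> \<open>Within its support \<open>- h\<close> is touched from above by a paraboloid of
      opening 1, since cutting off at 0 only raises \<open>h\<close>. This makes the bound uniform
      in \<open>\<epsilon>\<close>.\<close>
    have "trunc_lap s \<rho> (\<lambda>x. - h x) x - 1 * kern_moment TYPE('a) s \<rho> - 0 * kern_tail TYPE('a) s \<epsilon> \<le> trunc_lap s \<epsilon> (\<lambda>x. - h x) x"
    proof (rule trunc_lap_ring_ge[OF s _ \<epsilon>])
      fix z :: 'a
      have "r\<^sup>2 - (norm ((x - x1) + z))\<^sup>2 \<le> h (x + z)" by (simp add: h_def algebra_simps)
      then show "- h (x + z) \<le> - h x + (2 *\<^sub>R (x - x1)) \<bullet> z + 1 * (norm z)\<^sup>2 + 0"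
        unfolding norm_diff_square hx' by simp
    qed (use bounded_borel in auto)
    then show ?thesis by simp
  qed
  have trunc_eq: "trunc_lap s \<rho> h x = h x * L - (\<integral>z. h (x + z) * trunc_kern s \<rho> z \<partial>lborel)" for x
    unfolding L_def using s bounded_borel \<rho>(1) by (rule trunc_lap_eq)
  have int0: "0 \<le> (\<integral>z. h (x + z) * trunc_kern s \<rho> z \<partial>lborel)" for x
    using h0 by (intro integral_nonneg_AE) auto
  show thesis
  proof (rule that[OF C \<tau> \<rho>(1)])
    fix \<epsilon> and x :: 'a assume \<epsilon>: "0 < \<epsilon>" "\<epsilon> \<le> \<rho>"
    show "trunc_lap s \<epsilon> h x \<le> C"
    proof (cases "h x = 0")
      case False
      have "h x * L \<le> r\<^sup>2 * L" using hr L by (intro mult_right_mono) auto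
      then show ?thesis using ring[OF \<epsilon> False] int0[of x] unfolding trunc_eq C_def by linarith
    qed (use zero[of x \<epsilon>] C in linarith)
    assume small: "h x < \<tau>"
    show "trunc_lap s \<epsilon> h x \<le> 0"
    proof (cases "h x = 0")
      case False
      have "r\<^sup>2 - (norm (x - x1))\<^sup>2 \<le> h x" by (simp add: h_def)
      also have "h x < 7 * r\<^sup>2 / 16" using small by (simp add: \<tau>_def)
      finally have "r\<^sup>2 - (norm (x - x1))\<^sup>2 < 7 * r\<^sup>2 / 16" .
      then have "(3 * r / 4)\<^sup>2 < (norm (x - x1))\<^sup>2" by (simp add: power2_eq_square field_simps)
      then have far: "3 * r / 4 < norm (x - x1)" using power2_less_imp_less norm_ge_zero by blast
      have "(norm (x - x1))\<^sup>2 < r\<^sup>2" using False by (auto simp: h_def max_def split: if_splits)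
      then have near: "norm (x - x1) < r" using power2_less_imp_less r by (metis less_imp_le)
      have "measure lborel (ball x1 (r / 2)) = measure lborel (ball (x1 - x) (r / 2))"
        using content_ball_conv_unit_ball[of "r / 2" x1] content_ball_conv_unit_ball[of "r / 2" "x1 - x"] r by simp
      then have "c0 = (3 * r\<^sup>2 / 4) * (1 / (2 * r) powr (real DIM('a) + 2 * s)) * measure lborel (ball (x1 - x) (r / 2))"
        by (simp add: c0_def)
      also have "\<dots> \<le> (\<integral>z. h (x + z) * trunc_kern s \<rho> z \<partial>lborel)"
      proof (rule integral_ge_on_ball)
        show "integrable lborel (\<lambda>z. h (x + z) * trunc_kern s \<rho> z)" using s bounded_borel \<rho>(1) by (intro integrable_times_trunc_kern)
        show "0 \<le> h (x + z) * trunc_kern s \<rho> z" for z using h0 by simp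
        fix z assume "z \<in> ball (x1 - x) (r / 2)"
        then have z: "norm (x + z - x1) < r / 2" by (simp add: dist_norm norm_minus_commute algebra_simps)
        have "(norm (x + z - x1))\<^sup>2 \<le> (r / 2)\<^sup>2" using z by (intro power_mono) auto
        moreover have "r\<^sup>2 - (norm (x + z - x1))\<^sup>2 \<le> h (x + z)" by (simp add: h_def)
        moreover have "(r / 2)\<^sup>2 = r\<^sup>2 / 4" by (simp add: power_divide)
        ultimately have h1: "3 * r\<^sup>2 / 4 \<le> h (x + z)" by linarith
        have "norm (x - x1) \<le> norm (x + z - x1) + norm z" using norm_triangle_ineq4[of "x + z - x1" z] by simp
        then have z1: "r / 4 < norm z" using z far by simp
        have "norm z \<le> norm (x + z - x1) + norm (x - x1)" using norm_triangle_ineq4[of "x + z - x1" "x - x1"] by simp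
        then have z2: "norm z \<le> 2 * r" using z near r by simp
        have "1 / (2 * r) powr (real DIM('a) + 2 * s) \<le> trunc_kern s \<rho> z"
          using z1 z2 \<rho> r s unfolding trunc_kern_def kern_def by (auto intro!: divide_left_mono powr_mono2 mult_pos_pos)
        then show "(3 * r\<^sup>2 / 4) * (1 / (2 * r) powr (real DIM('a) + 2 * s)) \<le> h (x + z) * trunc_kern s \<rho> z"
          using h1 h0 by (intro mult_mono) auto
      qed
      finally have c0_le: "c0 \<le> (\<integral>z. h (x + z) * trunc_kern s \<rho> z \<partial>lborel)" .
      have "h x * L \<le> (c0 / (2 * L)) * L" using small L by (intro mult_right_mono) (auto simp: \<tau>_def)
      then have "h x * L \<le> c0 / 2" using L by simp
      then show ?thesis using ring[OF \<epsilon> False] c0_le \<rho>(3) unfolding trunc_eq by linarith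
    qed (use zero[of x \<epsilon>] in simp)
  qed
qed

section \<open>Constants for the barriers\<close>

lemma powr_dominates:
  fixes t :: real
  assumes "0 < e" "0 < K" "K powr (1 / e) \<le> t" shows "K \<le> t powr e"
proof -
  have "K = (K powr (1 / e)) powr e" using assms by (simp add: powr_powr)
  also have "\<dots> \<le> t powr e" using assms by (intro powr_mono2) auto
  finally show ?thesis .
qed

lemma powr_dominated:
  fixes t :: real
  assumes "0 < e" "0 < K" "0 \<le> t" "t \<le> K powr (1 / e)" shows "t powr e \<le> K"
proof -
  have "t powr e \<le> (K powr (1 / e)) powr e" using assms by (intro powr_mono2) auto
  also have "\<dots> = K" using assms by (simp add: powr_powr)
  finally show ?thesis .
qed

text \<open>With \<open>B = k * A powr q\<close> the second inequality is an equality, and the first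
  becomes \<open>K \<le> A powr (1 - p * q)\<close>, which holds for large \<open>A\<close> because
  \<open>p * q < 1\<close>. The lower bound \<open>M\<close> makes room for the subsolution
  below.\<close>

lemma large_constants:
  fixes L c p q :: real
  assumes "0 < L" "0 < c" "0 < p" "0 < q" "p * q < 1"
  obtains A B where "M \<le> A" "M \<le> B" "0 < A" "0 < B" "c * B powr p \<le> L * A" "c * A powr q \<le> L * B"
proof -
  define k where "k = c / L"
  have k: "0 < k" using assms by (simp add: k_def)
  define K where "K = k * k powr p"
  have K: "0 < K" using k by (simp add: K_def)
  define M' where "M' = max 1 M"
  define t where "t = max M' (max ((M' / k) powr (1 / q)) (K powr (1 / (1 - p * q))))"
  have t: "M' \<le> t" "(M' / k) powr (1 / q) \<le> t" "K powr (1 / (1 - p * q)) \<le> t" by (auto simp: t_def)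
  have t0: "0 < t" using t(1) by (simp add: M'_def)
  define B where "B = k * t powr q"
  have "M' / k \<le> t powr q" using assms k t(2) by (intro powr_dominates) (auto simp: M'_def)
  then have B: "M' \<le> B" using k by (simp add: B_def field_simps)
  have "K \<le> t powr (1 - p * q)" using assms K t(3) by (intro powr_dominates) auto
  then have "K * t powr (p * q) \<le> t powr (1 - p * q) * t powr (p * q)" by (intro mult_right_mono) auto
  also have "\<dots> = t" using t0 by (simp flip: powr_add)
  finally have "k * B powr p \<le> t" using k t0 by (simp add: B_def K_def powr_mult powr_powr mult_ac)
  then have "c * B powr p \<le> L * t" using assms by (simp add: k_def field_simps)
  moreover have "c * t powr q \<le> L * B" using assms by (simp add: B_def k_def)
  ultimately show thesis using that[of t B] t B t0 by (auto simp: M'_def)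
qed

text \<open>The same elimination in the opposite direction: \<open>b\<close> is chosen for equality
  in the second inequality, and the first becomes \<open>a powr (1 - p * q) \<le> K\<close>,
  solvable with a positive \<open>a\<close>.\<close>

lemma small_constants:
  fixes C c p q \<tau> :: real
  assumes "0 < C" "0 < c" "0 < p" "0 < q" "p * q < 1" "0 < \<tau>"
  obtains a b where "0 < a" "0 < b" "a * C \<le> c * (b * \<tau>) powr p" "b * C \<le> c * (a * \<tau>) powr q"
proof -
  define k where "k = c / C"
  have k: "0 < k" using assms by (simp add: k_def)
  define K where "K = k * (k * \<tau> powr q * \<tau>) powr p"
  have K: "0 < K" using k assms by (simp add: K_def)
  define t where "t = K powr (1 / (1 - p * q))"
  have t0: "0 < t" using K by (simp add: t_def)
  define b where "b = k * (t * \<tau>) powr q"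
  have b: "0 < b" using k t0 assms by (simp add: b_def)
  have "t powr (1 - p * q) \<le> K" using assms K t0 by (intro powr_dominated) (auto simp: t_def)
  then have "t powr (1 - p * q) * t powr (p * q) \<le> K * t powr (p * q)" by (intro mult_right_mono) auto
  moreover have "t powr (1 - p * q) * t powr (p * q) = t" using t0 by (simp flip: powr_add)
  moreover have "K * t powr (p * q) = k * (b * \<tau>) powr p"
    using k t0 assms by (simp add: K_def b_def powr_mult powr_powr mult_ac)
  ultimately have "t \<le> k * (b * \<tau>) powr p" by simp
  then have "t * C \<le> c * (b * \<tau>) powr p" using assms by (simp add: k_def field_simps)
  moreover have "b * C \<le> c * (t * \<tau>) powr q" using assms by (simp add: b_def k_def)
  ultimately show thesis using that[of t b] t0 b by blast
qed

end

section \<open>Relaxed limits\<close>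

lemma nonneg_squeeze_zero:
  fixes f g :: "nat \<Rightarrow> real"
  assumes "\<And>k. 0 \<le> f k" "\<And>k. f k \<le> g k" "g \<longlonglongrightarrow> 0"
  shows "f \<longlonglongrightarrow> 0"
  using assms(1,2) by (intro Lim_null_comparison[OF _ assms(3)] always_eventually) simp

text \<open>The upper half-relaxed limit, that is, the limit superior of \<open>U n y\<close> as
  \<open>n\<close> tends to infinity and \<open>y\<close> tends to \<open>x\<close> jointly. One
  parameter \<open>m\<close> controls both the index and the radius. The lower limit is obtained by
  negating twice.\<close>

definition relaxed_limsup :: "(nat \<Rightarrow> 'a::metric_space \<Rightarrow> real) \<Rightarrow> 'a \<Rightarrow> real" where
  "relaxed_limsup U x = Inf {a. \<exists>m. \<forall>n\<ge>m. \<forall>y\<in>ball x (1 / real (Suc m)). U n y \<le> a}"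

context
  fixes U :: "nat \<Rightarrow> 'a::metric_space \<Rightarrow> real" and M :: real
  assumes bound: "\<And>n x. \<bar>U n x\<bar> \<le> M"
begin

lemma relaxed_limsup_bdd: "bdd_below {a. \<exists>m. \<forall>n\<ge>m. \<forall>y\<in>ball x (1 / real (Suc m)). U n y \<le> a}"
proof (rule bdd_belowI[of _ "- M"], safe)
  fix a m assume "\<forall>n\<ge>m. \<forall>y\<in>ball x (1 / real (Suc m)). U n y \<le> a"
  moreover have "x \<in> ball x (1 / real (Suc m))" by simp
  ultimately have "U m x \<le> a" by blast
  then show "- M \<le> a" using bound[of m x] by linarith
qed

lemma relaxed_limsup_le:
  assumes "\<And>n y. m \<le> n \<Longrightarrow> dist x y < 1 / real (Suc m) \<Longrightarrow> U n y \<le> a"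
  shows "relaxed_limsup U x \<le> a"
  unfolding relaxed_limsup_def
  by (intro cInf_lower relaxed_limsup_bdd CollectI exI[of _ m]) (use assms in \<open>auto simp del: of_nat_Suc\<close>)

text \<open>Raising the index shrinks the coupled ball below any radius \<open>d\<close>, so index
  and radius can be chosen independently.\<close>

lemma relaxed_limsup_le':
  assumes "0 < d" "\<And>n y. m \<le> n \<Longrightarrow> dist x y < d \<Longrightarrow> U n y \<le> a"
  shows "relaxed_limsup U x \<le> a"
proof -
  obtain m' where m': "1 / real (Suc m') < d" using assms(1) nat_approx_posE by blast
  show ?thesis
  proof (rule relaxed_limsup_le[of "max m m'"])
    fix n y assume n: "max m m' \<le> n" "dist x y < 1 / real (Suc (max m m'))"
    have "1 / real (Suc (max m m')) \<le> 1 / real (Suc m')" by (simp add: frac_le)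
    then show "U n y \<le> a" using n m' by (intro assms(2)) auto
  qed
qed

lemma relaxed_limsup_less:
  assumes "relaxed_limsup U x < a"
  obtains m where "\<And>n y. m \<le> n \<Longrightarrow> dist x y < 1 / real (Suc m) \<Longrightarrow> U n y < a"
proof -
  have "{a. \<exists>m. \<forall>n\<ge>m. \<forall>y\<in>ball x (1 / real (Suc m)). U n y \<le> a} \<noteq> {}"
  proof -
    have "U n y \<le> M" for n y using bound[of n y] by simp
    then have "M \<in> {a. \<exists>m. \<forall>n\<ge>m. \<forall>y\<in>ball x (1 / real (Suc m)). U n y \<le> a}" by auto
    then show ?thesis by blast
  qed
  then obtain a' m where "a' < a" "\<forall>n\<ge>m. \<forall>y\<in>ball x (1 / real (Suc m)). U n y \<le> a'"
    using cInf_lessD[OF _ assms[unfolded relaxed_limsup_def]] by auto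
  then have "U n y < a" if "m \<le> n" "dist x y < 1 / real (Suc m)" for n y
    using that by (metis le_less_trans mem_ball)
  then show thesis by (rule that)
qed

lemma relaxed_limsup_greater:
  assumes "a < relaxed_limsup U x" "0 < d"
  obtains n y where "m \<le> n" "dist x y < d" "a < U n y"
  using relaxed_limsup_le'[of d m x a] assms by (meson leD not_le)

lemma relaxed_limsup_abs_le: "\<bar>relaxed_limsup U x\<bar> \<le> M"
proof -
  have "relaxed_limsup U x \<le> M" by (rule relaxed_limsup_le'[of 1]) (use bound in \<open>auto simp: abs_le_iff\<close>)
  moreover have "- M \<le> relaxed_limsup U x"
  proof (rule ccontr)
    assume "\<not> ?thesis"
    then obtain m where "\<And>n y. m \<le> n \<Longrightarrow> dist x y < 1 / real (Suc m) \<Longrightarrow> U n y < - M"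
      using relaxed_limsup_less[of x "- M"] by (auto simp: not_le)
    from this[of m x] show False using bound[of m x] by simp
  qed
  ultimately show ?thesis by simp
qed

text \<open>A bound for large \<open>n\<close> on a ball of radius \<open>e\<close> about
  \<open>x\<close> holds on balls of radius \<open>e / 2\<close> about all points within
  \<open>e / 2\<close> of \<open>x\<close>.\<close>

lemma relaxed_limsup_usc: "usc (relaxed_limsup U)"
  unfolding usc_def
proof
  fix a
  show "open {x. relaxed_limsup U x < a}"
    unfolding open_dist
  proof (intro ballI)
    fix x assume "x \<in> {x. relaxed_limsup U x < a}"
    then obtain a' where a': "relaxed_limsup U x < a'" "a' < a" using dense by auto
    obtain m where m: "\<And>n y. m \<le> n \<Longrightarrow> dist x y < 1 / real (Suc m) \<Longrightarrow> U n y < a'"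
      using relaxed_limsup_less[OF a'(1)] by metis
    define e where "e = 1 / real (Suc m)"
    have e: "0 < e" by (simp add: e_def)
    have "relaxed_limsup U y \<le> a'" if y: "dist y x < e / 2" for y
    proof (rule relaxed_limsup_le'[of "e / 2"])
      fix n z assume nz: "m \<le> n" "dist y z < e / 2"
      have "dist x z < e" using dist_triangle[of x z y] y nz(2) by (simp add: dist_commute)
      then show "U n z \<le> a'" using m[OF nz(1)] by (simp add: less_imp_le e_def)
    qed (use e in simp)
    then show "\<exists>e>0. \<forall>y. dist y x < e \<longrightarrow> y \<in> {x. relaxed_limsup U x < a}"
      using a'(2) e by (intro exI[of _ "e / 2"]) fastforce
  qed
qed

lemma relaxed_limsup_eventually_less:
  assumes "relaxed_limsup U x < a" "r \<longlonglongrightarrow> x" "\<And>k. k \<le> N k"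
  shows "eventually (\<lambda>k::nat. U (N k) (r k) < a) sequentially"
proof -
  obtain m where m: "\<And>n y. m \<le> n \<Longrightarrow> dist x y < 1 / real (Suc m) \<Longrightarrow> U n y < a"
    using relaxed_limsup_less[OF assms(1)] by metis
  have "eventually (\<lambda>k. dist (r k) x < 1 / real (Suc m)) sequentially"
    using assms(2) by (intro tendstoD) auto
  then show ?thesis using eventually_ge_at_top[of m]
    by eventually_elim (use m assms(3) order_trans in \<open>metis dist_commute\<close>)
qed

end

section \<open>Stability of subsolutions under relaxed limits\<close>

context
  fixes s :: real and U :: "nat \<Rightarrow> 'a::euclidean_space \<Rightarrow> real" and M :: real
  assumes s: "0 < s" "s < 1" and bound: "\<And>n x. \<bar>U n x\<bar> \<le> M"
begin

text \<open>The \<open>U n\<close> need not attain maxima, so points within \<open>\<eta> n\<close>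
  of the supremum are used. The strict term \<open>\<tau> * (dist x y)\<^sup>2\<close> keeps
  \<open>relaxed_limsup U - \<phi>\<close> below its value at \<open>x\<close> on an annulus;
  compactness passes this to all \<open>U n\<close> with large \<open>n\<close>, which confines the
  near-maximizers to a small ball about \<open>x\<close>.\<close>

lemma near_maximizers:
  assumes \<rho>: "0 < \<rho>" and \<tau>: "0 < \<tau>" and \<eta>: "\<eta> \<longlonglongrightarrow> 0" "\<And>n. 0 < \<eta> n"
    and cont: "continuous_on UNIV \<phi>" and \<phi>0: "\<phi> x = 0"
    and touch: "\<And>y. y \<in> cball x \<rho> \<Longrightarrow> relaxed_limsup U y \<le> relaxed_limsup U x + \<phi> y - \<tau> * (dist x y)\<^sup>2"
    and d: "0 < d"
  obtains n w where "m \<le> n" "dist x w < d" "\<bar>U n w - relaxed_limsup U x\<bar> < d"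
    "\<And>y. y \<in> cball x \<rho> \<Longrightarrow> U n y - \<phi> y \<le> U n w - \<phi> w + \<eta> n"
proof -
  define u where "u = relaxed_limsup U"
  have cont_at: "\<exists>d>0. \<forall>y. dist y z < d \<longrightarrow> \<bar>\<phi> y - \<phi> z\<bar> < e" if "0 < e" for e z
    using cont that unfolding continuous_on_iff by (auto simp: dist_real_def)
  have "0 < d / 4" using d by simp
  from cont_at[OF this, of x] obtain d0 where d0: "0 < d0" "\<And>y. dist y x < d0 \<Longrightarrow> \<bar>\<phi> y\<bar> < d / 4"
    unfolding \<phi>0 diff_0_right by blast
  have "relaxed_limsup U x < u x + d / 2" using d by (simp add: u_def)
  from relaxed_limsup_less[OF bound this]
  obtain m1 where m1: "\<And>n y. m1 \<le> n \<Longrightarrow> dist x y < 1 / real (Suc m1) \<Longrightarrow> U n y < u x + d / 2"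
    by blast
  define d' where "d' = min (min d d0) (min (1 / real (Suc m1)) \<rho>)"
  have d': "0 < d'" "d' \<le> d" "d' \<le> d0" "d' \<le> 1 / real (Suc m1)" "d' \<le> \<rho>"
    using d d0 \<rho> by (auto simp: d'_def)
  define K where "K = cball x \<rho> - ball x d'"
  define g where "g = \<tau> * d'\<^sup>2"
  have g: "0 < g" using \<tau> d' by (simp add: g_def)
  have "\<exists>e>0. \<exists>m. \<forall>n\<ge>m. \<forall>y'\<in>ball y e. U n y' - \<phi> y' < u x - g / 2" if y: "y \<in> K" for y
  proof -
    have "d' \<le> dist x y" using y by (simp add: K_def)
    then have "g \<le> \<tau> * (dist x y)\<^sup>2" unfolding g_def using \<tau> d' by (intro mult_left_mono power_mono) auto
    moreover have "u y \<le> u x + \<phi> y - \<tau> * (dist x y)\<^sup>2" using touch[of y] y by (simp add: K_def u_def)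
    ultimately have "relaxed_limsup U y < u x + \<phi> y - g * 3 / 4" using g by (simp add: u_def)
    from relaxed_limsup_less[OF bound this]
    obtain k where k: "\<And>n y'. k \<le> n \<Longrightarrow> dist y y' < 1 / real (Suc k) \<Longrightarrow> U n y' < u x + \<phi> y - g * 3 / 4"
      by blast
    have "0 < g / 4" using g by simp
    from cont_at[OF this, of y] obtain e0 where e0: "0 < e0" "\<And>y'. dist y' y < e0 \<Longrightarrow> \<bar>\<phi> y' - \<phi> y\<bar> < g / 4"
      by blast
    have "U n y' - \<phi> y' < u x - g / 2" if "k \<le> n" "y' \<in> ball y (min e0 (1 / real (Suc k)))" for n y'
    proof -
      have "U n y' < u x + \<phi> y - g * 3 / 4" "\<bar>\<phi> y' - \<phi> y\<bar> < g / 4"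
        using k[OF that(1), of y'] e0(2)[of y'] that(2) by (auto simp: dist_commute)
      then show ?thesis unfolding abs_less_iff by linarith
    qed
    then show ?thesis using e0(1) by (intro exI[of _ "min e0 (1 / real (Suc k))"] conjI exI[of _ k]) auto
  qed
  then obtain e k where ek: "\<And>y. y \<in> K \<Longrightarrow> 0 < e y"
    "\<And>y n y'. y \<in> K \<Longrightarrow> k y \<le> n \<Longrightarrow> y' \<in> ball y (e y) \<Longrightarrow> U n y' - \<phi> y' < u x - g / 2" by metis
  have "compact K" unfolding K_def by (intro compact_diff) auto
  moreover have "K \<subseteq> (\<Union>y\<in>K. ball y (e y))" using ek(1) by force
  ultimately obtain D where D: "D \<subseteq> K" "finite D" "K \<subseteq> (\<Union>y\<in>D. ball y (e y))"
    using compactE_image[of K K "\<lambda>y. ball y (e y)"] by blast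
  define m2 where "m2 = Max (insert 0 (k ` D))"
  have m2: "U n y - \<phi> y < u x - g / 2" if "m2 \<le> n" "y \<in> K" for n y
  proof -
    obtain y0 where y0: "y0 \<in> D" "y \<in> ball y0 (e y0)" using D(3) \<open>y \<in> K\<close> by auto
    have "k y0 \<le> m2" unfolding m2_def using D(2) y0(1) by (intro Max_ge) auto
    then show ?thesis using ek(2)[of y0 n y] y0 D(1) that(1) by auto
  qed
  \<comment> \<open>Three losses of \<open>\<sigma>\<close> occur, from the value at
    \<open>y0\<close>, from \<open>\<phi> y0\<close> and from \<open>\<eta> n\<close>; together they
    must stay below the gap \<open>g / 2\<close> on the annulus.\<close>
  define \<sigma> where "\<sigma> = min (g / 8) (d / 8)"
  have \<sigma>: "0 < \<sigma>" "4 * \<sigma> \<le> g / 2" "4 * \<sigma> \<le> d / 2" using g d by (auto simp: \<sigma>_def)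
  from cont_at[OF \<sigma>(1), of x] obtain d2 where d2: "0 < d2" "\<And>y. dist y x < d2 \<Longrightarrow> \<bar>\<phi> y\<bar> < \<sigma>"
    unfolding \<phi>0 diff_0_right by blast
  have "eventually (\<lambda>n. \<eta> n < \<sigma>) sequentially" using \<eta>(1) \<sigma>(1) by (rule order_tendstoD)
  then obtain m3 where m3: "\<And>n. m3 \<le> n \<Longrightarrow> \<eta> n < \<sigma>" unfolding eventually_sequentially by auto
  have "u x - \<sigma> < relaxed_limsup U x" "0 < min d2 \<rho>" using \<sigma> d2 \<rho> by (auto simp: u_def)
  from relaxed_limsup_greater[OF bound this, of "max (max m m1) (max m2 m3)"]
  obtain n y0 where n: "max (max m m1) (max m2 m3) \<le> n" "dist x y0 < min d2 \<rho>" "u x - \<sigma> < U n y0"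
    by blast
  define S where "S = (SUP y\<in>cball x \<rho>. U n y - \<phi> y)"
  have "bounded (\<phi> ` cball x \<rho>)"
    using continuous_on_subset[OF cont] by (intro compact_imp_bounded compact_continuous_image) auto
  then obtain B where "\<forall>t\<in>\<phi> ` cball x \<rho>. norm t \<le> B" unfolding bounded_iff by blast
  then have B: "\<bar>\<phi> y\<bar> \<le> B" if "y \<in> cball x \<rho>" for y using that by simp
  have "U n y - \<phi> y \<le> M + B" if "y \<in> cball x \<rho>" for y using B[OF that] bound[of n y] by linarith
  then have bdd: "bdd_above ((\<lambda>y. U n y - \<phi> y) ` cball x \<rho>)" by (intro bdd_aboveI[of _ "M + B"]) auto
  have "S - \<eta> n < (SUP y\<in>cball x \<rho>. U n y - \<phi> y)" using \<eta>(2)[of n] by (simp add: S_def)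
  then obtain w where w: "w \<in> cball x \<rho>" "S - \<eta> n < U n w - \<phi> w"
    using less_cSUP_iff[OF _ bdd] \<rho> by fastforce
  have Sge: "U n y - \<phi> y \<le> S" if "y \<in> cball x \<rho>" for y
    unfolding S_def using that bdd by (intro cSUP_upper)
  have "\<bar>\<phi> y0\<bar> < \<sigma>" using d2(2)[of y0] n(2) by (simp add: dist_commute)
  then have low: "u x - 3 * \<sigma> < U n w - \<phi> w" using Sge[of y0] n(2,3) w(2) m3[of n] n(1) by (auto simp: abs_less_iff)
  have "w \<in> ball x d'"
  proof (rule ccontr)
    assume "w \<notin> ball x d'"
    then have "w \<in> K" using w(1) by (simp add: K_def)
    then show False using m2[of n w] n(1) low \<sigma> by simp
  qed
  then have dw: "dist x w < d'" by simp
  have "\<bar>\<phi> w\<bar> < d / 4" using d0(2)[of w] dw d' by (simp add: dist_commute)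
  moreover have "U n w < u x + d / 2" using m1[of n w] n(1) dw d' by simp
  ultimately have "\<bar>U n w - u x\<bar> < d" using low \<sigma> d unfolding abs_less_iff by linarith
  moreover have "U n y - \<phi> y \<le> U n w - \<phi> w + \<eta> n" if "y \<in> cball x \<rho>" for y
    using Sge[OF that] w(2) by linarith
  ultimately show thesis using n(1) dw d' by (intro that[of n w]) (auto simp: u_def)
qed

text \<open>At near-maximizers the inequality holds with cut-off \<open>\<epsilon> n\<close>; the
  ring estimate raises the cut-off to the fixed \<open>\<delta>\<close>, where the kernel is
  integrable and limits can be taken. The inequality is required only at points whose values
  \<open>U n y\<close> are also close to the limit value, which admits points \<open>x\<close>
  outside the domain.\<close>

lemma relaxed_limsup_sub_at:
  assumes bounded_borel: "\<And>n. bounded_borel (U n)" and \<epsilon>: "\<epsilon> \<longlonglongrightarrow> 0" "\<And>n. 0 < \<epsilon> n"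
    and eq: "\<And>\<theta>. 0 < \<theta> \<Longrightarrow> \<exists>d>0. \<exists>m. \<forall>n\<ge>m. \<forall>y. dist x y < d \<longrightarrow> \<bar>U n y - relaxed_limsup U x\<bar> < d
      \<longrightarrow> trunc_lap s (\<epsilon> n) (U n) y \<le> F + \<theta>"
  shows "sub_at s (relaxed_limsup U) F x"
  unfolding sub_at_def
proof (intro allI impI, elim conjE)
  fix \<rho> b N \<delta>
  assume \<rho>: "0 < \<rho>" and N: "0 \<le> N" and \<delta>: "0 < \<delta>" "\<delta> < \<rho>"
    and touch: "\<forall>z. norm z < \<rho> \<longrightarrow> relaxed_limsup U (x + z) \<le> relaxed_limsup U x + b \<bullet> z + N * (norm z)\<^sup>2"
  define u where "u = relaxed_limsup U"
  have ubm: "bounded_borel u"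
    unfolding u_def
    by (rule bounded_borelI[OF usc_measurable[OF relaxed_limsup_usc[OF bound]] relaxed_limsup_abs_le[OF bound]])
  \<comment> \<open>Strictly between \<open>\<delta>\<close> and \<open>\<rho>\<close>, so that the
    ball of radius \<open>\<delta>\<close> about a point near \<open>x\<close> stays in the region
    of touching.\<close>
  define \<rho>' where "\<rho>' = (\<delta> + \<rho>) / 2"
  have \<rho>': "0 < \<rho>'" "\<delta> < \<rho>'" "\<rho>' < \<rho>" using \<delta> by (auto simp: \<rho>'_def)
  \<comment> \<open>The slack is paid for with the tail at \<open>\<epsilon> n\<close>, which may
    blow up; this choice keeps \<open>\<eta> n\<close> times that tail below
    \<open>1 / real (Suc n)\<close>.\<close>
  define \<eta> where "\<eta> = (\<lambda>n. 1 / real (Suc n) / (1 + kern_tail TYPE('a) s (\<epsilon> n)))"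
  have \<eta>pos: "0 < \<eta> n" for n
    using kern_tail_nonneg[OF s, where 'a='a and \<delta>="\<epsilon> n"] unfolding \<eta>_def by (intro divide_pos_pos) auto
  have \<eta>le: "\<eta> n \<le> 1 / real (Suc n)" for n
  proof -
    have "1 / real (Suc n) / (1 + kern_tail TYPE('a) s (\<epsilon> n)) \<le> 1 / real (Suc n) / 1"
      using kern_tail_nonneg[OF s, where 'a='a and \<delta>="\<epsilon> n"] by (intro divide_left_mono) auto
    then show ?thesis by (simp add: \<eta>_def)
  qed
  have \<eta>kern_tail: "\<eta> n * kern_tail TYPE('a) s (\<epsilon> n) \<le> 1 / real (Suc n)" for n
  proof -
    have "\<eta> n * kern_tail TYPE('a) s (\<epsilon> n) = (1 / real (Suc n)) * (kern_tail TYPE('a) s (\<epsilon> n) / (1 + kern_tail TYPE('a) s (\<epsilon> n)))"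
      by (simp add: \<eta>_def)
    also have "\<dots> \<le> (1 / real (Suc n)) * 1"
      using kern_tail_nonneg[OF s, where 'a='a and \<delta>="\<epsilon> n"] by (intro mult_left_mono) (auto simp: divide_le_eq)
    finally show ?thesis by simp
  qed
  have lim0: "(\<lambda>n. 1 / real (Suc n)) \<longlonglongrightarrow> 0" by (rule LIMSEQ_Suc[OF lim_1_over_n])
  have \<eta>lim: "\<eta> \<longlonglongrightarrow> 0"
    by (rule nonneg_squeeze_zero[OF less_imp_le[OF \<eta>pos] \<eta>le lim0])
  \<comment> \<open>The extra \<open>\<tau>\<close> in the opening makes the touching strict; it is
    removed at the end by letting \<open>\<tau>\<close> tend to 0.\<close>
  have main: "trunc_lap s \<delta> u x \<le> F + \<tau> + (N + \<tau>) * kern_moment TYPE('a) s \<delta>" if \<tau>: "0 < \<tau>" for \<tau>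
  proof -
    define \<phi> where "\<phi> = (\<lambda>y. b \<bullet> (y - x) + (N + \<tau>) * (norm (y - x))\<^sup>2)"
    have cont: "continuous_on UNIV \<phi>" unfolding \<phi>_def by (intro continuous_intros)
    have touch': "relaxed_limsup U y \<le> relaxed_limsup U x + \<phi> y - \<tau> * (dist x y)\<^sup>2" if "y \<in> cball x \<rho>'" for y
    proof -
      have "norm (y - x) < \<rho>" using that \<rho>' by (simp add: dist_norm norm_minus_commute)
      then have "relaxed_limsup U (x + (y - x)) \<le> relaxed_limsup U x + b \<bullet> (y - x) + N * (norm (y - x))\<^sup>2"
        using touch by blast
      then show ?thesis by (simp add: \<phi>_def dist_norm norm_minus_commute algebra_simps)
    qed
    obtain d0 m0 where d0: "0 < d0" "\<And>n y. m0 \<le> n \<Longrightarrow> dist x y < d0 \<Longrightarrow> \<bar>U n y - u x\<bar> < d0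
      \<Longrightarrow> trunc_lap s (\<epsilon> n) (U n) y \<le> F + \<tau>"
      using eq[OF \<tau>] unfolding u_def by metis
    have "eventually (\<lambda>n. \<epsilon> n < \<delta>) sequentially" using \<epsilon>(1) \<delta>(1) by (rule order_tendstoD)
    then obtain m1 where m1: "\<And>n. m1 \<le> n \<Longrightarrow> \<epsilon> n < \<delta>" unfolding eventually_sequentially by auto
    define dd where "dd = (\<lambda>k::nat. min (min d0 (\<rho>' - \<delta>)) (1 / real (Suc k)))"
    have dd: "0 < dd k" "dd k \<le> d0" "dd k \<le> \<rho>' - \<delta>" "dd k \<le> 1 / real (Suc k)" for k
      using d0 \<rho>' by (auto simp: dd_def)
    have "\<exists>n w. max k (max m0 m1) \<le> n \<and> dist x w < dd k \<and> \<bar>U n w - u x\<bar> < dd k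
       \<and> (\<forall>y\<in>cball x \<rho>'. U n y - \<phi> y \<le> U n w - \<phi> w + \<eta> n)" for k
    proof -
      have \<phi>x: "\<phi> x = 0" by (simp add: \<phi>_def)
      show ?thesis
        using near_maximizers[OF \<rho>'(1) \<tau> \<eta>lim \<eta>pos cont \<phi>x touch' dd(1)[of k], of "max k (max m0 m1)"]
        unfolding u_def by metis
    qed
    then obtain n w where nw: "\<And>k. max k (max m0 m1) \<le> n k" "\<And>k. dist x (w k) < dd k" "\<And>k. \<bar>U (n k) (w k) - u x\<bar> < dd k"
       "\<And>k y. y \<in> cball x \<rho>' \<Longrightarrow> U (n k) y - \<phi> y \<le> U (n k) (w k) - \<phi> (w k) + \<eta> (n k)" by metis
    have upper: "trunc_lap s \<delta> (U (n k)) (w k) \<le> F + \<tau> + (N + \<tau>) * kern_moment TYPE('a) s \<delta> + 1 / real (Suc k)" for k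
    proof -
      have k: "k \<le> n k" "m0 \<le> n k" "m1 \<le> n k" using nw(1)[of k] by auto
      have "trunc_lap s \<delta> (U (n k)) (w k) - (N + \<tau>) * kern_moment TYPE('a) s \<delta> - \<eta> (n k) * kern_tail TYPE('a) s (\<epsilon> (n k))
          \<le> trunc_lap s (\<epsilon> (n k)) (U (n k)) (w k)"
      proof (rule trunc_lap_ring_ge[OF s bounded_borel])
        show "0 < \<epsilon> (n k)" "\<epsilon> (n k) \<le> \<delta>" using \<epsilon>(2) m1[OF k(3)] by (auto intro: less_imp_le)
        fix z :: 'a assume z: "norm z < \<delta>"
        have "dist x (w k + z) \<le> dist x (w k) + norm z"
          using dist_triangle[of x "w k + z" "w k"] by (simp add: dist_norm)
        then have "w k + z \<in> cball x \<rho>'" using z nw(2)[of k] dd(3)[of k] by simp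
        from nw(4)[OF this, of k]
        have "U (n k) (w k + z) \<le> U (n k) (w k) + (\<phi> (w k + z) - \<phi> (w k)) + \<eta> (n k)" by simp
        also have "\<phi> (w k + z) - \<phi> (w k) = (b + (2 * (N + \<tau>)) *\<^sub>R (w k - x)) \<bullet> z + (N + \<tau>) * (norm z)\<^sup>2"
        proof -
          have e: "w k + z - x = (w k - x) + z" by simp
          show ?thesis unfolding \<phi>_def e norm_diff_square by (simp add: algebra_simps)
        qed
        finally show "U (n k) (w k + z) \<le> U (n k) (w k) + (b + (2 * (N + \<tau>)) *\<^sub>R (w k - x)) \<bullet> z + (N + \<tau>) * (norm z)\<^sup>2 + \<eta> (n k)"
          by simp
      qed (use N \<tau> \<eta>pos in \<open>auto intro: less_imp_le\<close>)
      moreover have "trunc_lap s (\<epsilon> (n k)) (U (n k)) (w k) \<le> F + \<tau>"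
        using d0(2)[OF k(2), of "w k"] nw(2,3)[of k] dd(2)[of k] by simp
      moreover have "1 / real (Suc (n k)) \<le> 1 / real (Suc k)" using k(1) by (simp add: frac_le)
      ultimately show ?thesis using \<eta>kern_tail[of "n k"] by linarith
    qed
    have ddlim: "dd \<longlonglongrightarrow> 0"
      by (rule nonneg_squeeze_zero[OF less_imp_le[OF dd(1)] dd(4) lim0])
    have "dist (w k) x \<le> dd k" for k using nw(2)[of k] by (simp only: dist_commute less_imp_le)
    then have "(\<lambda>k. dist (w k) x) \<longlonglongrightarrow> 0"
      by (rule nonneg_squeeze_zero[OF zero_le_dist _ ddlim])
    then have wlim: "w \<longlonglongrightarrow> x" by (rule tendsto_dist_iff[THEN iffD2])
    have Ulim: "(\<lambda>k. U (n k) (w k)) \<longlonglongrightarrow> u x"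
    proof -
      have "\<bar>U (n k) (w k) - u x\<bar> \<le> dd k" for k using nw(3)[of k] by (simp only: less_imp_le)
      then have "(\<lambda>k. \<bar>U (n k) (w k) - u x\<bar>) \<longlonglongrightarrow> 0"
        by (rule nonneg_squeeze_zero[OF abs_ge_zero _ ddlim])
      then show ?thesis unfolding tendsto_rabs_zero_iff by (rule LIM_zero_cancel)
    qed
    \<comment> \<open>Only an upper bound for the limit superior of \<open>U (n k) (w k + z)\<close>
      is known. The maximum with \<open>u (x + z)\<close> genuinely converges, and dominated
      convergence then acts as a reverse Fatou lemma.\<close>
    define G where "G = (\<lambda>k z. max (U (n k) (w k + z)) (u (x + z)))"
    have [measurable]: "u \<in> borel_measurable borel" "\<And>n. U n \<in> borel_measurable borel"
      using ubm bounded_borel by (auto simp: bounded_borel_def)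
    have Gbound: "\<bar>G k z\<bar> \<le> M" for k z
      using bound[of "n k" "w k + z"] relaxed_limsup_abs_le[OF bound, where x = "x + z"] by (auto simp: G_def u_def abs_le_iff)
    have Glim: "(\<lambda>k. G k z) \<longlonglongrightarrow> u (x + z)" for z
    proof (rule order_tendstoI)
      fix a assume "a < u (x + z)"
      then show "eventually (\<lambda>k. a < G k z) sequentially" by (simp add: G_def less_max_iff_disj)
    next
      fix a assume a: "u (x + z) < a"
      have "eventually (\<lambda>k. U (n k) (w k + z) < a) sequentially"
      proof (rule relaxed_limsup_eventually_less[OF bound])
        show "relaxed_limsup U (x + z) < a" using a by (simp add: u_def)
        show "(\<lambda>k. w k + z) \<longlonglongrightarrow> x + z" by (intro tendsto_intros wlim)
        show "k \<le> n k" for k using nw(1)[of k] by simp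
      qed
      then show "eventually (\<lambda>k. G k z < a) sequentially" by eventually_elim (use a in \<open>simp add: G_def\<close>)
    qed
    have intG: "integrable lborel (\<lambda>z. G k z * trunc_kern s \<delta> z)" for k
    proof (rule Bochner_Integration.integrable_bound)
      show "integrable lborel (\<lambda>z::'a. M * trunc_kern s \<delta> z)" using s \<delta> by auto
      show "(\<lambda>z. G k z * trunc_kern s \<delta> z) \<in> borel_measurable lborel" unfolding G_def by measurable
      show "AE z in lborel. norm (G k z * trunc_kern s \<delta> z) \<le> norm (M * trunc_kern s \<delta> z)"
        using Gbound by (intro AE_I2) (auto simp: abs_mult intro!: mult_right_mono order_trans[OF Gbound abs_ge_self])
    qed
    have "(\<lambda>k. \<integral>z. G k z * trunc_kern s \<delta> z \<partial>lborel) \<longlonglongrightarrow> (\<integral>z. u (x + z) * trunc_kern s \<delta> z \<partial>lborel)"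
    proof (rule integral_dominated_convergence)
      show "integrable lborel (\<lambda>z::'a. M * trunc_kern s \<delta> z)" using s \<delta> by auto
      show "(\<lambda>z. u (x + z) * trunc_kern s \<delta> z) \<in> borel_measurable lborel"
        "(\<lambda>z. G k z * trunc_kern s \<delta> z) \<in> borel_measurable lborel" for k unfolding G_def by measurable
      show "AE z in lborel. (\<lambda>k. G k z * trunc_kern s \<delta> z) \<longlonglongrightarrow> u (x + z) * trunc_kern s \<delta> z"
        by (intro AE_I2 tendsto_intros Glim)
      show "AE z in lborel. norm (G k z * trunc_kern s \<delta> z) \<le> M * trunc_kern s \<delta> z" for k
        using Gbound by (intro AE_I2) (auto simp: abs_mult intro!: mult_right_mono)
    qed
    then have "(\<lambda>k. U (n k) (w k) * kern_tail TYPE('a) s \<delta> - (\<integral>z. G k z * trunc_kern s \<delta> z \<partial>lborel))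
        \<longlonglongrightarrow> u x * kern_tail TYPE('a) s \<delta> - (\<integral>z. u (x + z) * trunc_kern s \<delta> z \<partial>lborel)"
      by (intro tendsto_intros Ulim)
    then have lhs: "(\<lambda>k. U (n k) (w k) * kern_tail TYPE('a) s \<delta> - (\<integral>z. G k z * trunc_kern s \<delta> z \<partial>lborel)) \<longlonglongrightarrow> trunc_lap s \<delta> u x"
      using trunc_lap_eq[OF s ubm \<delta>(1), of x] by simp
    have rhs: "(\<lambda>k. F + \<tau> + (N + \<tau>) * kern_moment TYPE('a) s \<delta> + 1 / real (Suc k)) \<longlonglongrightarrow> F + \<tau> + (N + \<tau>) * kern_moment TYPE('a) s \<delta> + 0"
      by (intro tendsto_intros lim0)
    have "U (n k) (w k) * kern_tail TYPE('a) s \<delta> - (\<integral>z. G k z * trunc_kern s \<delta> z \<partial>lborel)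
        \<le> F + \<tau> + (N + \<tau>) * kern_moment TYPE('a) s \<delta> + 1 / real (Suc k)" for k
    proof -
      have "(\<integral>z. U (n k) (w k + z) * trunc_kern s \<delta> z \<partial>lborel) \<le> (\<integral>z. G k z * trunc_kern s \<delta> z \<partial>lborel)"
        by (intro integral_mono integrable_times_trunc_kern(1)[OF s bounded_borel \<delta>(1)] intG mult_right_mono) (auto simp: G_def)
      then show ?thesis using upper[of k] trunc_lap_eq[OF s bounded_borel[of "n k"] \<delta>(1), of "w k"] by linarith
    qed
    then have "trunc_lap s \<delta> u x \<le> F + \<tau> + (N + \<tau>) * kern_moment TYPE('a) s \<delta> + 0"
      by (intro LIMSEQ_le[OF lhs rhs]) auto
    then show ?thesis by simp
  qed
  have "((\<lambda>\<tau>. F + \<tau> + (N + \<tau>) * kern_moment TYPE('a) s \<delta>) \<longlongrightarrow> F + 0 + (N + 0) * kern_moment TYPE('a) s \<delta>) (at_right 0)"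
    by (intro tendsto_intros)
  moreover have "eventually (\<lambda>\<tau>. trunc_lap s \<delta> u x \<le> F + \<tau> + (N + \<tau>) * kern_moment TYPE('a) s \<delta>) (at_right 0)"
    by (rule eventually_at_rightI[where b = 1]) (use main in auto)
  ultimately have "trunc_lap s \<delta> u x \<le> F + 0 + (N + 0) * kern_moment TYPE('a) s \<delta>"
    by (rule tendsto_lowerbound) simp
  then show "trunc_lap s \<delta> (relaxed_limsup U) x \<le> F + N * kern_moment TYPE('a) s \<delta>" by (simp add: u_def)
qed

end

section \<open>Boundary values\<close>

text \<open>An exterior corkscrew condition: at every small scale \<open>r\<close> a ball of
  comparable radius near \<open>x\<close> misses \<open>\<Omega>\<close>. Its proportion is what
  counts, since the kernel gives such a ball a mass of order
  \<open>r powr (- 2 * s)\<close>.\<close>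

definition exterior_ball_at :: "'a::euclidean_space set \<Rightarrow> 'a \<Rightarrow> bool" where
  "exterior_ball_at \<Omega> x \<longleftrightarrow> (\<exists>k>0. \<exists>r0>0. \<forall>r. 0 < r \<and> r < r0 \<longrightarrow> (\<exists>y. ball y (k * r) \<subseteq> ball x r - \<Omega>))"

text \<open>Smoothness enters only through a linear lower bound for \<open>\<gamma>\<close> at
  \<open>x0\<close>, so a cone below \<open>x0\<close> misses \<open>\<Omega>\<close>; the ball is
  centered at depth \<open>t / 2\<close> in it.\<close>

lemma smooth_domain_exterior_ball:
  fixes \<Omega> :: "'a::euclidean_space set"
  assumes "smooth_domain \<Omega>" "x0 \<in> frontier \<Omega>"
  shows "exterior_ball_at \<Omega> x0"
proof -
  obtain r e \<gamma> where r: "0 < r" and e: "norm e = 1" and Ck: "\<And>k. Ck_on k UNIV \<gamma>"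
    and inv: "\<And>x t. \<gamma> (x + t *\<^sub>R e) = \<gamma> x"
    and graph: "\<Omega> \<inter> ball x0 r = {x \<in> ball x0 r. \<gamma> x < x \<bullet> e}"
    using assms unfolding smooth_domain_def by blast
  have "open \<Omega>" using assms(1) by (simp add: smooth_domain_def)
  then have x0: "x0 \<notin> \<Omega>" using assms(2) by (simp add: frontier_def interior_open)
  have "x0 \<in> ball x0 r" using r by simp
  then have \<gamma>0: "x0 \<bullet> e \<le> \<gamma> x0" using x0 graph by (metis (mono_tags, lifting) IntD1 mem_Collect_eq not_less)
  obtain \<rho> b N where T: "0 < \<rho>" "0 \<le> N" "\<And>z. norm z < \<rho> \<Longrightarrow> \<bar>\<gamma> (x0 + z) - \<gamma> x0 - b \<bullet> z\<bar> \<le> N * (norm z)\<^sup>2"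
    using Ck_on_2_taylor[OF Ck[of 2] open_UNIV UNIV_I, of x0] by metis
  define L where "L = norm b + N * \<rho>"
  have L: "0 \<le> L" using T by (simp add: L_def)
  have lip: "\<gamma> x0 - L * norm z \<le> \<gamma> (x0 + z)" if "norm z < \<rho>" for z
  proof -
    have "norm z * norm z \<le> \<rho> * norm z" using that by (intro mult_right_mono) auto
    then have "N * (norm z)\<^sup>2 \<le> N * \<rho> * norm z"
      using T(2) by (simp add: power2_eq_square mult.assoc mult_left_mono)
    moreover have "\<bar>b \<bullet> z\<bar> \<le> norm b * norm z" by (rule Cauchy_Schwarz_ineq2)
    ultimately show ?thesis using T(3)[OF that] by (simp add: L_def algebra_simps)
  qed
  \<comment> \<open>Chosen so that \<open>(L + 1) * k = 1 / 2\<close>: over a displacement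
    \<open>w\<close> the graph drops by at most \<open>L * norm w\<close> and the point rises by at
    most \<open>norm w\<close>, together no more than the depth \<open>t / 2\<close>.\<close>
  define k where "k = 1 / (2 * (L + 1))"
  have k: "0 < k" "k \<le> 1 / 2" using L by (auto simp: k_def field_simps)
  have "\<exists>y. ball y (k * t) \<subseteq> ball x0 t - \<Omega>" if t: "0 < t" "t < min r \<rho>" for t
  proof (intro exI subsetI)
    fix x assume "x \<in> ball (x0 - (t / 2) *\<^sub>R e) (k * t)"
    define w where "w = x - (x0 - (t / 2) *\<^sub>R e)"
    have w: "norm w < k * t" using \<open>x \<in> ball _ _\<close> by (simp add: w_def dist_norm norm_minus_commute)
    have x: "x = (x0 + w) + (- (t / 2)) *\<^sub>R e" by (simp add: w_def)
    have "k * t \<le> (1 / 2) * t" using k t by (intro mult_right_mono) auto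
    then have wt: "norm w < t / 2" using w by simp
    have "norm (x - x0) \<le> norm w + norm ((t / 2) *\<^sub>R e)" unfolding x using norm_triangle_ineq4[of w "(t / 2) *\<^sub>R e"] by simp
    then have near: "norm (x - x0) < t" using wt t e by simp
    have "\<gamma> x = \<gamma> (x0 + w)" unfolding x by (rule inv)
    also have "\<gamma> x0 - L * norm w \<le> \<gamma> (x0 + w)" using wt t by (intro lip) simp
    finally have 1: "\<gamma> x0 - L * norm w \<le> \<gamma> x" by simp
    have "e \<bullet> e = 1" using e by (simp add: dot_square_norm)
    then have "x \<bullet> e = x0 \<bullet> e + w \<bullet> e - t / 2" unfolding x by (simp add: inner_add_left inner_diff_left)
    moreover have "w \<bullet> e \<le> norm w" using norm_cauchy_schwarz[of w e] e by simp
    moreover have "(L + 1) * norm w \<le> (L + 1) * (k * t)" using w L by (intro mult_left_mono) auto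
    moreover have "(L + 1) * (k * t) = t / 2"
    proof -
      have "(L + 1) * k = 1 / 2" using L by (simp add: k_def field_simps)
      then show ?thesis by (simp flip: mult.assoc)
    qed
    ultimately have "x \<bullet> e \<le> \<gamma> x" using 1 \<gamma>0 by (simp add: algebra_simps)
    then have "x \<notin> {x \<in> ball x0 r. \<gamma> x < x \<bullet> e}" by simp
    moreover have "x \<in> ball x0 r" using near t by (simp add: dist_norm norm_minus_commute)
    ultimately have "x \<notin> \<Omega>" using graph by blast
    then show "x \<in> ball x0 t - \<Omega>" using near by (simp add: dist_norm norm_minus_commute)
  qed
  then show ?thesis unfolding exterior_ball_at_def using k r T(1)
    by (intro exI[of _ k] conjI exI[of _ "min r \<rho>"]) auto
qed

text \<open>At a maximum of \<open>w - N (dist x\<^sub>0)\<^sup>2\<close> the operator is at most of order \<open>N\<^sup>s\<close> times a small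
  constant, whereas the exterior ball of radius comparable to \<open>N\<^bsup>-1/2\<^esup>\<close> contributes a fixed
  multiple of \<open>w x\<^sub>0 N\<^sup>s\<close>.\<close>

lemma boundary_value_nonpos:
  fixes w :: "'a::euclidean_space \<Rightarrow> real"
  assumes s: "0 < s" "s < 1" and w: "bounded_borel w" "usc w"
    and sub: "\<And>x. 0 < w x \<Longrightarrow> sub_at s w F x"
    and ext: "exterior_ball_at \<Omega> x0" and out: "\<And>x. x \<notin> closure \<Omega> \<Longrightarrow> w x = 0"
  shows "w x0 \<le> 0"
proof (rule ccontr)
  assume "\<not> w x0 \<le> 0"
  define m where "m = w x0"
  have m: "0 < m" using \<open>\<not> w x0 \<le> 0\<close> by (simp add: m_def)
  obtain A where A: "0 < A" "\<And>x. \<bar>w x\<bar> \<le> A" using w(1) bounded_borelE by metis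
  obtain k r0 where k: "0 < k" "0 < r0" and ball_ex: "\<And>r. 0 < r \<Longrightarrow> r < r0 \<Longrightarrow> \<exists>y. ball y (k * r) \<subseteq> ball x0 r - \<Omega>"
    using ext unfolding exterior_ball_at_def by blast
  obtain K1 where K1: "0 < K1" "\<And>\<delta>. 0 < \<delta> \<Longrightarrow> kern_tail TYPE('a) s \<delta> \<le> K1 * \<delta> powr (- 2 * s)"
    using kern_tail_bound[OF s, where 'a='a] by metis
  obtain K2 where K2: "0 < K2" "\<And>\<delta>. 0 < \<delta> \<Longrightarrow> kern_moment TYPE('a) s \<delta> \<le> K2 * \<delta> powr (2 - 2 * s)"
    using kern_moment_bound[OF s, where 'a='a] by metis
  define \<omega> where "\<omega> = measure lborel (ball (0::'a) 1)"
  have \<omega>: "0 < \<omega>" using content_ball_pos[of 1 "0::'a"] by (simp add: \<omega>_def)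
  define n where "n = real DIM('a)"
  \<comment> \<open>A ball of radius \<open>k * r / 2\<close>, all of whose points have norm at most
    \<open>2 * r\<close>, carries kernel mass at least \<open>c' * r powr (- 2 * s)\<close>.\<close>
  define c' where "c' = (k / 2) powr n * \<omega> * 2 powr (- (n + 2 * s))"
  have c': "0 < c'" using k \<omega> by (simp add: c'_def)
  \<comment> \<open>The cut-off will be \<open>\<delta> = t * r\<close>. The bound
    \<open>k / 4\<close> keeps it clear of the exterior ball, and the other bound limits the moment
    term to a quarter of the gain.\<close>
  define t where "t = min (k / 4) ((m * c' / (4 * K2)) powr (1 / (2 - 2 * s)))"
  have t: "0 < t" "t \<le> k / 4" using k m c' K2 by (auto simp: t_def)
  have "t powr (2 - 2 * s) \<le> m * c' / (4 * K2)"
    using s m c' K2 t(1) by (intro powr_dominated) (auto simp: t_def)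
  then have t2: "K2 * t powr (2 - 2 * s) \<le> m * c' / 4" using K2 by (simp add: field_simps)
  \<comment> \<open>The allowed excess of \<open>w\<close> over \<open>m\<close> near
    \<open>x0\<close>. Its first bound places the maximum within \<open>k / 4 * r\<close> of
    \<open>x0\<close>, its second limits the loss of the near part to a quarter of the gain.\<close>
  define \<sigma> where "\<sigma> = min ((k / 4)\<^sup>2) (m * c' / (4 * (K1 * t powr (- 2 * s))))"
  have \<sigma>: "0 < \<sigma>" "\<sigma> \<le> (k / 4)\<^sup>2" using k m c' K1 t by (auto simp: \<sigma>_def)
  have "\<sigma> \<le> m * c' / (4 * (K1 * t powr (- 2 * s)))" by (simp add: \<sigma>_def)
  then have \<sigma>2: "\<sigma> * (K1 * t powr (- 2 * s)) \<le> m * c' / 4" using K1 t by (simp add: field_simps)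
  have "open {x. w x < m + \<sigma>}" "x0 \<in> {x. w x < m + \<sigma>}" using w(2) \<sigma> by (auto simp: usc_def m_def)
  then obtain \<rho>2 where \<rho>2: "0 < \<rho>2" "ball x0 \<rho>2 \<subseteq> {x. w x < m + \<sigma>}" using open_contains_ball by blast
  define \<rho> where "\<rho> = \<rho>2 / 2"
  have \<rho>: "0 < \<rho>" using \<rho>2 by (simp add: \<rho>_def)
  have near\<rho>: "w x < m + \<sigma>" if "norm (x - x0) < 2 * \<rho>" for x
    using \<rho>2(2) that by (auto simp: \<rho>_def dist_norm norm_minus_commute subset_iff)
  define C2 where "C2 = \<bar>F\<bar> + A * kern_tail TYPE('a) s \<rho> + 1"
  have C2: "0 < C2" using A(1) kern_tail_nonneg[OF s, where 'a='a and \<delta>=\<rho>] by (simp add: C2_def add_nonneg_pos)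
  \<comment> \<open>Since \<open>r = R / (1 + A)\<close>, these bounds make
    \<open>N = 1 / r\<^sup>2\<close> exceed \<open>A\<close> and \<open>A / \<rho>\<^sup>2\<close>,
    so the maximum over the unit ball is global and lies within \<open>\<rho>\<close> of
    \<open>x0\<close>. The last bound makes the fixed terms in \<open>C2\<close> at most an eighth
    of the gain.\<close>
  define R where "R = min (min (r0 / 2) (1 / 2)) (min (min (\<rho> / (1 + A)) (\<rho> / t)) ((m * c' / (8 * C2)) powr (1 / (2 * s))))"
  define r where "r = R / (1 + A)"
  have rR: "r * (1 + A) = R" using A(1) by (simp add: r_def)
  have rr: "r * (1 + A) \<le> r0 / 2" "r * (1 + A) \<le> 1 / 2" "r * (1 + A) \<le> \<rho> / (1 + A)" "r * (1 + A) \<le> \<rho> / t"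
     "r * (1 + A) \<le> (m * c' / (8 * C2)) powr (1 / (2 * s))"
    unfolding rR R_def by (simp_all only: min_le_iff_disj order_refl simp_thms)
  have "0 < R" using k \<rho> t m c' C2 A by (simp add: R_def)
  then have r: "0 < r" using A by (simp add: r_def)
  have rle: "r \<le> r * (1 + A)" using r A by simp
  have r_r0: "r < r0" using rle rr(1) k by linarith
  have "r \<le> \<rho> / t" using rle rr(4) by linarith
  then have rt: "t * r \<le> \<rho>" using t by (simp add: pos_le_divide_eq mult.commute)
  have "r \<le> (m * c' / (8 * C2)) powr (1 / (2 * s))" using rle rr(5) by linarith
  then have "r powr (2 * s) \<le> m * c' / (8 * C2)"
    using s r m c' C2 by (intro powr_dominated) auto
  then have r2: "C2 * r powr (2 * s) \<le> m * c' / 8" using C2 by (simp add: field_simps)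
  define N where "N = 1 / r\<^sup>2"
  have N: "0 < N" using r by (simp add: N_def)
  have "r * (1 + A) \<le> 1" using rr(2) by simp
  then have "(r * (1 + A))\<^sup>2 \<le> 1" using r A by (intro power_le_one) auto
  then have "(1 + A)\<^sup>2 * r\<^sup>2 \<le> 1" by (simp only: power_mult_distrib mult.commute)
  then have "(1 + A)\<^sup>2 \<le> N" using r by (simp add: N_def pos_le_divide_eq)
  have A_sq: "A < (1 + A)\<^sup>2" using A(1) by (simp add: power2_eq_square algebra_simps add_pos_pos)
  with \<open>(1 + A)\<^sup>2 \<le> N\<close> have NA: "A < N" by linarith
  have NA\<rho>: "A < N * \<rho>\<^sup>2"
  proof -
    have "r * (1 + A) * (1 + A) \<le> \<rho>" using rr(3) A by (simp add: field_simps)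
    moreover have "r * (1 + A) \<le> r * (1 + A) * (1 + A)" using r A by simp
    ultimately have "r * (1 + A) \<le> \<rho>" by simp
    then have "(r * (1 + A))\<^sup>2 \<le> \<rho>\<^sup>2" using r A by (intro power_mono) auto
    then have "(1 + A)\<^sup>2 * r\<^sup>2 \<le> \<rho>\<^sup>2" by (simp only: power_mult_distrib mult.commute)
    then have "(1 + A)\<^sup>2 \<le> N * \<rho>\<^sup>2" using r by (simp add: N_def pos_le_divide_eq)
    then show ?thesis using A_sq by linarith
  qed
  define \<Phi> where "\<Phi> = (\<lambda>x. w x + - (N * (norm (x - x0))\<^sup>2))"
  have "usc \<Phi>" unfolding \<Phi>_def by (intro usc_add w continuous_imp_usc continuous_intros)
  then have "\<exists>x\<in>cball x0 1. \<forall>y\<in>cball x0 1. \<Phi> y \<le> \<Phi> x" by (intro usc_attains_sup) auto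
  then obtain x where x: "x \<in> cball x0 1" "\<And>y. y \<in> cball x0 1 \<Longrightarrow> \<Phi> y \<le> \<Phi> x" by blast
  have \<Phi>x: "m \<le> \<Phi> x" using x(2)[of x0] by (simp add: \<Phi>_def m_def)
  have max: "\<Phi> y \<le> \<Phi> x" for y
  proof (cases "y \<in> cball x0 1")
    case False
    then have "1 \<le> norm (y - x0)" by (simp add: dist_norm norm_minus_commute)
    then have "N * 1 \<le> N * (norm (y - x0))\<^sup>2" using N by (intro mult_left_mono one_le_power) auto
    then have "\<Phi> y \<le> A - N" using A(2)[of y] by (simp add: \<Phi>_def abs_le_iff)
    then show ?thesis using NA \<Phi>x m by linarith
  qed (use x in auto)
  have Nx: "m + N * (norm (x - x0))\<^sup>2 \<le> w x" using \<Phi>x by (simp add: \<Phi>_def)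
  have wx: "m \<le> w x" using Nx mult_nonneg_nonneg[OF less_imp_le[OF N] zero_le_power2, of "norm (x - x0)"] by linarith
  have "N * (norm (x - x0))\<^sup>2 < N * \<rho>\<^sup>2" using Nx m NA\<rho> A(2)[of x] by linarith
  then have "(norm (x - x0))\<^sup>2 < \<rho>\<^sup>2" using N by simp
  then have x\<rho>: "norm (x - x0) < \<rho>" by (rule power2_less_imp_less) (use \<rho> in simp)
  have "w x < m + \<sigma>" using x\<rho> \<rho> by (intro near\<rho>) simp
  then have "N * (norm (x - x0))\<^sup>2 < (k / 4)\<^sup>2" using Nx \<sigma> by simp
  then have "(norm (x - x0))\<^sup>2 < (k / 4 * r)\<^sup>2" using r by (simp add: N_def power_mult_distrib field_simps)
  then have xr: "norm (x - x0) < k / 4 * r" by (rule power2_less_imp_less) (use k r in simp)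
  obtain y where y: "ball y (k * r) \<subseteq> ball x0 r - \<Omega>" using ball_ex[OF r r_r0] by blast
  have wy: "w z = 0" if "z \<in> ball y (k * r)" for z
  proof -
    have "ball y (k * r) \<inter> closure \<Omega> = {}" using y open_Int_closure_eq_empty[of "ball y (k * r)" \<Omega>] by auto
    then show ?thesis using that out by blast
  qed
  have "x0 \<notin> ball y (k * r)" using wy[of x0] m by (auto simp: m_def)
  then have yx0: "k * r \<le> dist y x0" by simp
  define \<delta> where "\<delta> = t * r"
  have \<delta>: "0 < \<delta>" "\<delta> \<le> \<rho>" using t r rt by (auto simp: \<delta>_def)
  have upper: "trunc_lap s \<delta> w x \<le> F + N * kern_moment TYPE('a) s \<delta>"
  proof (rule sub_atD[OF sub])
    fix z :: 'a
    have "\<Phi> (x + z) \<le> \<Phi> x" by (rule max)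
    moreover have e: "x + z - x0 = (x - x0) + z" by simp
    have "(norm (x + z - x0))\<^sup>2 = (norm (x - x0))\<^sup>2 + 2 * ((x - x0) \<bullet> z) + (norm z)\<^sup>2"
      unfolding e norm_diff_square ..
    ultimately show "w (x + z) \<le> w x + ((2 * N) *\<^sub>R (x - x0)) \<bullet> z + N * (norm z)\<^sup>2"
      by (simp add: \<Phi>_def algebra_simps)
  qed (use wx m N \<delta> in \<open>auto intro: less_add_one\<close>)
  define B where "B = ball (y - x) (k * r / 2)"
  have Bz: "w (x + z) = 0" "\<delta> \<le> norm z" "norm z \<le> 2 * r" if "z \<in> B" for z
  proof -
    have d: "dist y (x + z) < k * r / 2" using that by (simp add: B_def dist_norm algebra_simps)
    then have inb: "x + z \<in> ball y (k * r)" using mult_pos_pos[OF k(1) r] by simp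
    then show "w (x + z) = 0" by (rule wy)
    have "dist y x0 \<le> dist y (x + z) + dist (x + z) x0" by (rule dist_triangle)
    then have "k * r / 2 < dist (x + z) x0" using yx0 d by simp
    moreover have "dist (x + z) x0 \<le> norm (x - x0) + norm z"
      using norm_triangle_ineq[of "x - x0" z] by (simp add: dist_norm algebra_simps)
    ultimately have "k / 4 * r < norm z" using xr by simp
    moreover have "t * r \<le> k / 4 * r" using t(2) r by (intro mult_right_mono) auto
    ultimately show "\<delta> \<le> norm z" by (simp add: \<delta>_def)
    have "dist x0 (x + z) < r" using y inb by auto
    moreover have "norm z \<le> dist x0 (x + z) + norm (x - x0)"
      using norm_triangle_ineq4[of "x + z - x0" "x - x0"] by (simp add: dist_norm norm_minus_commute)
    moreover have "norm (x - x0) < r"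
    proof -
      have "dist x0 y < r"
        using y k r subsetD[OF y, of y] by simp
      moreover have "norm (x - x0) < k * r" using xr mult_pos_pos[OF k(1) r] by simp
      ultimately show ?thesis using yx0 by (simp add: dist_commute)
    qed
    ultimately show "norm z \<le> 2 * r" by simp
  qed
  \<comment> \<open>On the exterior ball \<open>w\<close> vanishes and the integrand gains
    \<open>m\<close>; elsewhere within \<open>\<rho>\<close> it loses at most
    \<open>\<sigma>\<close>, and beyond \<open>\<rho>\<close> at most \<open>A\<close>.\<close>
  have lower: "m * (c' * r powr (- 2 * s)) - \<sigma> * kern_tail TYPE('a) s \<delta> - A * kern_tail TYPE('a) s \<rho> \<le> trunc_lap s \<delta> w x"
  proof -
    have intB: "integrable lborel (\<lambda>z. indicat_real B z * trunc_kern s \<delta> z)"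
    proof (rule integrable_times_trunc_kern(2)[OF s _ \<delta>(1)])
      show "bounded_borel (indicat_real B)"
        unfolding B_def by (intro bounded_borelI[of _ 1] borel_measurable_indicator) auto
    qed
    have "(1 / (2 * r) powr (n + 2 * s)) * measure lborel B \<le> (\<integral>z. indicat_real B z * trunc_kern s \<delta> z \<partial>lborel)"
      unfolding B_def
    proof (rule integral_ge_on_ball, goal_cases)
      case 1
      then show ?case using intB by (simp add: B_def)
    next
      case (3 z)
      then have z: "z \<in> B" by (simp add: B_def)
      have "0 < norm z" using Bz(2)[OF z] \<delta>(1) by linarith
      then have "1 / (2 * r) powr (n + 2 * s) \<le> trunc_kern s \<delta> z"
        using Bz[OF z] \<delta> r s unfolding trunc_kern_def kern_def n_def by (auto intro!: divide_left_mono powr_mono2 mult_pos_pos)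
      then show ?case using z by (simp add: B_def)
    qed simp
    moreover have "measure lborel B = (k * r / 2) powr n * \<omega>"
      unfolding B_def using content_ball_conv_unit_ball[of "k * r / 2" "y - x"] k r by (simp add: \<omega>_def n_def powr_realpow)
    moreover have "(1 / (2 * r) powr (n + 2 * s)) * ((k * r / 2) powr n * \<omega>) = c' * r powr (- 2 * s)"
    proof -
      have "k * r / 2 = (k / 2) * r" by simp
      then have 1: "(k * r / 2) powr n = (k / 2) powr n * r powr n" using k r by (simp only: powr_mult)
      have 2: "1 / (2 * r) powr (n + 2 * s) = 2 powr (- (n + 2 * s)) * r powr (- (n + 2 * s))"
      proof -
        have "1 / (2 * r) powr (n + 2 * s) = (2 * r) powr (- (n + 2 * s))"
          by (subst powr_minus) (simp add: divide_inverse)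
        then show ?thesis using r by (simp only: powr_mult)
      qed
      have 3: "r powr (- (n + 2 * s)) * r powr n = r powr (- 2 * s)" by (simp flip: powr_add)
      show ?thesis unfolding 1 2 c'_def 3[symmetric] by (simp only: mult_ac)
    qed
    ultimately have "c' * r powr (- 2 * s) \<le> (\<integral>z. indicat_real B z * trunc_kern s \<delta> z \<partial>lborel)" by simp
    then have "m * (c' * r powr (- 2 * s)) - \<sigma> * kern_tail TYPE('a) s \<delta> - A * kern_tail TYPE('a) s \<rho>
      \<le> m * (\<integral>z. indicat_real B z * trunc_kern s \<delta> z \<partial>lborel) - \<sigma> * kern_tail TYPE('a) s \<delta> - A * kern_tail TYPE('a) s \<rho>"
      using m by (intro diff_right_mono mult_left_mono) auto
    also have "\<dots> = (\<integral>z. m * (indicat_real B z * trunc_kern s \<delta> z) - \<sigma> * trunc_kern s \<delta> z - A * trunc_kern s \<rho> z \<partial>lborel)"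
      unfolding kern_tail_def using intB s \<delta> \<rho> by simp
    also have "\<dots> \<le> trunc_lap s \<delta> w x"
      unfolding trunc_lap_def
    proof (rule integral_mono)
      show "integrable lborel (\<lambda>z. m * (indicat_real B z * trunc_kern s \<delta> z) - \<sigma> * trunc_kern s \<delta> z - A * trunc_kern s \<rho> z)"
        using intB s \<delta> \<rho> by (intro Bochner_Integration.integrable_diff integrable_mult_right) auto
      show "integrable lborel (\<lambda>z. (w x - w (x + z)) * trunc_kern s \<delta> z)" using s w(1) \<delta>(1) by (rule integrable_trunc)
      fix z :: 'a
      have t0: "0 \<le> \<sigma> * trunc_kern s \<delta> z" "0 \<le> A * trunc_kern s \<rho> z" using \<sigma> A by auto
      show "m * (indicat_real B z * trunc_kern s \<delta> z) - \<sigma> * trunc_kern s \<delta> z - A * trunc_kern s \<rho> z \<le> (w x - w (x + z)) * trunc_kern s \<delta> z"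
      proof (cases "z \<in> B")
        case True
        then have "m * trunc_kern s \<delta> z \<le> (w x - w (x + z)) * trunc_kern s \<delta> z"
          using Bz(1) wx by (intro mult_right_mono) auto
        then show ?thesis using t0 True by simp
      next
        case notB: False
        show ?thesis
        proof (cases "norm z < \<rho>")
          case True
          have "norm (x + z - x0) \<le> norm (x - x0) + norm z"
            using norm_triangle_ineq[of "x - x0" z] by (simp add: algebra_simps)
          then have "w (x + z) < m + \<sigma>" using True x\<rho> by (intro near\<rho>) simp
          then have "(- \<sigma>) * trunc_kern s \<delta> z \<le> (w x - w (x + z)) * trunc_kern s \<delta> z"
            using wx by (intro mult_right_mono) auto
          then show ?thesis using notB t0 by simp
        next
          case False
          have "(- A) * trunc_kern s \<delta> z \<le> (w x - w (x + z)) * trunc_kern s \<delta> z"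
            using A(2)[of "x + z"] wx m by (intro mult_right_mono) (auto simp: abs_le_iff)
          moreover have "trunc_kern s \<rho> z = trunc_kern s \<delta> z" using False \<delta> by (simp add: trunc_kern_def)
          ultimately show ?thesis using notB t0 by simp
        qed
      qed
    qed
    finally show ?thesis .
  qed
  have "\<sigma> * kern_tail TYPE('a) s \<delta> \<le> \<sigma> * (K1 * \<delta> powr (- 2 * s))" using K1(2)[OF \<delta>(1)] \<sigma> by (intro mult_left_mono) auto
  also have "\<dots> = (\<sigma> * (K1 * t powr (- 2 * s))) * r powr (- 2 * s)" using t r by (simp add: \<delta>_def powr_mult)
  also have "\<dots> \<le> (m * c' / 4) * r powr (- 2 * s)" using \<sigma>2 by (intro mult_right_mono) auto
  finally have e1: "\<sigma> * kern_tail TYPE('a) s \<delta> \<le> (m * c' / 4) * r powr (- 2 * s)" .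
  have Npow: "N = r powr (- 2)" using r by (simp add: N_def powr_minus divide_inverse)
  have "N * kern_moment TYPE('a) s \<delta> \<le> N * (K2 * \<delta> powr (2 - 2 * s))" using K2(2)[OF \<delta>(1)] N by (intro mult_left_mono) auto
  also have "\<dots> = (K2 * t powr (2 - 2 * s)) * (r powr (- 2) * r powr (2 - 2 * s))"
    using t r by (simp add: \<delta>_def powr_mult Npow)
  also have "r powr (- 2) * r powr (2 - 2 * s) = r powr (- 2 * s)" by (simp flip: powr_add)
  also have "(K2 * t powr (2 - 2 * s)) * r powr (- 2 * s) \<le> (m * c' / 4) * r powr (- 2 * s)"
    using t2 by (intro mult_right_mono) auto
  finally have e2: "N * kern_moment TYPE('a) s \<delta> \<le> (m * c' / 4) * r powr (- 2 * s)" .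
  have "C2 = C2 * (r powr (2 * s) * r powr (- 2 * s))" using r by (simp flip: powr_add)
  also have "\<dots> = (C2 * r powr (2 * s)) * r powr (- 2 * s)" by simp
  also have "\<dots> \<le> (m * c' / 8) * r powr (- 2 * s)" using r2 by (intro mult_right_mono) auto
  finally have e3: "C2 \<le> (m * c' / 8) * r powr (- 2 * s)" .
  \<comment> \<open>The gain. The three costs are at most a quarter, a quarter and an eighth of it,
    which is less than the whole.\<close>
  define X where "X = (m * c') * r powr (- 2 * s)"
  have X: "0 < X" using m c' r by (simp add: X_def)
  have "X \<le> X / 4 + X / 4 + X / 8"
    using e1 e2 e3 lower upper unfolding X_def C2_def by (simp add: field_simps)
  then show False using X by simp
qed

section \<open>Existence and uniqueness\<close>

lemma usc_lsc_continuous: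
  fixes f :: "'a::topological_space \<Rightarrow> real"
  assumes "usc f" "usc (\<lambda>x. - f x)"
  shows "continuous_on UNIV f"
  unfolding continuous_on_def
proof (intro ballI order_tendstoI)
  fix x a
  show "eventually (\<lambda>y. f y < a) (at x within UNIV)" if "f x < a"
    using assms(1) that unfolding usc_def eventually_at_topological by (intro exI[of _ "{y. f y < a}"]) auto
  show "eventually (\<lambda>y. a < f y) (at x within UNIV)" if "a < f x"
    using assms(2)[unfolded usc_def, rule_format, of "- a"] that
    unfolding eventually_at_topological by (intro exI[of _ "{y. - f y < - a}"]) auto
qed

lemma bounded_borel_compact_support:
  fixes u :: "'a::euclidean_space \<Rightarrow> real"
  assumes "continuous_on UNIV u" "bounded \<Omega>" "\<And>x. x \<notin> \<Omega> \<Longrightarrow> u x = 0"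
  shows "bounded_borel u"
proof -
  obtain R where R: "0 < R" "\<Omega> \<subseteq> ball 0 R" using bounded_subset_ballD[OF assms(2), of 0] by auto
  have "bounded (u ` cball 0 R)"
    using continuous_on_subset[OF assms(1)] by (intro compact_imp_bounded compact_continuous_image) auto
  then obtain M where M: "\<forall>t\<in>u ` cball 0 R. norm t \<le> M" unfolding bounded_iff by blast
  have "\<bar>u x\<bar> \<le> \<bar>M\<bar>" for x
  proof (cases "x \<in> cball 0 R")
    case True
    then have "norm (u x) \<le> M" using M by blast
    then show ?thesis by simp
  next
    case False
    then have "x \<notin> \<Omega>" using R by auto
    then show ?thesis using assms(3) by simp
  qed
  then show ?thesis using borel_measurable_continuous_onI[OF assms(1)] by (rule bounded_borelI[rotated])
qed

text \<open>Continuity at \<open>t\<close> covers the points within \<open>\<kappa>\<close>,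
  monotonicity the remaining points on the favorable side; hence two one-sided bounds on half-lines,
  as the one-sided relaxed limits require.\<close>

lemma powr_right_continuous:
  fixes c p t \<theta> :: real
  assumes "0 < c" "0 < p" "0 \<le> t" "0 < \<theta>"
  obtains \<kappa> where "0 < \<kappa>" "\<And>x. 0 \<le> x \<Longrightarrow> x < t + \<kappa> \<Longrightarrow> c * x powr p \<le> c * t powr p + \<theta>"
    "\<And>x. 0 \<le> x \<Longrightarrow> t - \<kappa> < x \<Longrightarrow> c * t powr p - \<theta> \<le> c * x powr p"
proof -
  have cont: "continuous_on UNIV (\<lambda>x. c * max 0 x powr p)"
    using assms by (intro continuous_on_mult continuous_on_const continuous_powr_pos)
  then obtain \<kappa> where \<kappa>: "0 < \<kappa>" "\<And>x. dist x t < \<kappa> \<Longrightarrow> dist (c * max 0 x powr p) (c * max 0 t powr p) < \<theta>"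
    using assms(4) unfolding continuous_on_iff by (metis UNIV_I)
  show thesis
  proof (rule that[OF \<kappa>(1)])
    fix x :: real assume x: "0 \<le> x"
    have near: "\<bar>c * x powr p - c * t powr p\<bar> < \<theta>" if "\<bar>x - t\<bar> < \<kappa>"
      using \<kappa>(2)[of x] that x assms(3) by (simp add: dist_real_def max_absorb2)
    have mono: "c * x powr p \<le> c * y powr p" if "x \<le> y" "0 \<le> x" for x y
      using that assms by (intro mult_left_mono powr_mono2) auto
    show "c * x powr p \<le> c * t powr p + \<theta>" if "x < t + \<kappa>"
    proof (cases "x \<le> t")
      case True
      then show ?thesis using mono[of x t] x assms(4) by simp
    next
      case False
      then show ?thesis using near that unfolding abs_less_iff by linarith
    qed
    show "c * t powr p - \<theta> \<le> c * x powr p" if "t - \<kappa> < x"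
    proof (cases "t \<le> x")
      case True
      then show ?thesis using mono[of t x] assms(3,4) by simp
    next
      case False
      then show ?thesis using near that unfolding abs_less_iff by linarith
    qed
  qed
qed

section \<open>Barriers, limits and positivity for the system\<close>

context
  fixes s :: real
  assumes s: "0 < s" "s < 1"
begin

text \<open>From a point of \<open>\<Omega>\<close> every increment is nonnegative, and beyond
  distance \<open>2 * R\<close> it equals \<open>A\<close> because \<open>\<Omega>\<close> has been
  left. The bound does not depend on \<open>\<epsilon>\<close>; the jump at the boundary is
  admissible for Borel functions.\<close>

lemma upper_barrier:
  fixes \<Omega> :: "'a::euclidean_space set"
  assumes \<Omega>: "open \<Omega>" "\<Omega> \<subseteq> ball 0 R" and \<epsilon>: "0 < \<epsilon>" "\<epsilon> \<le> 2 * R" and A: "0 \<le> A" and x: "x \<in> \<Omega>"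
  shows "A * kern_tail TYPE('a) s (2 * R) \<le> trunc_lap s \<epsilon> (\<lambda>x. if x \<in> \<Omega> then A else 0) x"
proof -
  define w where "w = (\<lambda>x. if x \<in> \<Omega> then A else 0)"
  have "w \<in> borel_measurable borel" unfolding w_def using \<Omega> by (intro measurable_If_set) auto
  then have w: "bounded_borel w" using A by (intro bounded_borelI[of _ A]) (auto simp: w_def)
  have "A * kern_tail TYPE('a) s (2 * R) \<le> trunc_lap s \<epsilon> w x"
    unfolding kern_tail_def trunc_lap_def integral_mult_right_zero[symmetric]
  proof (rule integral_mono)
    fix z :: 'a
    show "A * trunc_kern s (2 * R) z \<le> (w x - w (x + z)) * trunc_kern s \<epsilon> z"
    proof (cases "2 * R \<le> norm z")
      case True
      have "norm x < R" using x \<Omega>(2) by auto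
      then have "\<not> norm (x + z) < R" using True norm_diff_ineq[of z x] by (simp add: add.commute)
      then have "w (x + z) = 0" using \<Omega>(2) by (auto simp: w_def)
      then show ?thesis using True \<epsilon> x by (simp add: w_def trunc_kern_def)
    next
      case False
      have "0 \<le> (w x - w (x + z)) * trunc_kern s \<epsilon> z" using x A by (intro mult_nonneg_nonneg) (auto simp: w_def)
      then show ?thesis using False by (simp add: trunc_kern_def)
    qed
  qed (use s w \<epsilon> in \<open>auto intro: integrable_trunc\<close>)
  then show ?thesis by (simp add: w_def)
qed

text \<open>The point \<open>x\<close> need only satisfy \<open>0 < relaxed_limsup U x\<close>:
  values \<open>U n y\<close> close to this positive number are nonzero, so \<open>y\<close> lies in
  \<open>\<Omega>\<close>, where the equation holds. Boundary points with a positive limit are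
  thereby included, as the proof of the boundary condition requires.\<close>

lemma relaxed_system_sub:
  fixes U V :: "nat \<Rightarrow> 'a::euclidean_space \<Rightarrow> real"
  assumes U: "\<And>n. bounded_borel (U n)" "\<And>n x. \<bar>U n x\<bar> \<le> M" and V: "\<And>n x. \<bar>V n x\<bar> \<le> M" "\<And>n x. 0 \<le> V n x"
    and out: "\<And>n x. x \<notin> \<Omega> \<Longrightarrow> U n x = 0"
    and \<epsilon>: "\<epsilon> \<longlonglongrightarrow> 0" "\<And>n. 0 < \<epsilon> n" and c: "0 < c" and p: "0 < p"
    and eq: "\<And>n x. x \<in> \<Omega> \<Longrightarrow> trunc_lap s (\<epsilon> n) (U n) x = c * V n x powr p"
    and x: "0 < relaxed_limsup U x" and Vx: "0 \<le> relaxed_limsup V x"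
  shows "sub_at s (relaxed_limsup U) (c * relaxed_limsup V x powr p) x"
proof (rule relaxed_limsup_sub_at[OF s U(2,1) \<epsilon>])
  fix \<theta> :: real assume \<theta>: "0 < \<theta>"
  obtain \<kappa> where \<kappa>: "0 < \<kappa>" "\<And>t. 0 \<le> t \<Longrightarrow> t < relaxed_limsup V x + \<kappa> \<Longrightarrow> c * t powr p \<le> c * relaxed_limsup V x powr p + \<theta>"
    using powr_right_continuous[OF c p Vx \<theta>] by metis
  have "relaxed_limsup V x < relaxed_limsup V x + \<kappa>" using \<kappa> by simp
  from relaxed_limsup_less[OF V(1) this]
  obtain m where m: "\<And>n y. m \<le> n \<Longrightarrow> dist x y < 1 / real (Suc m) \<Longrightarrow> V n y < relaxed_limsup V x + \<kappa>" by blast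
  define d where "d = min (1 / real (Suc m)) (relaxed_limsup U x)"
  have d: "0 < d" "d \<le> 1 / real (Suc m)" "d \<le> relaxed_limsup U x" using x by (auto simp: d_def)
  have "trunc_lap s (\<epsilon> n) (U n) y \<le> c * relaxed_limsup V x powr p + \<theta>"
    if "m \<le> n" "dist x y < d" "\<bar>U n y - relaxed_limsup U x\<bar> < d" for n y
  proof -
    have "U n y \<noteq> 0" using that(3) d x by auto
    then have "y \<in> \<Omega>" using out by blast
    moreover have "V n y < relaxed_limsup V x + \<kappa>" using m[OF that(1)] that(2) d(2) by simp
    ultimately show ?thesis using \<kappa>(2)[OF V(2)] eq by simp
  qed
  then show "\<exists>d>0. \<exists>m. \<forall>n\<ge>m. \<forall>y. dist x y < d \<longrightarrow> \<bar>U n y - relaxed_limsup U x\<bar> < d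
      \<longrightarrow> trunc_lap s (\<epsilon> n) (U n) y \<le> c * relaxed_limsup V x powr p + \<theta>"
    using d(1) by blast
qed

lemma relaxed_system_super:
  fixes U V :: "nat \<Rightarrow> 'a::euclidean_space \<Rightarrow> real"
  assumes U: "\<And>n. bounded_borel (U n)" "\<And>n x. \<bar>U n x\<bar> \<le> M" and V: "\<And>n x. \<bar>V n x\<bar> \<le> M" "\<And>n x. 0 \<le> V n x"
    and \<epsilon>: "\<epsilon> \<longlonglongrightarrow> 0" "\<And>n. 0 < \<epsilon> n" and c: "0 < c" and p: "0 < p" and \<Omega>: "open \<Omega>" "x \<in> \<Omega>"
    and eq: "\<And>n x. x \<in> \<Omega> \<Longrightarrow> trunc_lap s (\<epsilon> n) (U n) x = c * V n x powr p"
    and Vx: "relaxed_limsup (\<lambda>n x. - V n x) x \<le> 0"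
  shows "super_at s (\<lambda>x. - relaxed_limsup (\<lambda>n x. - U n x) x) (c * (- relaxed_limsup (\<lambda>n x. - V n x) x) powr p) x"
proof -
  define vx where "vx = - relaxed_limsup (\<lambda>n x. - V n x) x"
  have vx: "0 \<le> vx" using Vx by (simp add: vx_def)
  have Ub: "\<bar>- U n x\<bar> \<le> M" and Vb: "\<bar>- V n x\<bar> \<le> M" for n x using U(2) V(1) by simp_all
  have "sub_at s (relaxed_limsup (\<lambda>n x. - U n x)) (- (c * vx powr p)) x"
  proof (rule relaxed_limsup_sub_at[OF s Ub _ \<epsilon>])
    show "bounded_borel (\<lambda>x. - U n x)" for n using U(1) by simp
    fix \<theta> :: real assume \<theta>: "0 < \<theta>"
    obtain \<kappa> where \<kappa>: "0 < \<kappa>" "\<And>t. 0 \<le> t \<Longrightarrow> vx - \<kappa> < t \<Longrightarrow> c * vx powr p - \<theta> \<le> c * t powr p"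
      using powr_right_continuous[OF c p vx \<theta>] by metis
    have "relaxed_limsup (\<lambda>n x. - V n x) x < - vx + \<kappa>" using \<kappa> by (simp add: vx_def)
    from relaxed_limsup_less[OF Vb this]
    obtain m where m: "\<And>n y. m \<le> n \<Longrightarrow> dist x y < 1 / real (Suc m) \<Longrightarrow> - V n y < - vx + \<kappa>" by blast
    obtain r where r: "0 < r" "ball x r \<subseteq> \<Omega>" using \<Omega> open_contains_ball by blast
    define d where "d = min (1 / real (Suc m)) r"
    have d: "0 < d" "d \<le> 1 / real (Suc m)" "d \<le> r" using r by (auto simp: d_def)
    have "trunc_lap s (\<epsilon> n) (\<lambda>x. - U n x) y \<le> - (c * vx powr p) + \<theta>"
      if "m \<le> n" "dist x y < d" for n y
    proof -
      have "y \<in> \<Omega>" using that(2) d(3) r(2) by auto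
      moreover have "vx - \<kappa> < V n y" using m[OF that(1), of y] that(2) d(2) by simp
      ultimately show ?thesis using \<kappa>(2)[OF V(2), of n y] eq by simp
    qed
    then show "\<exists>d>0. \<exists>m. \<forall>n\<ge>m. \<forall>y. dist x y < d \<longrightarrow> \<bar>- U n y - relaxed_limsup (\<lambda>n x. - U n x) x\<bar> < d
        \<longrightarrow> trunc_lap s (\<epsilon> n) (\<lambda>x. - U n x) y \<le> - (c * vx powr p) + \<theta>"
      using d(1) by blast
  qed
  then show ?thesis by (simp add: super_at_def vx_def)
qed

text \<open>A nonlocal strong maximum principle. At a zero of the nonnegative \<open>w\<close> the
  constant 0 touches from below, so the weighted average of \<open>w\<close> is at most 0, although
  \<open>w \<ge> m\<close> on a ball within reach of the kernel.\<close>

lemma super_at_positive: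
  fixes w :: "'a::euclidean_space \<Rightarrow> real"
  assumes w: "bounded_borel w" "\<And>x. 0 \<le> w x" and r: "0 < r" and m: "0 < m" "\<And>y. y \<in> ball x1 r \<Longrightarrow> m \<le> w y"
    and x: "r < dist x1 x" and super: "super_at s w 0 x"
  shows "0 < w x"
proof (rule ccontr)
  assume "\<not> 0 < w x"
  then have wx: "w x = 0" using w(2)[of x] by simp
  define \<delta> where "\<delta> = dist x1 x - r"
  have \<delta>: "0 < \<delta>" using x by (simp add: \<delta>_def)
  have "trunc_lap s \<delta> (\<lambda>y. - w y) x \<le> - 0 + 0 * kern_moment TYPE('a) s \<delta>"
    by (rule sub_atD[OF super[unfolded super_at_def] _ \<delta>, where \<rho> = "\<delta> + 1" and b = 0]) (use w(2) wx in auto)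
  then have le: "(\<integral>z. w (x + z) * trunc_kern s \<delta> z \<partial>lborel) \<le> 0"
    using trunc_lap_eq[OF s w(1) \<delta>, of x] wx by simp
  define D where "D = dist x1 x + r"
  have D: "0 < D" using r by (simp add: D_def add_nonneg_pos)
  define k where "k = 1 / D powr (real DIM('a) + 2 * s)"
  have k: "0 < k" using D by (simp add: k_def)
  have "(m * k) * measure lborel (ball (x1 - x) r) \<le> (\<integral>z. w (x + z) * trunc_kern s \<delta> z \<partial>lborel)"
  proof (rule integral_ge_on_ball)
    show "integrable lborel (\<lambda>z. w (x + z) * trunc_kern s \<delta> z)" using s w(1) \<delta> by (intro integrable_times_trunc_kern)
    show "0 \<le> w (x + z) * trunc_kern s \<delta> z" for z using w(2) by simp
    fix z assume "z \<in> ball (x1 - x) r"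
    then have z: "dist x1 (x + z) < r" by (simp add: dist_norm algebra_simps)
    have "dist x1 x \<le> dist x1 (x + z) + dist (x + z) x" by (rule dist_triangle)
    then have z1: "\<delta> \<le> norm z" using z by (simp add: \<delta>_def dist_norm)
    have "dist (x + z) x \<le> dist (x + z) x1 + dist x1 x" by (rule dist_triangle)
    then have z2: "norm z \<le> D" using z by (simp add: D_def dist_norm norm_minus_commute)
    have "0 < norm z" using z1 \<delta> by linarith
    then have "k \<le> trunc_kern s \<delta> z"
      using z1 z2 D s unfolding k_def trunc_kern_def kern_def by (auto intro!: divide_left_mono powr_mono2 mult_pos_pos)
    then show "m * k \<le> w (x + z) * trunc_kern s \<delta> z" using m z k w(2) by (intro mult_mono) auto
  qed
  moreover have "0 < (m * k) * measure lborel (ball (x1 - x) r)"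
    using m k r content_ball_pos[of r "x1 - x"] by simp
  ultimately show False using le by linarith
qed

lemma system_solution_exists:
  fixes \<Omega> :: "'a::euclidean_space set"
  assumes \<Omega>: "smooth_domain \<Omega>" "bounded \<Omega>" and c: "0 < c" and pq: "0 < p" "0 < q" "p * q < 1"
  obtains u v where "continuous_on UNIV u" "continuous_on UNIV v"
    "\<And>x. x \<notin> \<Omega> \<Longrightarrow> u x = 0" "\<And>x. x \<notin> \<Omega> \<Longrightarrow> v x = 0" "\<And>x. x \<in> \<Omega> \<Longrightarrow> 0 < u x" "\<And>x. x \<in> \<Omega> \<Longrightarrow> 0 < v x"
    "\<And>x. x \<in> \<Omega> \<Longrightarrow> sub_at s u (c * v x powr p) x" "\<And>x. x \<in> \<Omega> \<Longrightarrow> sub_at s v (c * u x powr q) x"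
    "\<And>x. x \<in> \<Omega> \<Longrightarrow> super_at s u (c * v x powr p) x" "\<And>x. x \<in> \<Omega> \<Longrightarrow> super_at s v (c * u x powr q) x"
proof (cases "\<Omega> = {}")
  case True
  \<comment> \<open>The empty set counts as a smooth domain; the zero couple satisfies
    everything.\<close>
  then show thesis using that[of "\<lambda>_. 0" "\<lambda>_. 0"] by simp
next
  case False
  have op: "open \<Omega>" using \<Omega>(1) by (simp add: smooth_domain_def)
  obtain R where R: "0 < R" "\<Omega> \<subseteq> ball 0 R" using bounded_subset_ballD[OF \<Omega>(2), of 0] by auto
  obtain x1 where "x1 \<in> \<Omega>" using False by auto
  then obtain r where r: "0 < r" "ball x1 r \<subseteq> \<Omega>" using op open_contains_ball by blast
  define h where "h = (\<lambda>x. max 0 (r\<^sup>2 - (norm (x - x1))\<^sup>2))"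
  have h0: "0 \<le> h x" and hr: "h x \<le> r\<^sup>2" for x by (auto simp: h_def)
  have hcont: "continuous_on UNIV h" unfolding h_def by (intro continuous_intros)
  have hbm: "bounded_borel h" using h0 hr by (intro bounded_borelI[of _ "r\<^sup>2"] borel_measurable_continuous_onI hcont) auto
  have hout: "h x = 0" if "x \<notin> \<Omega>" for x
  proof -
    have "x \<notin> ball x1 r" using that r(2) by blast
    then have "r \<le> norm (x - x1)" by (simp add: dist_norm norm_minus_commute)
    then have "r\<^sup>2 \<le> (norm (x - x1))\<^sup>2" using r(1) by (intro power_mono) auto
    then show ?thesis by (simp add: h_def)
  qed
  have hpos: "0 < h x" if "x \<in> ball x1 r" for x
  proof -
    have "norm (x - x1) < r" using that by (simp add: dist_norm norm_minus_commute)
    then have "(norm (x - x1))\<^sup>2 < r\<^sup>2" by (intro power_strict_mono) auto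
    then show ?thesis by (simp add: h_def)
  qed
  obtain C \<tau> \<epsilon>0 where C: "0 < C" "0 < \<tau>" "0 < \<epsilon>0"
    and hC: "\<And>\<epsilon> x. 0 < \<epsilon> \<Longrightarrow> \<epsilon> \<le> \<epsilon>0 \<Longrightarrow> trunc_lap s \<epsilon> h x \<le> C"
    and h\<tau>: "\<And>\<epsilon> x. 0 < \<epsilon> \<Longrightarrow> \<epsilon> \<le> \<epsilon>0 \<Longrightarrow> h x < \<tau> \<Longrightarrow> trunc_lap s \<epsilon> h x \<le> 0"
    using lower_barrier[OF s r(1), of x1] unfolding h_def by metis
  obtain a b where ab: "0 < a" "0 < b" "a * C \<le> c * (b * \<tau>) powr p" "b * C \<le> c * (a * \<tau>) powr q"
    using small_constants[OF s C(1) c pq C(2)] by metis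
  define L where "L = kern_tail TYPE('a) s (2 * R)"
  have L: "0 < L" unfolding L_def using s R by (intro kern_tail_pos) auto
  obtain A B where AB: "max (a * r\<^sup>2) (b * r\<^sup>2) \<le> A" "max (a * r\<^sup>2) (b * r\<^sup>2) \<le> B" "0 < A" "0 < B"
    "c * B powr p \<le> L * A" "c * A powr q \<le> L * B"
    using large_constants[OF s L c pq] by metis
  \<comment> \<open>Below the thresholds of both barriers: \<open>\<epsilon>0\<close> for the bump
    and \<open>2 * R\<close> for the constants on \<open>\<Omega>\<close>.\<close>
  define \<epsilon> where "\<epsilon> = (\<lambda>n. min \<epsilon>0 (2 * R) * (1 / real (Suc n)))"
  have E0: "0 < min \<epsilon>0 (2 * R)" using C R by simp
  have \<epsilon>pos: "0 < \<epsilon> n" for n unfolding \<epsilon>_def using E0 by (intro mult_pos_pos) auto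
  have \<epsilon>le: "\<epsilon> n \<le> min \<epsilon>0 (2 * R)" for n
    unfolding \<epsilon>_def using E0 mult_left_mono[of "1 / real (Suc n)" 1 "min \<epsilon>0 (2 * R)"] by simp
  have "\<epsilon> \<longlonglongrightarrow> min \<epsilon>0 (2 * R) * 0" unfolding \<epsilon>_def by (intro tendsto_intros LIMSEQ_Suc[OF lim_1_over_n])
  then have \<epsilon>lim: "\<epsilon> \<longlonglongrightarrow> 0" by simp
  have sub0: "trunc_lap s (\<epsilon> n) (\<lambda>x. a' * h x) x \<le> c * (b' * h x) powr e"
    \<comment> \<open>Where \<open>h\<close> is below \<open>\<tau>\<close> the operator is
      nonpositive; elsewhere it is at most \<open>C\<close>, and the right-hand side is at least its
      value at \<open>\<tau>\<close>.\<close>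
    if "0 < a'" "0 < b'" "0 < e" "a' * C \<le> c * (b' * \<tau>) powr e" for a' b' e n x
  proof (cases "h x < \<tau>")
    case True
    have "trunc_lap s (\<epsilon> n) h x \<le> 0" using \<epsilon>pos \<epsilon>le[of n] True by (intro h\<tau>) auto
    then have "a' * trunc_lap s (\<epsilon> n) h x \<le> 0" using that by (simp add: mult_nonneg_nonpos)
    moreover have "0 \<le> c * (b' * h x) powr e" using c by simp
    ultimately show ?thesis by simp
  next
    case False
    have "trunc_lap s (\<epsilon> n) h x \<le> C" using \<epsilon>pos \<epsilon>le[of n] by (intro hC) auto
    then have "a' * trunc_lap s (\<epsilon> n) h x \<le> a' * C" using that by simp
    also have "\<dots> \<le> c * (b' * \<tau>) powr e" by (rule that)
    also have "\<dots> \<le> c * (b' * h x) powr e"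
      using that c C False by (intro mult_left_mono powr_mono2) auto
    finally show ?thesis by simp
  qed
  have "\<exists>u v. bounded_borel u \<and> bounded_borel v \<and> (\<forall>x. a * h x \<le> u x \<and> b * h x \<le> v x \<and> u x \<le> (if x \<in> \<Omega> then A else 0)
      \<and> v x \<le> (if x \<in> \<Omega> then B else 0)) \<and> (\<forall>x\<in>\<Omega>. trunc_lap s (\<epsilon> n) u x = c * v x powr p \<and> trunc_lap s (\<epsilon> n) v x = c * u x powr q)" for n
  proof (rule approximate_solution[OF s op \<epsilon>pos[of n] c pq(1,2), of "\<lambda>x. a * h x" A "\<lambda>x. b * h x" B], goal_cases)
    case (3 x)
    have "a * h x \<le> a * r\<^sup>2" using hr ab by simp
    then show ?case using AB(1) hout by (auto split: if_splits)
  next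
    case (6 x)
    have "b * h x \<le> b * r\<^sup>2" using hr ab by simp
    then show ?case using AB(2) hout by (auto split: if_splits)
  next
    case (9 x)
    then show ?case using upper_barrier[OF op R(2) \<epsilon>pos[of n] _ _ 9, of A] \<epsilon>le[of n] AB by (simp add: L_def mult.commute)
  next
    case (10 x)
    then show ?case using upper_barrier[OF op R(2) \<epsilon>pos[of n] _ _ 10, of B] \<epsilon>le[of n] AB by (simp add: L_def mult.commute)
  next
    case (11 u v)
    then show ?case by (intro exI[of _ u] exI[of _ v]) auto
  qed (use ab h0 hbm sub0 pq in \<open>auto intro: bounded_borel_cmult\<close>)
  then obtain U V where UV: "\<And>n. bounded_borel (U n)" "\<And>n. bounded_borel (V n)" "\<And>n x. a * h x \<le> U n x" "\<And>n x. b * h x \<le> V n x"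
    "\<And>n x. U n x \<le> (if x \<in> \<Omega> then A else 0)" "\<And>n x. V n x \<le> (if x \<in> \<Omega> then B else 0)"
    "\<And>n x. x \<in> \<Omega> \<Longrightarrow> trunc_lap s (\<epsilon> n) (U n) x = c * V n x powr p"
    "\<And>n x. x \<in> \<Omega> \<Longrightarrow> trunc_lap s (\<epsilon> n) (V n) x = c * U n x powr q" by metis
  define M where "M = max A B"
  have U0: "0 \<le> U n x" and V0: "0 \<le> V n x" for n x
    using UV(3,4)[of x n] ab h0[of x] by (auto intro: order_trans[rotated])
  have UM: "\<bar>U n x\<bar> \<le> M" and VM: "\<bar>V n x\<bar> \<le> M" for n x
    using UV(5,6)[of n x] U0[of n x] V0[of n x] AB(3,4) by (auto simp: M_def split: if_splits)
  have Uout: "U n x = 0" and Vout: "V n x = 0" if "x \<notin> \<Omega>" for n x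
    using UV(5,6)[of n x] U0[of n x] V0[of n x] that by auto
  define us where "us = relaxed_limsup U"
  define vs where "vs = relaxed_limsup V"
  define ul where "ul = (\<lambda>x. - relaxed_limsup (\<lambda>n x. - U n x) x)"
  define vl where "vl = (\<lambda>x. - relaxed_limsup (\<lambda>n x. - V n x) x)"
  have basic: "bounded_borel (relaxed_limsup W)" "usc (relaxed_limsup W)"
      "bounded_borel (\<lambda>x. - relaxed_limsup (\<lambda>n x. - W n x) x)" "usc (relaxed_limsup (\<lambda>n x. - W n x))"
      "\<And>x. - relaxed_limsup (\<lambda>n x. - W n x) x \<le> relaxed_limsup W x"
      "\<And>x. k * h x \<le> - relaxed_limsup (\<lambda>n x. - W n x) x"
      "\<And>x. x \<notin> closure \<Omega> \<Longrightarrow> relaxed_limsup W x \<le> 0"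
    if W: "\<And>n x. \<bar>W n x\<bar> \<le> M" "\<And>n x. k * h x \<le> W n x" "\<forall>n x. x \<notin> \<Omega> \<longrightarrow> W n x = 0" for W k
  proof -
    have W': "\<bar>- W n x\<bar> \<le> M" for n x using W(1) by simp
    show usc: "usc (relaxed_limsup W)" "usc (relaxed_limsup (\<lambda>n x. - W n x))"
      by (rule relaxed_limsup_usc, rule W W')+
    show "bounded_borel (relaxed_limsup W)"
      by (rule bounded_borelI[OF usc_measurable[OF usc(1)] relaxed_limsup_abs_le[OF W(1)]])
    have "bounded_borel (relaxed_limsup (\<lambda>n x. - W n x))"
      by (rule bounded_borelI[OF usc_measurable[OF usc(2)] relaxed_limsup_abs_le[OF W']])
    then show "bounded_borel (\<lambda>x. - relaxed_limsup (\<lambda>n x. - W n x) x)" by simp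
    show "- relaxed_limsup (\<lambda>n x. - W n x) x \<le> relaxed_limsup W x" for x
    proof (rule ccontr)
      assume "\<not> ?thesis"
      then obtain t where t: "relaxed_limsup W x < t" "t < - relaxed_limsup (\<lambda>n x. - W n x) x"
        using dense by (auto simp: not_le)
      then have t': "relaxed_limsup (\<lambda>n x. - W n x) x < - t" by simp
      obtain m1 where m1: "\<And>n y. m1 \<le> n \<Longrightarrow> dist x y < 1 / real (Suc m1) \<Longrightarrow> W n y < t"
        using relaxed_limsup_less[OF W(1) t(1)] by blast
      obtain m2 where m2: "\<And>n y. m2 \<le> n \<Longrightarrow> dist x y < 1 / real (Suc m2) \<Longrightarrow> - W n y < - t"
        using relaxed_limsup_less[OF W' t'] by blast
      show False using m1[of "max m1 m2" x] m2[of "max m1 m2" x] by simp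
    qed
    show "k * h x \<le> - relaxed_limsup (\<lambda>n x. - W n x) x" for x
    proof -
      have "relaxed_limsup (\<lambda>n x. - W n x) x \<le> - (k * h x) + e" if e: "0 < e" for e
      proof -
        have "continuous_on UNIV (\<lambda>x. k * h x)" by (intro continuous_intros hcont)
        then obtain d where d: "0 < d" "\<And>y. dist y x < d \<Longrightarrow> dist (k * h y) (k * h x) < e"
          using e unfolding continuous_on_iff by (metis UNIV_I)
        show ?thesis
        proof (rule relaxed_limsup_le'[OF W' d(1)])
          fix n y assume "dist x y < d"
          then have "\<bar>k * h y - k * h x\<bar> < e" using d(2)[of y] by (simp add: dist_commute dist_real_def)
          then show "- W n y \<le> - (k * h x) + e" using W(2)[of y n] unfolding abs_less_iff by linarith
        qed
      qed
      then have "relaxed_limsup (\<lambda>n x. - W n x) x \<le> - (k * h x)" by (rule field_le_epsilon)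
      then show ?thesis by simp
    qed
    show "relaxed_limsup W x \<le> 0" if x: "x \<notin> closure \<Omega>" for x
    proof -
      have "open (- closure \<Omega>)" "x \<in> - closure \<Omega>" using x by auto
      then obtain d where d: "0 < d" "ball x d \<subseteq> - closure \<Omega>" using open_contains_ball by blast
      show ?thesis
      proof (rule relaxed_limsup_le'[OF W(1) d(1)])
        fix n y assume "dist x y < d"
        then have "y \<notin> closure \<Omega>" using d(2) by auto
        then have "y \<notin> \<Omega>" using closure_subset by blast
        then show "W n y \<le> 0" using W(3) by simp
      qed
    qed
  qed
  have "\<forall>n x. x \<notin> \<Omega> \<longrightarrow> U n x = 0" "\<forall>n x. x \<notin> \<Omega> \<longrightarrow> V n x = 0" using Uout Vout by auto
  note bu = basic[of U a, OF UM UV(3) this(1), folded us_def]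
    and bv = basic[of V b, OF VM UV(4) this(2), folded vs_def]
  have ul_ge: "a * h x \<le> ul x" and vl_ge: "b * h x \<le> vl x" for x using bu(6) bv(6) by (auto simp: ul_def vl_def)
  have ul0: "0 \<le> ul x" and vl0: "0 \<le> vl x" for x
    using ul_ge[of x] vl_ge[of x] h0[of x] ab by (meson mult_nonneg_nonneg less_imp_le order_trans)+
  have ul_us: "ul x \<le> us x" and vl_vs: "vl x \<le> vs x" for x using bu(5) bv(5) by (auto simp: ul_def vl_def)
  have us0: "0 \<le> us x" and vs0: "0 \<le> vs x" for x using ul0[of x] vl0[of x] ul_us[of x] vl_vs[of x] by linarith+
  have usub: "sub_at s us (c * vs x powr p) x" if "0 < us x" for x
    unfolding us_def vs_def using that vs0[of x]
    by (intro relaxed_system_sub[OF UV(1) UM VM V0 Uout \<epsilon>lim \<epsilon>pos c pq(1) UV(7)]) (auto simp: us_def vs_def)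
  have vsub: "sub_at s vs (c * us x powr q) x" if "0 < vs x" for x
    unfolding us_def vs_def using that us0[of x]
    by (intro relaxed_system_sub[OF UV(2) VM UM U0 Vout \<epsilon>lim \<epsilon>pos c pq(2) UV(8)]) (auto simp: us_def vs_def)
  have usup: "super_at s ul (c * vl x powr p) x" if "x \<in> \<Omega>" for x
    unfolding ul_def vl_def using that vl0[of x]
    by (intro relaxed_system_super[OF UV(1) UM VM V0 \<epsilon>lim \<epsilon>pos c pq(1) op _ UV(7)]) (auto simp: vl_def)
  have vsup: "super_at s vl (c * ul x powr q) x" if "x \<in> \<Omega>" for x
    unfolding ul_def vl_def using that ul0[of x]
    by (intro relaxed_system_super[OF UV(2) VM UM U0 \<epsilon>lim \<epsilon>pos c pq(2) op _ UV(8)]) (auto simp: ul_def)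
  have us_le: "us x \<le> M" and vs_le: "vs x \<le> M" for x
    using relaxed_limsup_abs_le[of U M x, OF UM] relaxed_limsup_abs_le[of V M x, OF VM]
    by (auto simp: us_def vs_def abs_le_iff)
  \<comment> \<open>At frontier points the subsolution property holds wherever the upper limit is
    positive, inside \<open>\<Omega>\<close> or not, and the bound \<open>M\<close> turns the
    right-hand sides into constants.\<close>
  have zero: "us x \<le> 0 \<and> vs x \<le> 0" if x: "x \<notin> \<Omega>" for x
  proof (cases "x \<in> closure \<Omega>")
    case True
    then have "x \<in> frontier \<Omega>" using x op by (simp add: frontier_def interior_open)
    then have ext: "exterior_ball_at \<Omega> x" using \<Omega>(1) by (rule smooth_domain_exterior_ball[rotated])
    have F: "c * t powr e \<le> c * M powr e" if "0 \<le> t" "t \<le> M" "0 < e" for t e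
      using that c by (intro mult_left_mono powr_mono2) auto
    have "us x \<le> 0"
    proof (rule boundary_value_nonpos[OF s bu(1,2) _ ext])
      show "sub_at s us (c * M powr p) y" if "0 < us y" for y
        using usub[OF that] F[OF vs0 vs_le pq(1)] by (rule sub_at_mono)
      show "us y = 0" if "y \<notin> closure \<Omega>" for y using bu(7)[OF that] us0[of y] by simp
    qed
    moreover have "vs x \<le> 0"
    proof (rule boundary_value_nonpos[OF s bv(1,2) _ ext])
      show "sub_at s vs (c * M powr q) y" if "0 < vs y" for y
        using vsub[OF that] F[OF us0 us_le pq(2)] by (rule sub_at_mono)
      show "vs y = 0" if "y \<notin> closure \<Omega>" for y using bv(7)[OF that] vs0[of y] by simp
    qed
    ultimately show ?thesis by simp
  qed (use bu(7) bv(7) in simp)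
  \<comment> \<open>The lower limits inherit the exterior values, squeezed between 0 and the upper
    limits.\<close>
  have us_out: "us x = 0" and vs_out: "vs x = 0" and ul_out: "ul x = 0" and vl_out: "vl x = 0" if "x \<notin> \<Omega>" for x
    using zero[OF that] us0[of x] vs0[of x] ul_us[of x] vl_vs[of x] ul0[of x] vl0[of x] by linarith+
  have positive: "0 < w x" if w: "bounded_borel w" "\<And>x. k * h x \<le> w x" "0 < k" "super_at s w F x" "0 \<le> F" "x \<in> \<Omega>" for w k F x
  proof (cases "x \<in> ball x1 r")
    case True
    then have "0 < k * h x" using hpos that(3) by simp
    then show ?thesis using w(2)[of x] by linarith
  next
    case False
    show ?thesis
    \<comment> \<open>Half the radius is used so that points outside the ball of radius
      \<open>r\<close> have distance strictly larger than it, and so that the bump has the explicit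
      lower bound \<open>3 * r\<^sup>2 / 4\<close>.\<close>
    proof (rule super_at_positive[where r = "r / 2" and ?x1.0 = x1 and m = "k * (3 * r\<^sup>2 / 4)"])
      show "0 \<le> w y" for y using w(2)[of y] h0[of y] w(3) by (meson mult_nonneg_nonneg less_imp_le order_trans)
      show "k * (3 * r\<^sup>2 / 4) \<le> w y" if "y \<in> ball x1 (r / 2)" for y
      proof -
        have "norm (y - x1) < r / 2" using that by (simp add: dist_norm norm_minus_commute)
        then have "(norm (y - x1))\<^sup>2 \<le> (r / 2)\<^sup>2" by (intro power_mono) auto
        moreover have "(r / 2)\<^sup>2 = r\<^sup>2 / 4" by (simp add: power_divide)
        moreover have "r\<^sup>2 - (norm (y - x1))\<^sup>2 \<le> h y" by (simp add: h_def)
        ultimately have "3 * r\<^sup>2 / 4 \<le> h y" by linarith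
        then have "k * (3 * r\<^sup>2 / 4) \<le> k * h y" using w(3) by (intro mult_left_mono) auto
        then show ?thesis using w(2)[of y] by linarith
      qed
      show "super_at s w 0 x" using w(4,5) unfolding super_at_def by (elim sub_at_mono) simp
    qed (use w r False in auto)
  qed
  have ulpos: "0 < ul x" and vlpos: "0 < vl x" if "x \<in> \<Omega>" for x
  proof -
    have ubm: "bounded_borel ul" "bounded_borel vl" using bu(3) bv(3) by (auto simp: ul_def vl_def)
    show "0 < ul x" by (rule positive[OF ubm(1) ul_ge ab(1) usup[OF that] _ that]) (use c in simp)
    show "0 < vl x" by (rule positive[OF ubm(2) vl_ge ab(2) vsup[OF that] _ that]) (use c in simp)
  qed
  have pos: "0 < us x" "0 < vs x" if "x \<in> \<Omega>" for x
    using ulpos[OF that] vlpos[OF that] ul_us[of x] vl_vs[of x] by linarith+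
  have lsc: "usc (\<lambda>x. - ul x)" "usc (\<lambda>x. - vl x)" "bounded_borel ul" "bounded_borel vl"
    using bu(3,4) bv(3,4) by (auto simp: ul_def vl_def)
  have usub': "sub_at s us (c * vs x powr p) x" and vsub': "sub_at s vs (c * us x powr q) x" if "x \<in> \<Omega>" for x
    using usub vsub pos[OF that] by auto
  \<comment> \<open>The upper limits act as subsolutions, the lower ones as supersolutions. As the
    lower limits lie below the upper ones by construction, the couples coincide and are
    continuous.\<close>
  have le: "us x \<le> ul x" "vs x \<le> vl x" for x
    by (rule system_comparison[OF s op \<Omega>(2) c pq, of us vs ul vl];
        fact bu bv lsc us_out vs_out ul_out vl_out us0 vs0 ulpos vlpos usub' vsub' usup vsup)+
  have eq: "us = ul" "vs = vl" using le ul_us vl_vs by (auto intro!: ext antisym)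
  show thesis
  proof (rule that[of us vs])
    show "continuous_on UNIV us" using bu(2) lsc(1) unfolding eq by (intro usc_lsc_continuous)
    show "continuous_on UNIV vs" using bv(2) lsc(2) unfolding eq by (intro usc_lsc_continuous)
    show "super_at s us (c * vs x powr p) x" "super_at s vs (c * us x powr q) x" if "x \<in> \<Omega>" for x
      using usup[OF that] vsup[OF that] by (simp_all add: eq)
  qed (use us_out vs_out pos usub vsub in auto)
qed

end

section \<open>Translation to and from positive viscosity solutions\<close>

lemma powr_diff_one_mult:
  fixes v p :: real
  assumes "0 \<le> v" shows "v powr (p - 1) * v = v powr p"
  using powr_mult_base[OF assms, of "p - 1"] by (simp add: mult.commute)

text \<open>The factor \<open>c\<close> is the reciprocal of the constant \<open>C(n,s)\<close>,
  which the pointwise notion omits. Boundedness of \<open>\<Omega>\<close> makes the closure of the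
  prescribed neighborhood compact, and nonnegativity removes the absolute values from the
  powers.\<close>

lemma positive_viscosity_solutionD:
  fixes u v :: "real^'n::{finite,wellorder} \<Rightarrow> real"
  assumes s: "0 < s" "s < 1" and \<Omega>: "bounded \<Omega>"
    and sol: "positive_viscosity_solution s p q \<Omega> u v"
  defines "c \<equiv> inverse (frac_const TYPE('n) s)"
  shows "continuous_on UNIV u" "continuous_on UNIV v" "\<And>x. x \<notin> \<Omega> \<Longrightarrow> u x = 0" "\<And>x. x \<notin> \<Omega> \<Longrightarrow> v x = 0"
    "\<And>x. x \<in> \<Omega> \<Longrightarrow> 0 < u x" "\<And>x. x \<in> \<Omega> \<Longrightarrow> 0 < v x" "\<And>x. 0 \<le> u x" "\<And>x. 0 \<le> v x" "bounded_borel u" "bounded_borel v"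
    "\<And>x. x \<in> \<Omega> \<Longrightarrow> sub_at s u (c * v x powr p) x" "\<And>x. x \<in> \<Omega> \<Longrightarrow> sub_at s v (c * u x powr q) x"
    "\<And>x. x \<in> \<Omega> \<Longrightarrow> super_at s u (c * v x powr p) x" "\<And>x. x \<in> \<Omega> \<Longrightarrow> super_at s v (c * u x powr q) x"
proof -
  have sub: "viscosity_subsolution s p q \<Omega> u v" and super: "viscosity_supersolution s p q \<Omega> u v"
    and pos: "\<And>x. x \<in> \<Omega> \<Longrightarrow> 0 < u x" "\<And>x. x \<in> \<Omega> \<Longrightarrow> 0 < v x" "\<And>x. 0 \<le> u x" "\<And>x. 0 \<le> v x"
    using sol by (auto simp: positive_viscosity_solution_def viscosity_solution_def)
  show "\<And>x. x \<in> \<Omega> \<Longrightarrow> 0 < u x" "\<And>x. x \<in> \<Omega> \<Longrightarrow> 0 < v x" "\<And>x. 0 \<le> u x" "\<And>x. 0 \<le> v x" by (fact pos)+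
  have adm: "admissible_couple \<Omega> u v" using sub by (simp add: viscosity_subsolution_def)
  show cont: "continuous_on UNIV u" "continuous_on UNIV v"
    and out: "\<And>x. x \<notin> \<Omega> \<Longrightarrow> u x = 0" "\<And>x. x \<notin> \<Omega> \<Longrightarrow> v x = 0"
    using adm by (auto simp: admissible_couple_def)
  show bms: "bounded_borel u" "bounded_borel v"
    by (rule bounded_borel_compact_support[OF cont(1) \<Omega> out(1)], simp,
        rule bounded_borel_compact_support[OF cont(2) \<Omega> out(2)], simp)
  have C: "frac_const TYPE('n) s * (c * t) = t" for t
    using frac_const_pos[OF s, where 'n='n] by (simp add: c_def)
  have cpt: "compact (closure W)" if "closure W \<subseteq> \<Omega>" for W
    using bounded_subset[OF \<Omega> that] by (simp add: compact_eq_bounded_closed)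
  fix x assume x: "x \<in> \<Omega>"
  obtain W where W: "open W" "x \<in> W" "closure W \<subseteq> \<Omega>"
    "\<And>\<phi>. test_above W x u \<phi> \<Longrightarrow> frac_laplacian s (glue W \<phi> u) x \<le> \<bar>v x\<bar> powr (p - 1) * v x"
    "\<And>\<psi>. test_above W x v \<psi> \<Longrightarrow> frac_laplacian s (glue W \<psi> v) x \<le> \<bar>u x\<bar> powr (q - 1) * u x"
    using sub x unfolding viscosity_subsolution_def by blast
  show "sub_at s u (c * v x powr p) x"
    using W(4) by (intro viscosity_imp_sub_at[OF s W(1,2) cpt[OF W(3)] bms(1) cont(1)]) (simp add: C powr_diff_one_mult pos)
  show "sub_at s v (c * u x powr q) x"
    using W(5) by (intro viscosity_imp_sub_at[OF s W(1,2) cpt[OF W(3)] bms(2) cont(2)]) (simp add: C powr_diff_one_mult pos)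
  obtain W where W: "open W" "x \<in> W" "closure W \<subseteq> \<Omega>"
    "\<And>\<phi>. test_below W x u \<phi> \<Longrightarrow> frac_laplacian s (glue W \<phi> u) x \<ge> \<bar>v x\<bar> powr (p - 1) * v x"
    "\<And>\<psi>. test_below W x v \<psi> \<Longrightarrow> frac_laplacian s (glue W \<psi> v) x \<ge> \<bar>u x\<bar> powr (q - 1) * u x"
    using super x unfolding viscosity_supersolution_def by blast
  show "super_at s u (c * v x powr p) x"
    using W(4) by (intro viscosity_imp_super_at[OF s W(1,2) cpt[OF W(3)] bms(1) cont(1)]) (simp add: C powr_diff_one_mult pos)
  show "super_at s v (c * u x powr q) x"
    using W(5) by (intro viscosity_imp_super_at[OF s W(1,2) cpt[OF W(3)] bms(2) cont(2)]) (simp add: C powr_diff_one_mult pos)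
qed

lemma positive_viscosity_solutionI:
  fixes u v :: "real^'n::{finite,wellorder} \<Rightarrow> real"
  assumes s: "0 < s" "s < 1" and \<Omega>: "bounded \<Omega>" "open \<Omega>"
  defines "c \<equiv> inverse (frac_const TYPE('n) s)"
  assumes cont: "continuous_on UNIV u" "continuous_on UNIV v"
    and out: "\<And>x. x \<notin> \<Omega> \<Longrightarrow> u x = 0" "\<And>x. x \<notin> \<Omega> \<Longrightarrow> v x = 0"
    and pos: "\<And>x. x \<in> \<Omega> \<Longrightarrow> 0 < u x" "\<And>x. x \<in> \<Omega> \<Longrightarrow> 0 < v x"
    and sub: "\<And>x. x \<in> \<Omega> \<Longrightarrow> sub_at s u (c * v x powr p) x" "\<And>x. x \<in> \<Omega> \<Longrightarrow> sub_at s v (c * u x powr q) x"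
    and super: "\<And>x. x \<in> \<Omega> \<Longrightarrow> super_at s u (c * v x powr p) x" "\<And>x. x \<in> \<Omega> \<Longrightarrow> super_at s v (c * u x powr q) x"
  shows "positive_viscosity_solution s p q \<Omega> u v"
proof -
  have adm: "admissible_couple \<Omega> u v" using cont out by (simp add: admissible_couple_def)
  have nonneg: "0 \<le> u x" "0 \<le> v x" for x using out[of x] pos[of x] by (cases "x \<in> \<Omega>"; simp add: less_imp_le)+
  have bms: "bounded_borel u" "bounded_borel v"
    by (rule bounded_borel_compact_support[OF cont(1) \<Omega>(1) out(1)], simp,
        rule bounded_borel_compact_support[OF cont(2) \<Omega>(1) out(2)], simp)
  have C: "frac_const TYPE('n) s * (c * t) = t" for t
    using frac_const_pos[OF s, where 'n='n] by (simp add: c_def)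
  \<comment> \<open>Since \<open>sub_at\<close> and \<open>super_at\<close> refer to no
    neighborhood, any ball with closure in \<open>\<Omega>\<close> serves for all test
    functions.\<close>
  have nbhd: "\<exists>W. open W \<and> x \<in> W \<and> closure W \<subseteq> \<Omega> \<and> compact (closure W)" if x: "x \<in> \<Omega>" for x
  proof -
    obtain r where r: "0 < r" "cball x r \<subseteq> \<Omega>" using x \<Omega>(2) open_contains_cball by blast
    then show ?thesis by (intro exI[of _ "ball x r"]) auto
  qed
  have "viscosity_subsolution s p q \<Omega> u v"
    unfolding viscosity_subsolution_def
  proof (intro conjI adm ballI)
    fix x assume x: "x \<in> \<Omega>"
    then obtain W where W: "open W" "x \<in> W" "compact (closure W)" "closure W \<subseteq> \<Omega>" using nbhd by blast
    show "\<exists>U. open U \<and> x \<in> U \<and> closure U \<subseteq> \<Omega> \<and>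
        (\<forall>\<phi>. test_above U x u \<phi> \<longrightarrow> frac_laplacian s (glue U \<phi> u) x \<le> \<bar>v x\<bar> powr (p - 1) * v x) \<and>
        (\<forall>\<psi>. test_above U x v \<psi> \<longrightarrow> frac_laplacian s (glue U \<psi> v) x \<le> \<bar>u x\<bar> powr (q - 1) * u x)"
      using sub_at_imp_viscosity[OF s W(1-3) bms(1) sub(1)[OF x]] sub_at_imp_viscosity[OF s W(1-3) bms(2) sub(2)[OF x]]
      by (intro exI[of _ W] conjI W allI impI) (simp_all add: C powr_diff_one_mult nonneg)
  qed
  moreover have "viscosity_supersolution s p q \<Omega> u v"
    unfolding viscosity_supersolution_def
  proof (intro conjI adm ballI)
    fix x assume x: "x \<in> \<Omega>"
    then obtain W where W: "open W" "x \<in> W" "compact (closure W)" "closure W \<subseteq> \<Omega>" using nbhd by blast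
    show "\<exists>U. open U \<and> x \<in> U \<and> closure U \<subseteq> \<Omega> \<and>
        (\<forall>\<phi>. test_below U x u \<phi> \<longrightarrow> frac_laplacian s (glue U \<phi> u) x \<ge> \<bar>v x\<bar> powr (p - 1) * v x) \<and>
        (\<forall>\<psi>. test_below U x v \<psi> \<longrightarrow> frac_laplacian s (glue U \<psi> v) x \<ge> \<bar>u x\<bar> powr (q - 1) * u x)"
      using super_at_imp_viscosity[OF s W(1-3) bms(1) super(1)[OF x]] super_at_imp_viscosity[OF s W(1-3) bms(2) super(2)[OF x]]
      by (intro exI[of _ W] conjI W allI impI) (simp_all add: C powr_diff_one_mult nonneg)
  qed
  ultimately show ?thesis using pos nonneg by (simp add: positive_viscosity_solution_def viscosity_solution_def)
qed

theorem theorem1p1: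
  fixes \<Omega> :: "(real^'n::{finite,wellorder}) set" and s p q :: real
  assumes "smooth_domain \<Omega>" and "bounded \<Omega>"
    and "0 < s" and "s < 1"
    and "p > 0" and "q > 0" and "p * q < 1"
  shows "\<exists>!(u, v). positive_viscosity_solution s p q \<Omega> u v"
proof -
  note s = assms(3,4) and pq = assms(5-7)
  have op: "open \<Omega>" using assms(1) by (simp add: smooth_domain_def)
  define c where "c = inverse (frac_const TYPE('n) s)"
  have c: "0 < c" using frac_const_pos[OF s, where 'n='n] by (simp add: c_def)
  obtain u v where uv: "continuous_on UNIV u" "continuous_on UNIV v"
    "\<And>x. x \<notin> \<Omega> \<Longrightarrow> u x = 0" "\<And>x. x \<notin> \<Omega> \<Longrightarrow> v x = 0" "\<And>x. x \<in> \<Omega> \<Longrightarrow> 0 < u x" "\<And>x. x \<in> \<Omega> \<Longrightarrow> 0 < v x"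
    "\<And>x. x \<in> \<Omega> \<Longrightarrow> sub_at s u (c * v x powr p) x" "\<And>x. x \<in> \<Omega> \<Longrightarrow> sub_at s v (c * u x powr q) x"
    "\<And>x. x \<in> \<Omega> \<Longrightarrow> super_at s u (c * v x powr p) x" "\<And>x. x \<in> \<Omega> \<Longrightarrow> super_at s v (c * u x powr q) x"
    using system_solution_exists[OF s assms(1,2) c pq] by blast
  have ex: "positive_viscosity_solution s p q \<Omega> u v"
    by (rule positive_viscosity_solutionI[OF s assms(2) op uv[unfolded c_def]])
  \<comment> \<open>Each solution is both a sub- and a supersolution, so this one-sided comparison,
    used with the roles exchanged, gives equality.\<close>
  have le: "u1 x \<le> u2 x \<and> v1 x \<le> v2 x"
    if "positive_viscosity_solution s p q \<Omega> u1 v1" "positive_viscosity_solution s p q \<Omega> u2 v2" for u1 v1 u2 v2 x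
  proof -
    note a = positive_viscosity_solutionD[OF s assms(2) that(1), folded c_def]
      and b = positive_viscosity_solutionD[OF s assms(2) that(2), folded c_def]
    have usc: "usc u1" "usc v1" "usc (\<lambda>x. - u2 x)" "usc (\<lambda>x. - v2 x)"
      using a(1,2) b(1,2) by (auto intro: continuous_imp_usc continuous_on_minus)
    have "u1 x \<le> u2 x" "v1 x \<le> v2 x"
      by (rule system_comparison[OF s op assms(2) c pq, of u1 v1 u2 v2]; fact a b usc)+
    then show ?thesis ..
  qed
  show ?thesis
  proof (rule ex1I[of _ "(u, v)"])
    show "case (u, v) of (u, v) \<Rightarrow> positive_viscosity_solution s p q \<Omega> u v" using ex by simp
    fix w assume w: "case w of (u, v) \<Rightarrow> positive_viscosity_solution s p q \<Omega> u v"
    obtain u' v' where w': "w = (u', v')" by (cases w)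
    then have sol: "positive_viscosity_solution s p q \<Omega> u' v'" using w by simp
    have "u' = u" "v' = v" using le[OF sol ex] le[OF ex sol] by (auto intro!: ext antisym)
    then show "w = (u, v)" using w' by simp
  qed
qed

end
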